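(* For every $n\geq1$ there is an equivalence of $C_2$-spaces $$\Omega^\sigma Gr_n(\mathbb{C}^\infty)_\tau\simeq U(n)_\tau.$$
   Context: $\sigma$ is the sign representation of $C_2$, $S^\sigma$ its one-point compactification. For a based $C_2$-space $Y$, $\Omega^\sigma Y=\mathrm{Map}_*(S^\sigma,Y)$ with conjugation action. $Gr_n(\mathbb{C}^\infty)_\tau$ is the Grassmannian of complex $n$-dimensional subspaces of $\mathbb{C}^\infty$ with $C_2$-action by complex conjugation $W\mapsto\overline{W}$. $U(n)_\tau$ is the unitary group with $C_2$-action by transposition $A\mapsto A^T$. Equivalence of $C_2$-spaces means weak equivalence on underlying spaces and on $C_2$-fixed points. *)

theory Defs
  imports "HOL-Analysis.Analysis" "HOL-Library.Poly_Mapping"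
begin

section \<open>Weak homotopy equivalences\<close>

definition sphere_pt :: "nat \<Rightarrow> real" where
  "sphere_pt = (\<lambda>i. if i = 0 then 1 else 0)"

definition based_homotopic ::
  "nat \<Rightarrow> 'a topology \<Rightarrow> 'a \<Rightarrow> (((nat \<Rightarrow> real) \<Rightarrow> 'a) \<times> ((nat \<Rightarrow> real) \<Rightarrow> 'a)) set" where
  "based_homotopic k X x =
     {(g, h). homotopic_with (\<lambda>u. u sphere_pt = x) (nsphere k) X g h}"

text \<open>The underlying set of the homotopy group \<open>\<pi>\<^sub>k(X, x)\<close>: based maps
  \<open>S\<^sup>k \<rightarrow> X\<close> modulo based homotopy.\<close>

definition homotopy_classes ::
  "nat \<Rightarrow> 'a topology \<Rightarrow> 'a \<Rightarrow> ((nat \<Rightarrow> real) \<Rightarrow> 'a) set set" where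
  "homotopy_classes k X x =
     {g. continuous_map (nsphere k) X g \<and> g sphere_pt = x} // based_homotopic k X x"

definition homotopy_classes_map ::
  "nat \<Rightarrow> 'b topology \<Rightarrow> ('a \<Rightarrow> 'b) \<Rightarrow> 'a \<Rightarrow>
     ((nat \<Rightarrow> real) \<Rightarrow> 'a) set \<Rightarrow> ((nat \<Rightarrow> real) \<Rightarrow> 'b) set" where
  "homotopy_classes_map k Y f x C = based_homotopic k Y (f x) `` ((\<lambda>g. f \<circ> g) ` C)"

definition path_components_map ::
  "'b topology \<Rightarrow> ('a \<Rightarrow> 'b) \<Rightarrow> 'a set \<Rightarrow> 'b set" where
  "path_components_map Y f C = (\<Union>x\<in>C. path_component_of_set Y (f x))"

text \<open>The map induced on \<open>\<pi>\<^sub>k\<close>, \<open>k \<ge> 1\<close>, is always a group homomorphism, so it is an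
  isomorphism as soon as it is bijective; hence no group structure is needed here.\<close>

definition weak_equivalence :: "'a topology \<Rightarrow> 'b topology \<Rightarrow> ('a \<Rightarrow> 'b) \<Rightarrow> bool" where
  "weak_equivalence X Y f \<longleftrightarrow>
     continuous_map X Y f \<and>
     bij_betw (path_components_map Y f) (path_components_of X) (path_components_of Y) \<and>
     (\<forall>x\<in>topspace X. \<forall>k\<ge>1.
        bij_betw (homotopy_classes_map k Y f x)
          (homotopy_classes k X x) (homotopy_classes k Y (f x)))"

section \<open>Spaces with an action of the group of order two\<close>

text \<open>A space together with the action of the generator.\<close>

type_synonym 'a C2space = "'a topology \<times> ('a \<Rightarrow> 'a)"

abbreviation underlying :: "'a C2space \<Rightarrow> 'a topology" where
  "underlying X \<equiv> fst X"

abbreviation act :: "'a C2space \<Rightarrow> 'a \<Rightarrow> 'a" where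
  "act X \<equiv> snd X"

definition C2_space :: "'a C2space \<Rightarrow> bool" where
  "C2_space X \<longleftrightarrow>
     continuous_map (underlying X) (underlying X) (act X) \<and>
     (\<forall>x\<in>topspace (underlying X). act X (act X x) = x)"

definition fixed_points :: "'a C2space \<Rightarrow> 'a topology" where
  "fixed_points X =
     subtopology (underlying X) {x \<in> topspace (underlying X). act X x = x}"

definition C2_weak_equivalence :: "'a C2space \<Rightarrow> 'b C2space \<Rightarrow> ('a \<Rightarrow> 'b) \<Rightarrow> bool" where
  "C2_weak_equivalence X Y f \<longleftrightarrow>
     C2_space X \<and> C2_space Y \<and>
     (\<forall>x\<in>topspace (underlying X). f (act X x) = act Y (f x)) \<and>
     weak_equivalence (underlying X) (underlying Y) f \<and>
     weak_equivalence (fixed_points X) (fixed_points Y) f"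

text \<open>Equivalence of \<open>C\<^sub>2\<close>-spaces: the existence of a zigzag of equivariant maps that are weak
  equivalences on underlying spaces and on fixed points. Higher-order logic does not allow
  intermediate spaces of arbitrary varying types, so they are taken on subsets of
  \<open>'a + 'b\<close>, where both end points have isomorphic copies.\<close>

definition C2_equivalent :: "'a C2space \<Rightarrow> 'b C2space \<Rightarrow> bool" where
  "C2_equivalent X Y \<longleftrightarrow>
     (\<exists>(A :: ('a + 'b) C2space) B p q.
        C2_weak_equivalence A X p \<and>
        equivclp (\<lambda>V W. \<exists>f. C2_weak_equivalence V W f) A B \<and>
        C2_weak_equivalence B Y q)"

section \<open>The signed loop space\<close>

text \<open>The one-point compactification of the sign representation; \<open>None\<close> is the point at
  infinity, which is the base point.\<close>

definition sign_sphere :: "real option C2space" where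
  "sign_sphere = (Alexandroff_compactification euclideanreal, map_option uminus)"

lemma topspace_sign_sphere [simp]: "topspace (underlying sign_sphere) = UNIV"
  by (simp add: sign_sphere_def UNIV_option_conv)

definition sign_loops :: "'a topology \<Rightarrow> 'a \<Rightarrow> (real option \<Rightarrow> 'a) set" where
  "sign_loops Y y = {f. continuous_map (underlying sign_sphere) Y f \<and> f None = y}"

definition sign_loop_topology :: "'a topology \<Rightarrow> 'a \<Rightarrow> (real option \<Rightarrow> 'a) topology" where
  "sign_loop_topology Y y = topology_generated_by
     {{f \<in> sign_loops Y y. f ` K \<subseteq> U} | K U.
        compactin (underlying sign_sphere) K \<and> openin Y U}"

lemma topspace_sign_loop_topology [simp]:
  "topspace (sign_loop_topology Y y) = sign_loops Y y"
proof -
  have "sign_loops Y y \<in> {{f \<in> sign_loops Y y. f ` K \<subseteq> U} | K U.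
          compactin (underlying sign_sphere) K \<and> openin Y U}"
    by (intro CollectI exI[of _ "{}"]) auto
  then show ?thesis
    unfolding sign_loop_topology_def topology_generated_by_topspace by blast
qed

definition Omega_sigma :: "'a C2space \<Rightarrow> 'a \<Rightarrow> (real option \<Rightarrow> 'a) C2space" where
  "Omega_sigma Y y =
     (sign_loop_topology (underlying Y) y, \<lambda>f. act Y \<circ> f \<circ> act sign_sphere)"

section \<open>The infinite complex Grassmannian\<close>

text \<open>\<open>\<complex>\<^sup>\<infinity>\<close> is the space of finitely supported complex sequences.\<close>

type_synonym cinf = "nat \<Rightarrow>\<^sub>0 complex"

definition cinf_scale :: "complex \<Rightarrow> cinf \<Rightarrow> cinf" where
  "cinf_scale c v = Poly_Mapping.map (\<lambda>z. c * z) v"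

lemma lookup_cinf_scale [simp]:
  "Poly_Mapping.lookup (cinf_scale c v) i = c * Poly_Mapping.lookup v i"
  by (simp add: cinf_scale_def Poly_Mapping.map.rep_eq when_def)

global_interpretation cinf: vector_space cinf_scale
  by unfold_locales (auto intro!: poly_mapping_eqI simp: lookup_add algebra_simps)

definition cinf_cnj :: "cinf \<Rightarrow> cinf" where
  "cinf_cnj v = Poly_Mapping.map cnj v"

lemma lookup_cinf_cnj [simp]:
  "Poly_Mapping.lookup (cinf_cnj v) i = cnj (Poly_Mapping.lookup v i)"
  by (simp add: cinf_cnj_def Poly_Mapping.map.rep_eq when_def)

text \<open>\<open>\<complex>\<^sup>m \<subseteq> \<complex>\<^sup>\<infinity>\<close>, the vectors supported on the first \<open>m\<close> coordinates,
  with its Euclidean topology.\<close>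

definition cfin :: "nat \<Rightarrow> cinf set" where
  "cfin m = {v. Poly_Mapping.keys v \<subseteq> {..<m}}"

definition cfin_topology :: "nat \<Rightarrow> cinf topology" where
  "cfin_topology m = pullback_topology (cfin m) Poly_Mapping.lookup euclidean"

text \<open>The space of linearly independent \<open>n\<close>-frames in \<open>\<complex>\<^sup>m\<close>.\<close>

definition frame_topology :: "nat \<Rightarrow> nat \<Rightarrow> (nat \<Rightarrow> cinf) topology" where
  "frame_topology n m =
     subtopology (product_topology (\<lambda>_. cfin_topology m) {..<n})
       {F. inj_on F {..<n} \<and> cinf.independent (F ` {..<n})}"

text \<open>\<open>cinf.dim\<close> is \<open>0\<close> on infinite-dimensional subspaces, so these are the intended sets
  only for \<open>n \<ge> 1\<close>.\<close>

definition grassmannian :: "nat \<Rightarrow> cinf set set" where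
  "grassmannian n = {W. cinf.subspace W \<and> cinf.dim W = n}"

text \<open>\<open>Gr\<^sub>n(\<complex>\<^sup>m)\<close> has the quotient topology along the map sending a frame to its span.\<close>

definition grassmannian_fin_open :: "nat \<Rightarrow> nat \<Rightarrow> cinf set set \<Rightarrow> bool" where
  "grassmannian_fin_open n m \<U> \<longleftrightarrow>
     \<U> \<subseteq> {W \<in> grassmannian n. W \<subseteq> cfin m} \<and>
     openin (frame_topology n m)
       {F \<in> topspace (frame_topology n m). cinf.span (F ` {..<n}) \<in> \<U>}"

text \<open>\<open>Gr\<^sub>n(\<complex>\<^sup>\<infinity>)\<close> is the colimit of its subspaces \<open>Gr\<^sub>n(\<complex>\<^sup>m)\<close>.\<close>

definition grassmannian_open :: "nat \<Rightarrow> cinf set set \<Rightarrow> bool" where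
  "grassmannian_open n \<U> \<longleftrightarrow>
     \<U> \<subseteq> grassmannian n \<and> (\<forall>m. grassmannian_fin_open n m {W \<in> \<U>. W \<subseteq> cfin m})"

definition grassmannian_topology :: "nat \<Rightarrow> cinf set topology" where
  "grassmannian_topology n = topology (grassmannian_open n)"

lemma cfin_subspace: "cinf.subspace (cfin m)"
proof -
  have iff: "v \<in> cfin m \<longleftrightarrow> (\<forall>i\<ge>m. Poly_Mapping.lookup v i = 0)" for v
    by (auto simp: cfin_def in_keys_iff subset_iff not_le[symmetric])
  show ?thesis
    unfolding cinf.subspace_def by (auto simp: iff lookup_add)
qed

lemma frame_span_in_grassmannian:
  assumes "F \<in> topspace (frame_topology n m)"
  shows "cinf.span (F ` {..<n}) \<in> grassmannian n" "cinf.span (F ` {..<n}) \<subseteq> cfin m"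
proof -
  have F: "inj_on F {..<n}" "cinf.independent (F ` {..<n})" "F ` {..<n} \<subseteq> cfin m"
    using assms
    by (auto simp: frame_topology_def cfin_topology_def topspace_pullback_topology PiE_iff)
  show "cinf.span (F ` {..<n}) \<in> grassmannian n"
    using F by (simp add: grassmannian_def cinf.dim_eq_card_independent card_image)
  show "cinf.span (F ` {..<n}) \<subseteq> cfin m"
    using F cfin_subspace by (simp add: cinf.span_minimal)
qed

lemma istopology_grassmannian_open: "istopology (grassmannian_open n)"
proof -
  let ?T = "\<lambda>m. frame_topology n m"
  let ?s = "\<lambda>F. cinf.span (F ` {..<n})"
  have iff: "grassmannian_open n \<U> \<longleftrightarrow> \<U> \<subseteq> grassmannian n \<and>
      (\<forall>m. openin (?T m) {F \<in> topspace (?T m). ?s F \<in> \<U>})" for \<U>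
  proof -
    have "{F \<in> topspace (?T m). ?s F \<in> {W \<in> \<U>. W \<subseteq> cfin m}} =
        {F \<in> topspace (?T m). ?s F \<in> \<U>}" for m
      using frame_span_in_grassmannian(2) by auto
    then show ?thesis
      by (auto simp: grassmannian_open_def grassmannian_fin_open_def)
  qed
  show ?thesis
    unfolding istopology_def
  proof (intro conjI allI impI)
    fix S T assume "grassmannian_open n S" "grassmannian_open n T"
    moreover have "{F \<in> topspace (?T m). ?s F \<in> S \<inter> T} =
        {F \<in> topspace (?T m). ?s F \<in> S} \<inter> {F \<in> topspace (?T m). ?s F \<in> T}" for m
      by auto
    ultimately show "grassmannian_open n (S \<inter> T)"
      unfolding iff by (metis (no_types, lifting) le_infI1 openin_Int)
  next
    fix \<K> assume "\<forall>K\<in>\<K>. grassmannian_open n K"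
    moreover have "{F \<in> topspace (?T m). ?s F \<in> \<Union>\<K>} =
        \<Union> ((\<lambda>K. {F \<in> topspace (?T m). ?s F \<in> K}) ` \<K>)" for m
      by auto
    ultimately show "grassmannian_open n (\<Union>\<K>)"
      unfolding iff by (auto intro!: openin_Union)
  qed
qed

lemma openin_grassmannian_topology:
  "openin (grassmannian_topology n) = grassmannian_open n"
  by (simp add: grassmannian_topology_def istopology_grassmannian_open topology_inverse')

lemma topspace_grassmannian_topology [simp]:
  "topspace (grassmannian_topology n) = grassmannian n"
proof
  show "topspace (grassmannian_topology n) \<subseteq> grassmannian n"
    by (auto simp: topspace_def openin_grassmannian_topology grassmannian_open_def)
  have "{F \<in> topspace (frame_topology n m).
      cinf.span (F ` {..<n}) \<in> {W \<in> grassmannian n. W \<subseteq> cfin m}} =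
      topspace (frame_topology n m)" for m
    using frame_span_in_grassmannian[where n = n and m = m] by blast
  then have "openin (grassmannian_topology n) (grassmannian n)"
    by (simp add: openin_grassmannian_topology grassmannian_open_def
        grassmannian_fin_open_def)
  then show "grassmannian n \<subseteq> topspace (grassmannian_topology n)"
    by (rule openin_subset)
qed

text \<open>As a based \<open>C\<^sub>2\<close>-space, \<open>Gr\<^sub>n(\<complex>\<^sup>\<infinity>)\<close> has the conjugation-invariant base point
  \<open>\<complex>\<^sup>n\<close>, that is \<open>cfin n\<close>.\<close>

definition Gr_tau :: "nat \<Rightarrow> cinf set C2space" where
  "Gr_tau n = (grassmannian_topology n, \<lambda>W. cinf_cnj ` W)"

section \<open>The unitary group\<close>

definition unitary_matrices :: "(complex ^ 'n ^ 'n) set" where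
  "unitary_matrices =
     {A. A ** map_matrix cnj (transpose A) = mat 1 \<and>
         map_matrix cnj (transpose A) ** A = mat 1}"

definition U_tau :: "(complex ^ 'n ^ 'n) C2space" where
  "U_tau = (top_of_set unitary_matrices, transpose)"

end

theory Submission
  imports Defs "HOL-Analysis.Finite_Function_Topology"
begin

text \<open>For \<open>-1 \<le> u \<le> 1\<close> the columns of the matrix with blocks
  \<open>(1 - u)/2 + (1 + u)/2 A\<close>, \<open>(1 - u\<^sup>2) (1 + A)\<close> and \<open>\<i> (1 - u\<^sup>2) (1 - A)\<close> are independent, and they
  span \<open>\<complex>\<^sup>n\<close> at both ends. This gives a map from \<open>U(n)\<close> to the loops in \<open>Gr\<^sub>n(\<complex>\<^sup>3\<^sup>n)\<close>. It is strictly
  equivariant, because the conjugate of the reversed frame of \<open>A\<close>, multiplied by the transpose of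
  \<open>A\<close>, is the frame of that transpose. For this map, relative lifting problems over compact
  metric pairs \<open>(K, L)\<close> are solved up to homotopy, which proves that it is a weak equivalence. A
  family of loops over \<open>K\<close> lifts to a family of frames over \<open>[-1, 1]\<close> starting at the standard
  frame of \<open>\<complex>\<^sup>n\<close>; the frame at the other end is a map \<open>A : K \<rightarrow> GL(n)\<close>. Linear interpolation,
  corrected by a multiple of \<open>(1 + A, \<i> (1 - A))\<close> in unused coordinates, deforms the family of
  frames to the one associated with \<open>A\<close>, and finally \<open>GL(n)\<close> is deformed to \<open>U(n)\<close>. All steps are
  compatible with the involutions, so they apply to fixed points as well.\<close>

text \<open>A loop of subspaces based at \<open>cfin n\<close> is classified by its clutching
  matrix: trivialise it by a frame that starts at the standard one and compare the frame at the
  other end. Loops with the same matrix are homotopic because the frames in infinitely many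
  dimensions form a contractible space; here contractibility enters as a supply of fresh
  coordinates. Conjugating and reversing a loop replaces \<open>A\<close> by the conjugate of its
  inverse, which on U(n) is the transpose. The obstacle is that all choices must respect this
  involution. Reversal does not preserve frames that are standard at one end, so frames are built at
  the centre \<open>t = 0\<close>, which reversal fixes, and normalised at -1 afterwards. Likewise
  GL(n) cannot be deformed by Gram-Schmidt on the columns of \<open>A\<close>, since inversion
  exchanges left and right factors; the correction has to be two-sided. Compact pairs take the place
  of fibration theory, and as compact subsets of the Grassmannian lie in a finite stage, the
  analysis takes place in a single \<open>cfin N\<close>.\<close>

section \<open>Weak equivalences from relative lifting up to homotopy\<close>

text \<open>The compression property which, when \<open>(K, L)\<close> ranges over CW pairs,
  characterises weak equivalences.\<close>

definition rel_homotopy_lifting ::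
  "'a topology \<Rightarrow> 'b topology \<Rightarrow> ('a \<Rightarrow> 'b) \<Rightarrow> 'k::topological_space set \<Rightarrow> 'k set \<Rightarrow> bool" where
  "rel_homotopy_lifting X Y f K L \<longleftrightarrow>
     (\<forall>\<alpha> \<beta>. continuous_map (top_of_set K) Y \<alpha> \<and> continuous_map (top_of_set L) X \<beta> \<and>
        (\<forall>l\<in>L. f (\<beta> l) = \<alpha> l) \<longrightarrow>
        (\<exists>\<gamma>. continuous_map (top_of_set K) X \<gamma> \<and> (\<forall>l\<in>L. \<gamma> l = \<beta> l) \<and>
             homotopic_with (\<lambda>u. \<forall>l\<in>L. u l = \<alpha> l) (top_of_set K) Y \<alpha> (f \<circ> \<gamma>)))"

lemma rel_homotopy_liftingE:
  assumes "rel_homotopy_lifting X Y f K L"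
    and "continuous_map (top_of_set K) Y \<alpha>" "continuous_map (top_of_set L) X \<beta>"
    and "\<And>l. l \<in> L \<Longrightarrow> f (\<beta> l) = \<alpha> l"
  obtains \<gamma> where "continuous_map (top_of_set K) X \<gamma>" "\<forall>l\<in>L. \<gamma> l = \<beta> l"
    "homotopic_with (\<lambda>u. \<forall>l\<in>L. u l = \<alpha> l) (top_of_set K) Y \<alpha> (f \<circ> \<gamma>)"
proof -
  have "\<exists>\<gamma>. continuous_map (top_of_set K) X \<gamma> \<and> (\<forall>l\<in>L. \<gamma> l = \<beta> l) \<and>
          homotopic_with (\<lambda>u. \<forall>l\<in>L. u l = \<alpha> l) (top_of_set K) Y \<alpha> (f \<circ> \<gamma>)"
    using assms unfolding rel_homotopy_lifting_def by simp
  then show thesis using that by auto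
qed

lemma path_components_map_component:
  assumes f: "continuous_map X Y f" and x: "x \<in> topspace X"
  shows "path_components_map Y f (path_component_of_set X x) = path_component_of_set Y (f x)"
proof -
  have "path_component_of Y (f x) (f x')" if px: "path_component_of X x x'" for x'
  proof -
    obtain g where "pathin X g" "g 0 = x" "g 1 = x'"
      using px unfolding path_component_of_def by blast
    then show ?thesis
      unfolding path_component_of_def using f
      by (intro exI[of _ "f \<circ> g"]) (auto simp: pathin_def intro: continuous_map_compose)
  qed
  then have "path_component_of_set Y (f x') = path_component_of_set Y (f x)"
    if "x' \<in> path_component_of_set X x" for x'
    using that by (metis mem_Collect_eq path_component_of_equiv)
  moreover have "x \<in> path_component_of_set X x"
    using x by (simp add: path_component_of_refl)
  ultimately show ?thesis
    unfolding path_components_map_def by blast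
qed

lemma top_of_set_finite_discrete:
  fixes S :: "'a::t1_space set"
  assumes "finite S"
  shows "top_of_set S = discrete_topology S"
proof -
  have "openin (top_of_set S) {x}" if "x \<in> S" for x
  proof -
    have "open (- (S - {x}))"
      using assms by (intro open_Compl finite_imp_closed) auto
    moreover have "{x} = S \<inter> (- (S - {x}))" using that by auto
    ultimately show ?thesis by (metis openin_open)
  qed
  then show ?thesis
    by (metis discrete_topology_unique topspace_euclidean_subtopology)
qed

text \<open>Injectivity lifts a path between two images relative to its end points; surjectivity
  lifts a single point, with \<open>L\<close> empty.\<close>

lemma path_components_bij_of_rel_lifting:
  assumes f: "continuous_map X Y f"
    and L: "\<And>K L :: real set. compact K \<Longrightarrow> closed L \<Longrightarrow> L \<subseteq> K \<Longrightarrow> rel_homotopy_lifting X Y f K L"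
  shows "bij_betw (path_components_map Y f) (path_components_of X) (path_components_of Y)"
  unfolding bij_betw_def
proof (intro conjI)
  show "inj_on (path_components_map Y f) (path_components_of X)"
  proof (rule inj_onI)
    fix C D
    assume "C \<in> path_components_of X" "D \<in> path_components_of X"
      and eq: "path_components_map Y f C = path_components_map Y f D"
    then obtain x x' where x: "x \<in> topspace X" "C = path_component_of_set X x"
      "x' \<in> topspace X" "D = path_component_of_set X x'"
      by (auto simp: path_components_of_def)
    then have "path_component_of_set Y (f x) = path_component_of_set Y (f x')"
      using eq path_components_map_component[OF f] by simp
    moreover have "f x' \<in> topspace Y" using x f by (auto simp: continuous_map_def)
    ultimately have "path_component_of Y (f x) (f x')"
      by (metis mem_Collect_eq path_component_of_refl)
    then obtain a where a: "pathin Y a" "a 0 = f x" "a 1 = f x'"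
      unfolding path_component_of_def by blast
    have "rel_homotopy_lifting X Y f {0..1} {0,1::real}"
      by (rule L) auto
    moreover have "continuous_map (top_of_set {0..1}) Y a" using a(1) by (simp add: pathin_def)
    moreover have "continuous_map (top_of_set {0,1::real}) X (\<lambda>t. if t = 0 then x else x')"
      using x by (subst top_of_set_finite_discrete) (auto simp: continuous_map_def)
    ultimately obtain g where g: "continuous_map (top_of_set {0..1::real}) X g"
      "\<forall>l\<in>{0,1}. g l = (if l = 0 then x else x')"
      by (rule rel_homotopy_liftingE) (use a in auto)
    then have "path_component_of X x x'"
      unfolding path_component_of_def pathin_def by (intro exI[of _ g]) auto
    then show "C = D"
      using x by (metis path_component_of_equiv)
  qed
next
  have "path_components_map Y f C \<in> path_components_of Y" if C: "C \<in> path_components_of X" for C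
  proof -
    obtain x where x: "x \<in> topspace X" "C = path_component_of_set X x"
      using C unfolding path_components_of_def by blast
    moreover have "f x \<in> topspace Y" using x f by (auto simp: continuous_map_def)
    ultimately show ?thesis
      using path_components_map_component[OF f x(1)] unfolding path_components_of_def by blast
  qed
  moreover have "D \<in> path_components_map Y f ` path_components_of X"
    if D: "D \<in> path_components_of Y" for D
  proof -
    obtain y where y: "y \<in> topspace Y" "D = path_component_of_set Y y"
      using D by (auto simp: path_components_of_def)
    have "rel_homotopy_lifting X Y f {0::real} {}"
      by (rule L) auto
    then obtain g where g: "continuous_map (top_of_set {0::real}) X g"
      "homotopic_with (\<lambda>u. \<forall>l\<in>{}. u l = y) (top_of_set {0}) Y (\<lambda>_. y) (f \<circ> g)"
      by (rule rel_homotopy_liftingE[where \<alpha> = "\<lambda>_. y" and \<beta> = "\<lambda>_. undefined"]) (use y in auto)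
    have x: "g 0 \<in> topspace X" using g(1) by (auto simp: continuous_map_def)
    have "homotopic_with (\<lambda>_. True) (top_of_set {0::real}) Y (\<lambda>_. y) (\<lambda>_. f (g 0))"
    proof (rule homotopic_with_eq)
      show "homotopic_with (\<lambda>_. True) (top_of_set {0::real}) Y (\<lambda>_. y) (f \<circ> g)"
        using g(2) by (rule homotopic_with_mono) simp
    qed auto
    then have "path_component_of Y y (f (g 0))"
      unfolding homotopic_constant_maps
      by (metis insert_not_empty topspace_discrete_topology topspace_euclidean_subtopology)
    then have "D = path_component_of_set Y (f (g 0))"
      using y by (metis path_component_of_equiv)
    then have "D = path_components_map Y f (path_component_of_set X (g 0))"
      using path_components_map_component[OF f x] by simp
    then show ?thesis using x by (auto simp: path_components_of_def)
  qed
  ultimately show "path_components_map Y f ` path_components_of X = path_components_of Y" by blast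
qed

text \<open>The product topology behind \<open>nsphere\<close> is the topology of the function type,
  so spheres are instances of the set \<open>K\<close> in
  \<open>rel_homotopy_lifting\<close>.\<close>

lemma nsphere_top_of_set: "nsphere k = top_of_set (topspace (nsphere k))"
  by (simp only: nsphere euclidean_product_topology topspace_subtopology topspace_euclidean inf_top_left)

lemma compact_PiE_UNIV:
  fixes S :: "'i \<Rightarrow> 'a::topological_space set"
  assumes "\<And>i. compact (S i)"
  shows "compact (PiE UNIV S)"
proof -
  have "compactin (product_topology (\<lambda>_. euclidean) UNIV) (PiE UNIV S)"
    using assms by (simp add: compactin_PiE)
  then show ?thesis by (simp add: euclidean_product_topology)
qed

text \<open>The ambient type has infinitely many coordinates, so compactness comes from Tychonoff's
  theorem for a cube that contains the sphere as a closed subset.\<close>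

lemma compact_nsphere: "compact (topspace (nsphere k))"
proof -
  let ?S = "{x :: nat \<Rightarrow> real. (\<Sum>i\<le>k. (x i)\<^sup>2) = 1} \<inter> (\<Inter>i\<in>{k<..}. {x. x i = 0})"
  have "closed ?S"
    by (intro closed_Int closed_INT ballI closed_Collect_eq continuous_intros
        continuous_on_product_coordinates)
  moreover have "\<bar>x i\<bar> \<le> 1" if "x \<in> ?S" for x i
  proof (cases "i \<le> k")
    case True
    then have "(x i)\<^sup>2 \<le> (\<Sum>i\<le>k. (x i)\<^sup>2)" by (intro member_le_sum) auto
    then show ?thesis using that by (simp add: abs_square_le_1)
  qed (use that in auto)
  then have "?S \<subseteq> PiE UNIV (\<lambda>_. {-1..1})" by (fastforce simp: abs_le_iff)
  moreover have "compact (PiE UNIV (\<lambda>_::nat. {-1..1::real}))"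
    by (intro compact_PiE_UNIV) auto
  ultimately have "compact ?S" by (metis closed_Int_compact inf.absorb_iff1)
  moreover have "topspace (nsphere k) = ?S" by (auto simp: nsphere)
  ultimately show ?thesis by simp
qed

lemma sphere_pt_in_nsphere: "sphere_pt \<in> topspace (nsphere k)"
proof -
  have "(\<Sum>i\<le>k. (sphere_pt i)\<^sup>2) = (\<Sum>i\<le>k. if i = 0 then 1 else 0)"
    by (rule sum.cong) (auto simp: sphere_pt_def)
  then show ?thesis by (auto simp: nsphere sphere_pt_def)
qed

section \<open>Based homotopy classes and induced maps\<close>

lemma sym_based_homotopic: "sym (based_homotopic k X x)"
  unfolding based_homotopic_def
  by (rule symI, unfold mem_Collect_eq case_prod_conv, rule homotopic_with_symD)

lemma trans_based_homotopic: "trans (based_homotopic k X x)"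
  unfolding based_homotopic_def
  by (rule transI, unfold mem_Collect_eq case_prod_conv, rule homotopic_with_trans)

lemma based_homotopic_refl:
  "continuous_map (nsphere k) X g \<Longrightarrow> g sphere_pt = x \<Longrightarrow> (g, g) \<in> based_homotopic k X x"
  by (simp add: based_homotopic_def)

lemma based_homotopic_class_eq:
  "based_homotopic k X x `` {g} = based_homotopic k X x `` {h}" if "(g, h) \<in> based_homotopic k X x"
proof (intro equalityI subsetI)
  have hg: "(h, g) \<in> based_homotopic k X x"
    using sym_based_homotopic that by (rule symD)
  fix v
  show "v \<in> based_homotopic k X x `` {h}" if "v \<in> based_homotopic k X x `` {g}"
    using transD[OF trans_based_homotopic hg] that by simp
  show "v \<in> based_homotopic k X x `` {g}" if "v \<in> based_homotopic k X x `` {h}"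
    using transD[OF trans_based_homotopic \<open>(g, h) \<in> _\<close>] that by simp
qed

text \<open>Composition with \<open>f\<close> respects based homotopy, so the induced map can be
  computed on one representative.\<close>

lemma homotopy_classes_map_class:
  assumes f: "continuous_map X Y f" and g: "continuous_map (nsphere k) X g" "g sphere_pt = x"
  shows "homotopy_classes_map k Y f x (based_homotopic k X x `` {g}) =
         based_homotopic k Y (f x) `` {f \<circ> g}"
proof -
  have "(f \<circ> g, f \<circ> h) \<in> based_homotopic k Y (f x)" if "(g, h) \<in> based_homotopic k X x" for h
  proof -
    have "homotopic_with (\<lambda>u. u sphere_pt = x) (nsphere k) X g h"
      using that by (simp add: based_homotopic_def)
    then have "homotopic_with (\<lambda>u. u sphere_pt = f x) (nsphere k) Y (f \<circ> g) (f \<circ> h)"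
      by (rule homotopic_with_compose_continuous_map_left[OF _ f]) simp
    then show ?thesis by (simp add: based_homotopic_def)
  qed
  note fg = this
  have gg: "(g, g) \<in> based_homotopic k X x"
    using g by (rule based_homotopic_refl)
  show ?thesis
    unfolding homotopy_classes_map_def
  proof (intro equalityI subsetI)
    fix v
    assume "v \<in> based_homotopic k Y (f x) `` (\<lambda>g. f \<circ> g) ` based_homotopic k X x `` {g}"
    then obtain h where "(g, h) \<in> based_homotopic k X x" "(f \<circ> h, v) \<in> based_homotopic k Y (f x)"
      by blast
    then have "(f \<circ> g, v) \<in> based_homotopic k Y (f x)"
      using fg transD[OF trans_based_homotopic] by metis
    then show "v \<in> based_homotopic k Y (f x) `` {f \<circ> g}" by simp
  next
    fix v assume "v \<in> based_homotopic k Y (f x) `` {f \<circ> g}"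
    then show "v \<in> based_homotopic k Y (f x) `` (\<lambda>g. f \<circ> g) ` based_homotopic k X x `` {g}"
      using gg by (intro ImageI[of "f \<circ> g"]) auto
  qed
qed

text \<open>For injectivity, a homotopy between the images is lifted on the cylinder over the
  sphere, relative to both ends and to the segment over the base point. For surjectivity, a sphere
  is lifted relative to its base point; the class is unchanged because the homotopy is stationary
  there.\<close>

lemma homotopy_classes_bij_of_rel_lifting:
  assumes f: "continuous_map X Y f" and x: "x \<in> topspace X"
    and L1: "\<And>K L :: (nat \<Rightarrow> real) set. compact K \<Longrightarrow> closed L \<Longrightarrow> L \<subseteq> K \<Longrightarrow>
               rel_homotopy_lifting X Y f K L"
    and L2: "\<And>K L :: (real \<times> (nat \<Rightarrow> real)) set. compact K \<Longrightarrow> closed L \<Longrightarrow> L \<subseteq> K \<Longrightarrow>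
               rel_homotopy_lifting X Y f K L"
  shows "bij_betw (homotopy_classes_map k Y f x) (homotopy_classes k X x)
           (homotopy_classes k Y (f x))"
proof -
  let ?S = "topspace (nsphere k)"
  let ?RX = "based_homotopic k X x" and ?RY = "based_homotopic k Y (f x)"
  note S = nsphere_top_of_set[of k]
  have cls: "C \<in> homotopy_classes k Z z \<longleftrightarrow>
     (\<exists>g. continuous_map (nsphere k) Z g \<and> g sphere_pt = z \<and> C = based_homotopic k Z z `` {g})"
    for C and Z :: "'z topology" and z
    by (auto simp: homotopy_classes_def quotient_def)
  show ?thesis
    unfolding bij_betw_def
  proof (intro conjI)
    show "inj_on (homotopy_classes_map k Y f x) (homotopy_classes k X x)"
    proof (rule inj_onI)
      fix C D assume "C \<in> homotopy_classes k X x" "D \<in> homotopy_classes k X x"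
        and eq: "homotopy_classes_map k Y f x C = homotopy_classes_map k Y f x D"
      then obtain g g' where g: "continuous_map (nsphere k) X g" "g sphere_pt = x" "C = ?RX `` {g}"
        and g': "continuous_map (nsphere k) X g'" "g' sphere_pt = x" "D = ?RX `` {g'}"
        unfolding cls by blast
      have "?RY `` {f \<circ> g} = ?RY `` {f \<circ> g'}"
        using eq unfolding g(3) g'(3)
        by (simp add: homotopy_classes_map_class[OF f g(1,2)] homotopy_classes_map_class[OF f g'(1,2)])
      moreover have "(f \<circ> g', f \<circ> g') \<in> ?RY"
        using g' f by (intro based_homotopic_refl) (auto intro: continuous_map_compose)
      ultimately have "(f \<circ> g, f \<circ> g') \<in> ?RY" by (metis Image_singleton_iff)
      then obtain h where h: "continuous_map (prod_topology (top_of_set {0..1::real}) (nsphere k)) Y h"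
        "\<And>s. h (0, s) = f (g s)" "\<And>s. h (1, s) = f (g' s)"
        "\<And>t. t \<in> {0..1} \<Longrightarrow> h (t, sphere_pt) = f x"
        unfolding based_homotopic_def homotopic_with_def by auto
      let ?K = "{0..1::real} \<times> ?S"
      let ?A = "{0::real} \<times> ?S" and ?B = "{1::real} \<times> ?S" and ?C = "{0..1::real} \<times> {sphere_pt}"
      let ?L = "?A \<union> ?B \<union> ?C"
      have prod: "prod_topology (top_of_set {0..1::real}) (nsphere k) = top_of_set ?K"
        by (subst S) (simp add: subtopology_Times[symmetric] flip: euclidean_product_topology prod_topology_subtopology_eu)
      have clos: "closed ?A" "closed ?B" "closed ?C"
        using compact_nsphere[of k] by (auto intro!: closed_Times simp: compact_imp_closed)
      have sub: "?L \<subseteq> ?K" using sphere_pt_in_nsphere[of k] by auto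
      \<comment> \<open>The three closed pieces meet only over the base point, where all prescribed
        values are \<open>x\<close>.\<close>
      define b where "b = (\<lambda>(t, s). if s = sphere_pt then x else if t = (0::real) then g s else g' s)"
      have "continuous_map (top_of_set ?L) X b"
      proof (rule pasting_lemma_closed[where I = "{0,1,2::nat}"
            and T = "\<lambda>i. if i = 0 then ?A else if i = 1 then ?B else ?C"
            and f = "\<lambda>i. if i = 0 then g \<circ> snd else if i = 1 then g' \<circ> snd else (\<lambda>_. x)"])
        have sn: "continuous_map (top_of_set (C \<times> ?S)) (nsphere k) snd" for C :: "real set"
          by (subst S) (auto simp: continuous_map_in_subtopology continuous_on_snd continuous_on_id)
        fix i :: nat assume i: "i \<in> {0,1,2}"
        have "continuous_map (top_of_set ?A) X (g \<circ> snd)" "continuous_map (top_of_set ?B) X (g' \<circ> snd)"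
          using g(1) g'(1) sn by (auto intro: continuous_map_compose)
        moreover have "?L \<inter> ?A = ?A" "?L \<inter> ?B = ?B" "?L \<inter> ?C = ?C" by auto
        ultimately show "continuous_map (subtopology (top_of_set ?L)
             (if i = 0 then ?A else if i = 1 then ?B else ?C)) X
             (if i = 0 then g \<circ> snd else if i = 1 then g' \<circ> snd else (\<lambda>_. x))"
          using i x unfolding subtopology_subtopology by (auto simp: Int_absorb1)
        show "closedin (top_of_set ?L) (if i = 0 then ?A else if i = 1 then ?B else ?C)"
          using clos i by (auto intro!: closed_subset)
      next
        fix v assume "v \<in> topspace (top_of_set ?L)"
        then consider "v \<in> ?A" | "v \<in> ?B" | "v \<in> ?C" by auto
        then show "\<exists>j. j \<in> {0,1,2::nat} \<and> v \<in> (if j = 0 then ?A else if j = 1 then ?B else ?C) \<and>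
              b v = (if j = 0 then g \<circ> snd else if j = 1 then g' \<circ> snd else (\<lambda>_. x)) v"
        proof cases
          case 1 then show ?thesis using g(2) by (intro exI[of _ 0]) (auto simp: b_def)
        next
          case 2 then show ?thesis using g'(2) by (intro exI[of _ 1]) (auto simp: b_def)
        next
          case 3 then show ?thesis by (intro exI[of _ 2]) (auto simp: b_def)
        qed
      qed (use g(2) g'(2) in \<open>auto split: if_splits\<close>)
      note cb = this
      have rl: "rel_homotopy_lifting X Y f ?K ?L"
        using clos sub by (intro L2) (auto intro: compact_Times compact_nsphere)
      have ch: "continuous_map (top_of_set ?K) Y h" using h(1) prod by simp
      have "f (b l) = h l" if "l \<in> ?L" for l
        using that h g(2) g'(2) by (auto simp: b_def)
      with rl ch cb obtain c where c: "continuous_map (top_of_set ?K) X c"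
        "\<forall>l\<in>?L. c l = b l"
        "homotopic_with (\<lambda>u. \<forall>l\<in>?L. u l = h l) (top_of_set ?K) Y h (f \<circ> c)"
        by (rule rel_homotopy_liftingE)
      have c_end: "c (0, s) = g s" "c (1, s) = g' s" if "s \<in> ?S" for s
        using c(2)[rule_format, of "(0, s)"] c(2)[rule_format, of "(1, s)"] that g(2) g'(2)
        by (auto simp: b_def)
      have c_pt: "c (t, sphere_pt) = x" if "t \<in> {0..1}" for t
        using c(2)[rule_format, of "(t, sphere_pt)"] that by (auto simp: b_def)
      have "homotopic_with (\<lambda>u. u sphere_pt = x) (nsphere k) X (\<lambda>s. c (0, s)) (\<lambda>s. c (1, s))"
        unfolding homotopic_with_def prod
        by (rule exI[of _ c], intro conjI allI ballI c(1) c_pt refl)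
      then have "homotopic_with (\<lambda>u. u sphere_pt = x) (nsphere k) X g g'"
        by (rule homotopic_with_eq) (simp_all add: c_end sphere_pt_in_nsphere)
      then have "(g, g') \<in> ?RX" by (simp add: based_homotopic_def)
      then show "C = D"
        unfolding g(3) g'(3) by (rule based_homotopic_class_eq)
    qed
  next
    have "homotopy_classes_map k Y f x C \<in> homotopy_classes k Y (f x)"
      if C: "C \<in> homotopy_classes k X x" for C
    proof -
      obtain g where g: "continuous_map (nsphere k) X g" "g sphere_pt = x" "C = ?RX `` {g}"
        using C unfolding cls by blast
      have "continuous_map (nsphere k) Y (f \<circ> g)" using g(1) f by (rule continuous_map_compose)
      then show ?thesis
        unfolding cls g(3) homotopy_classes_map_class[OF f g(1,2)]
        using g(2) by (intro exI[of _ "f \<circ> g"]) simp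
    qed
    moreover have "D \<in> homotopy_classes_map k Y f x ` homotopy_classes k X x"
      if D: "D \<in> homotopy_classes k Y (f x)" for D
    proof -
      obtain a where a: "continuous_map (nsphere k) Y a" "a sphere_pt = f x" "D = ?RY `` {a}"
        using D unfolding cls by blast
      have "rel_homotopy_lifting X Y f ?S {sphere_pt}"
        using sphere_pt_in_nsphere by (intro L1) (auto simp: compact_nsphere)
      then obtain g where g: "continuous_map (top_of_set ?S) X g" "g sphere_pt = x"
        "homotopic_with (\<lambda>u. \<forall>l\<in>{sphere_pt}. u l = a l) (top_of_set ?S) Y a (f \<circ> g)"
      proof (rule rel_homotopy_liftingE)
        show "continuous_map (top_of_set ?S) Y a" using a(1) by (simp flip: S)
        show "continuous_map (top_of_set {sphere_pt}) X (\<lambda>_. x)" using x by simp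
      qed (use a(2) in auto)
      have "(a, f \<circ> g) \<in> ?RY"
        using g(3) a(2) by (simp add: based_homotopic_def flip: S)
      then have DR: "D = ?RY `` {f \<circ> g}"
        unfolding a(3) by (rule based_homotopic_class_eq)
      show ?thesis
      proof -
        have g': "continuous_map (nsphere k) X g" using g(1) by (simp flip: S)
        then have "?RX `` {g} \<in> homotopy_classes k X x" using g(2) unfolding cls by blast
        moreover have "D = homotopy_classes_map k Y f x (?RX `` {g})"
          unfolding homotopy_classes_map_class[OF f g' g(2)] by (rule DR)
        ultimately show ?thesis by blast
      qed
    qed
    ultimately show "homotopy_classes_map k Y f x ` homotopy_classes k X x = homotopy_classes k Y (f x)"
      by blast
  qed
qed

text \<open>The three instances of \<open>K\<close> are an interval, a sphere, and the product of both; \<open>L\<close> is then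
  empty, a point, or the part of the boundary where a homotopy is prescribed.\<close>

theorem weak_equivalence_of_rel_lifting:
  assumes "continuous_map X Y f"
    and "\<And>K L :: real set. compact K \<Longrightarrow> closed L \<Longrightarrow> L \<subseteq> K \<Longrightarrow> rel_homotopy_lifting X Y f K L"
    and "\<And>K L :: (nat \<Rightarrow> real) set. compact K \<Longrightarrow> closed L \<Longrightarrow> L \<subseteq> K \<Longrightarrow>
           rel_homotopy_lifting X Y f K L"
    and "\<And>K L :: (real \<times> (nat \<Rightarrow> real)) set. compact K \<Longrightarrow> closed L \<Longrightarrow> L \<subseteq> K \<Longrightarrow>
           rel_homotopy_lifting X Y f K L"
  shows "weak_equivalence X Y f"
  unfolding weak_equivalence_def
  by (intro conjI ballI allI impI assms(1) path_components_bij_of_rel_lifting[OF assms(1,2)]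
      homotopy_classes_bij_of_rel_lifting[OF assms(1) _ assms(3,4)])

section \<open>Maps into the signed loop space\<close>

text \<open>The sign sphere as the quotient of \<open>[-1, 1]\<close> by its end points; negation on the interval
  corresponds to the action.\<close>

definition compactify :: "real \<Rightarrow> real option" where
  "compactify u = (if \<bar>u\<bar> < 1 then Some (u / (1 - \<bar>u\<bar>)) else None)"

text \<open>A section of \<open>compactify\<close>. It is discontinuous at infinity, where it picks
  the end point 1, so continuity of \<open>loop_of\<close> has to come from the quotient
  map.\<close>

definition uncompactify :: "real option \<Rightarrow> real" where
  "uncompactify s = (case s of None \<Rightarrow> 1 | Some t \<Rightarrow> t / (1 + \<bar>t\<bar>))"

definition loop_of :: "(real \<Rightarrow> 'a) \<Rightarrow> real option \<Rightarrow> 'a" where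
  "loop_of g s = g (uncompactify s)"

lemma uncompactify_compactify: "\<bar>u\<bar> < 1 \<Longrightarrow> uncompactify (compactify u) = u"
proof -
  assume u: "\<bar>u\<bar> < 1"
  then have "1 + \<bar>u / (1 - \<bar>u\<bar>)\<bar> = 1 / (1 - \<bar>u\<bar>)" by (simp add: field_simps)
  then show ?thesis using u by (simp add: compactify_def uncompactify_def)
qed

lemma abs_uncompactify_less: "\<bar>t / (1 + \<bar>t\<bar>)\<bar> < (1::real)"
  by (simp add: field_simps)

lemma uncompactify_bounds: "uncompactify s \<in> {-1..1}"
proof (cases s)
  case (Some t)
  then show ?thesis
    using abs_uncompactify_less[of t] unfolding uncompactify_def Some option.case atLeastAtMost_iff
    by linarith
qed (simp add: uncompactify_def)

lemma compactify_uncompactify: "compactify (uncompactify s) = s"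
proof (cases s)
  case (Some t)
  have "1 - \<bar>t / (1 + \<bar>t\<bar>)\<bar> = 1 / (1 + \<bar>t\<bar>)" by (simp add: field_simps)
  then show ?thesis
    using Some abs_uncompactify_less[of t] by (simp add: compactify_def uncompactify_def)
qed (simp add: compactify_def uncompactify_def)

lemma loop_of_compactify:
  assumes "u \<in> {-1..1}" "g (-1) = g 1"
  shows "loop_of g (compactify u) = g u"
proof (cases "\<bar>u\<bar> < 1")
  case False
  then have "u = 1 \<or> u = -1" using assms by auto
  then show ?thesis using assms by (auto simp: loop_of_def compactify_def uncompactify_def)
qed (simp add: loop_of_def uncompactify_compactify)

lemma compactify_uminus: "compactify (- u) = map_option uminus (compactify u)"
  by (simp add: compactify_def)

lemma continuous_map_compactify:
  "continuous_map (top_of_set {-1..1}) (underlying sign_sphere) compactify"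
  unfolding sign_sphere_def fst_conv continuous_map_def
proof (intro conjI allI impI)
  fix U assume "openin (Alexandroff_compactification euclideanreal) U"
  then consider V where "open V" "U = Some ` V"
    | C where "compact C" "U = insert None (Some ` (- C))"
    unfolding openin_Alexandroff_compactification by (auto simp: Compl_eq_Diff_UNIV)
  then show "openin (top_of_set {-1..1}) {u \<in> topspace (top_of_set {-1..1}). compactify u \<in> U}"
  proof cases
    case 1
    have "1 - \<bar>u\<bar> \<noteq> 0" if "u \<in> {-1<..<1}" for u :: real using that by auto
    then have "continuous_on {-1<..<1::real} (\<lambda>u. u / (1 - \<bar>u\<bar>))"
      by (intro continuous_intros) auto
    then have "open ({-1<..<1} \<inter> (\<lambda>u. u / (1 - \<bar>u\<bar>)) -` V)"
      using 1(1) by (intro continuous_open_preimage) auto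
    moreover have "{u \<in> topspace (top_of_set {-1..1}). compactify u \<in> U} =
        {-1..1} \<inter> ({-1<..<1} \<inter> (\<lambda>u. u / (1 - \<bar>u\<bar>)) -` V)"
      by (auto simp: 1 compactify_def split: if_splits)
    ultimately show ?thesis by (metis openin_open)
  next
    case 2
    \<comment> \<open>The preimage of a neighbourhood of infinity is the complement of the image of
      \<open>C\<close> under the inverse map; that image is compact, hence closed.\<close>
    have "compact ((\<lambda>t. t / (1 + \<bar>t\<bar>)) ` C)"
    proof (rule compact_continuous_image)
      have "1 + \<bar>t\<bar> \<noteq> 0" for t :: real by linarith
      then show "continuous_on C (\<lambda>t. t / (1 + \<bar>t\<bar>))" by (intro continuous_intros) auto
    qed (use 2 in auto)
    then have "open (- ((\<lambda>t. t / (1 + \<bar>t\<bar>)) ` C))"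
      using compact_imp_closed by blast
    moreover have "compactify u \<in> U \<longleftrightarrow> u \<notin> (\<lambda>t. t / (1 + \<bar>t\<bar>)) ` C" if "u \<in> {-1..1}" for u
    proof
      assume u: "compactify u \<in> U"
      show "u \<notin> (\<lambda>t. t / (1 + \<bar>t\<bar>)) ` C"
      proof
        assume "u \<in> (\<lambda>t. t / (1 + \<bar>t\<bar>)) ` C"
        then obtain t where "t \<in> C" "u = uncompactify (Some t)" by (auto simp: uncompactify_def)
        then show False using u compactify_uncompactify[of "Some t"] 2 by auto
      qed
    next
      assume u: "u \<notin> (\<lambda>t. t / (1 + \<bar>t\<bar>)) ` C"
      show "compactify u \<in> U"
      proof (cases "compactify u")
        case (Some t)
        then have "\<bar>u\<bar> < 1" by (auto simp: compactify_def split: if_splits)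
        then have "u = t / (1 + \<bar>t\<bar>)"
          using uncompactify_compactify[of u] Some by (simp add: uncompactify_def)
        then show ?thesis using u Some 2 by auto
      qed (use 2 in auto)
    qed
    then have "{u \<in> topspace (top_of_set {-1..1}). compactify u \<in> U} =
        {-1..1} \<inter> - ((\<lambda>t. t / (1 + \<bar>t\<bar>)) ` C)" by auto
    ultimately show ?thesis by (metis openin_open)
  qed
qed (auto simp flip: UNIV_option_conv)

lemma Hausdorff_sign_sphere: "Hausdorff_space (underlying sign_sphere)"
  by (simp add: sign_sphere_def Hausdorff_space_Alexandroff_compactification
      locally_compact_space_euclidean Hausdorff_space_euclidean)

lemma compactify_image: "compactify ` {-1..1} = UNIV"
proof -
  have "s \<in> compactify ` {-1..1}" for s
    using compactify_uncompactify[of s] uncompactify_bounds[of s] by (metis image_eqI)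
  then show ?thesis by blast
qed

lemma quotient_map_compactify:
  "quotient_map (top_of_set {-1..1}) (underlying sign_sphere) compactify"
proof (rule continuous_closed_imp_quotient_map)
  show "closed_map (top_of_set {-1..1}) (underlying sign_sphere) compactify"
  proof (rule continuous_imp_closed_map)
    show "compact_space (top_of_set {-1..1::real})"
      by (simp add: compact_space_subtopology)
  qed (fact Hausdorff_sign_sphere continuous_map_compactify)+
qed (use compactify_image continuous_map_compactify in auto)

lemma sign_sphere_preimage_compactin:
  assumes "compactin (underlying sign_sphere) K"
  shows "compactin (top_of_set {-1..1}) {u \<in> {-1..1}. compactify u \<in> K}"
proof (rule closedin_compact_space)
  have "closedin (underlying sign_sphere) K"
    using assms Hausdorff_sign_sphere by (simp add: compactin_imp_closedin)
  then show "closedin (top_of_set {-1..1}) {u \<in> {-1..1}. compactify u \<in> K}"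
    using closedin_continuous_map_preimage[OF continuous_map_compactify] by simp
  show "compact_space (top_of_set {-1..1::real})"
    by (simp add: compact_space_subtopology)
qed

lemma loop_of_in_sign_loops:
  assumes "continuous_map (top_of_set {-1..1}) Y g" "g (-1) = y" "g 1 = y"
  shows "loop_of g \<in> sign_loops Y y"
proof -
  have "continuous_map (top_of_set {-1..1}) Y (loop_of g \<circ> compactify)"
    using assms by (rule_tac continuous_map_eq[OF assms(1)]) (simp add: loop_of_compactify)
  then have "continuous_map (underlying sign_sphere) Y (loop_of g)"
    by (rule continuous_compose_quotient_map[OF quotient_map_compactify])
  then show ?thesis
    using assms by (simp add: sign_loops_def loop_of_def uncompactify_def)
qed

text \<open>One half of the exponential law for the compact-open topology. By the tube lemma, a
  compact part of the interval that is mapped into \<open>U\<close> at \<open>z\<close> is mapped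
  into \<open>U\<close> for all nearby parameters.\<close>

lemma continuous_map_loop_of:
  assumes G: "continuous_map (prod_topology Z (top_of_set {-1..1})) Y (\<lambda>(z, u). G z u)"
    and ends: "\<And>z. z \<in> topspace Z \<Longrightarrow> G z (-1) = y" "\<And>z. z \<in> topspace Z \<Longrightarrow> G z 1 = y"
  shows "continuous_map Z (sign_loop_topology Y y) (\<lambda>z. loop_of (G z))"
proof -
  have "continuous_map (top_of_set {-1..1}) Y (G z)" if "z \<in> topspace Z" for z
  proof -
    have "continuous_map (top_of_set {-1..1}) Y ((\<lambda>(z, u). G z u) \<circ> Pair z)"
      using G that by (rule continuous_map_o_Pair)
    then show ?thesis by (simp add: o_def)
  qed
  then have loop: "loop_of (G z) \<in> sign_loops Y y" if "z \<in> topspace Z" for z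
    using that ends by (intro loop_of_in_sign_loops)
  show ?thesis
    unfolding sign_loop_topology_def
  proof (rule continuous_on_generated_topo)
    fix O' assume "O' \<in> {{f \<in> sign_loops Y y. f ` K \<subseteq> U} | K U.
        compactin (underlying sign_sphere) K \<and> openin Y U}"
    then obtain K U where KU: "O' = {f \<in> sign_loops Y y. f ` K \<subseteq> U}"
      "compactin (underlying sign_sphere) K" "openin Y U" by blast
    define C where "C = {u \<in> {-1..1}. compactify u \<in> K}"
    have C: "compactin (top_of_set {-1..1}) C"
      unfolding C_def using KU(2) by (rule sign_sphere_preimage_compactin)
    have iff: "loop_of (G z) ` K \<subseteq> U \<longleftrightarrow> (\<forall>u\<in>C. G z u \<in> U)" if z: "z \<in> topspace Z" for z
    proof -
      have "loop_of (G z) ` K = G z ` C"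
      proof (intro equalityI subsetI)
        fix v assume "v \<in> loop_of (G z) ` K"
        then obtain s where "s \<in> K" "v = G z (uncompactify s)" by (auto simp: loop_of_def)
        then show "v \<in> G z ` C"
          using compactify_uncompactify[of s] uncompactify_bounds[of s] by (auto simp: C_def)
      next
        fix v assume "v \<in> G z ` C"
        then obtain u where "u \<in> {-1..1}" "compactify u \<in> K" "v = G z u" by (auto simp: C_def)
        then show "v \<in> loop_of (G z) ` K"
          using loop_of_compactify[of u "G z"] ends[OF z] by (metis image_eqI)
      qed
      then show ?thesis by auto
    qed
    let ?W = "{p \<in> topspace (prod_topology Z (top_of_set {-1..1})). (\<lambda>(z, u). G z u) p \<in> U}"
    have W: "openin (prod_topology Z (top_of_set {-1..1})) ?W"
      using G KU(3) by (rule openin_continuous_map_preimage)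
    show "openin Z ((\<lambda>z. loop_of (G z)) -` O' \<inter> topspace Z)"
    proof (subst openin_subopen, intro ballI)
      fix z assume z: "z \<in> (\<lambda>z. loop_of (G z)) -` O' \<inter> topspace Z"
      then have zt: "z \<in> topspace Z" and "{z} \<times> C \<subseteq> ?W" using iff KU(1) C_def by auto
      then have "\<exists>V V'. openin Z V \<and> openin (top_of_set {-1..1}) V' \<and> z \<in> V \<and> C \<subseteq> V' \<and> V \<times> V' \<subseteq> ?W"
        by (intro tube_lemma_right[OF W C])
      then obtain V V' where V: "openin Z V" "z \<in> V" "C \<subseteq> V'" "V \<times> V' \<subseteq> ?W"
        by blast
      have "V \<subseteq> (\<lambda>z. loop_of (G z)) -` O' \<inter> topspace Z"
      proof
        fix z' assume z': "z' \<in> V"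
        then have "z' \<in> topspace Z" using V(1) openin_subset by blast
        moreover have "G z' u \<in> U" if "u \<in> C" for u
          using subsetD[OF V(4), of "(z', u)"] subsetD[OF V(3) that] z' by simp
        ultimately show "z' \<in> (\<lambda>z. loop_of (G z)) -` O' \<inter> topspace Z"
          using iff loop KU(1) by simp
      qed
      then show "\<exists>T. openin Z T \<and> z \<in> T \<and> T \<subseteq> (\<lambda>z. loop_of (G z)) -` O' \<inter> topspace Z"
        using V by blast
    qed
  next
    have "sign_loops Y y \<in> {{f \<in> sign_loops Y y. f ` K \<subseteq> U} | K U.
        compactin (underlying sign_sphere) K \<and> openin Y U}"
      by (intro CollectI exI[of _ "{}"]) auto
    then show "(\<lambda>z. loop_of (G z)) ` topspace Z \<subseteq> \<Union> {{f \<in> sign_loops Y y. f ` K \<subseteq> U} | K U.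
        compactin (underlying sign_sphere) K \<and> openin Y U}"
      using loop by blast
  qed
qed

text \<open>The other half of the exponential law, from local compactness of the interval: the
  closed ball of half the radius is the compact set that defines a basic open set of loops.\<close>

lemma continuous_map_eval_loop:
  assumes F: "continuous_map Z (sign_loop_topology Y y) F"
  shows "continuous_map (prod_topology Z (top_of_set {-1..1})) Y (\<lambda>(z, u). F z (compactify u))"
  unfolding continuous_map_def
proof (intro conjI allI impI)
  have Floop: "F z \<in> sign_loops Y y" if "z \<in> topspace Z" for z
    using F that by (auto simp: continuous_map_def)
  have Fc: "continuous_map (top_of_set {-1..1}) Y (F z \<circ> compactify)" if "z \<in> topspace Z" for z
    using continuous_map_compactify
    by (rule continuous_map_compose) (use Floop[OF that] in \<open>simp add: sign_loops_def\<close>)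
  show "(\<lambda>(z, u). F z (compactify u)) \<in> topspace (prod_topology Z (top_of_set {-1..1})) \<rightarrow> topspace Y"
    using Fc by (fastforce simp: continuous_map_def Pi_iff)
  fix U assume U: "openin Y U"
  let ?W = "{p \<in> topspace (prod_topology Z (top_of_set {-1..1})). (\<lambda>(z, u). F z (compactify u)) p \<in> U}"
  show "openin (prod_topology Z (top_of_set {-1..1})) ?W"
    unfolding openin_prod_topology_alt
  proof (intro allI impI)
    fix z u assume "(z, u) \<in> ?W"
    then have z: "z \<in> topspace Z" and u: "u \<in> {-1..1}" "F z (compactify u) \<in> U" by auto
    have "openin (top_of_set {-1..1}) {u \<in> {-1..1}. F z (compactify u) \<in> U}"
      using openin_continuous_map_preimage[OF Fc[OF z] U] by simp
    then obtain e where e: "e > 0" "\<And>v. v \<in> {-1..1} \<Longrightarrow> dist v u < e \<Longrightarrow> F z (compactify v) \<in> U"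
      unfolding openin_euclidean_subtopology_iff using u by blast
    define C where "C = {-1..1} \<inter> cball u (e/2)"
    have "compactin (top_of_set {-1..1}) C"
      unfolding C_def compactin_subtopology by (auto intro: compact_Int)
    then have K: "compactin (underlying sign_sphere) (compactify ` C)"
      using continuous_map_compactify by (rule image_compactin)
    let ?O = "{f \<in> sign_loops Y y. f ` compactify ` C \<subseteq> U}"
    have "openin (sign_loop_topology Y y) ?O"
      unfolding sign_loop_topology_def
      by (rule topology_generated_by_Basis) (use K U in blast)
    then have V: "openin Z {z \<in> topspace Z. F z \<in> ?O}"
      using F by (rule_tac openin_continuous_map_preimage)
    have "dist v u < e" if "v \<in> C" for v
      using that e(1) by (auto simp: C_def dist_commute)
    then have "F z ` compactify ` C \<subseteq> U" using e(2) by (auto simp: C_def)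
    then have "z \<in> {z \<in> topspace Z. F z \<in> ?O}" using z Floop by simp
    moreover have "openin (top_of_set {-1..1}) ({-1..1} \<inter> ball u (e/2))"
      by (simp add: openin_open_Int)
    moreover have "u \<in> {-1..1} \<inter> ball u (e/2)" using u e(1) by simp
    moreover have "{z \<in> topspace Z. F z \<in> ?O} \<times> ({-1..1} \<inter> ball u (e/2)) \<subseteq> ?W"
    proof
      fix p assume "p \<in> {z \<in> topspace Z. F z \<in> ?O} \<times> ({-1..1} \<inter> ball u (e/2))"
      moreover then have "snd p \<in> C" by (auto simp: C_def)
      ultimately show "p \<in> ?W" by auto
    qed
    ultimately show "\<exists>V V'. openin Z V \<and> openin (top_of_set {-1..1}) V' \<and> z \<in> V \<and> u \<in> V' \<and> V \<times> V' \<subseteq> ?W"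
      using V by blast
  qed
qed

section \<open>Finitely supported sequences as a normed space\<close>

notation cinf_scale (infixr "\<cdot>" 75)

abbreviation coord :: "('a \<Rightarrow>\<^sub>0 'b::zero) \<Rightarrow> 'a \<Rightarrow> 'b" where
  "coord \<equiv> Poly_Mapping.lookup"

lemma lookup_scaleR [simp]:
  "coord (r *\<^sub>R v) i = r *\<^sub>R coord v i"
  for v :: "'a \<Rightarrow>\<^sub>0 'b::real_vector"
proof -
  have "{k. r *\<^sub>R coord v k \<noteq> 0} \<subseteq> Poly_Mapping.keys v"
    by (auto simp: in_keys_iff)
  then have "finite {k. r *\<^sub>R coord v k \<noteq> 0}"
    using finite_subset finite_keys by blast
  then show ?thesis
    by (simp add: scaleR_poly_mapping_def Abs_poly_mapping_inverse)
qed

lemma scaleR_cinf: "r *\<^sub>R v = complex_of_real r \<cdot> v"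
  by (rule poly_mapping_eqI) (simp add: scaleR_conv_of_real)

text \<open>The norm of the library is the l1 norm. On each \<open>cfin m\<close> it induces the
  Euclidean topology; a larger \<open>S\<close> allows several vectors to be handled over a common
  support.\<close>

lemma norm_cinf:
  assumes "finite S" "Poly_Mapping.keys v \<subseteq> S"
  shows "norm (v :: cinf) = (\<Sum>i\<in>S. norm (coord v i))"
proof -
  have "norm v = (\<Sum>i\<in>Poly_Mapping.keys v. norm (coord v i))"
    by (simp add: norm_poly_mapping_def dist_poly_mapping_def)
  also have "\<dots> = (\<Sum>i\<in>S. norm (coord v i))"
    using assms by (intro sum.mono_neutral_left) (auto simp: in_keys_iff)
  finally show ?thesis .
qed

lemma norm_lookup_le: "norm (coord v i) \<le> norm (v :: cinf)"
proof (cases "i \<in> Poly_Mapping.keys v")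
  case True
  then show ?thesis
    unfolding norm_cinf[OF finite_keys order_refl] by (intro member_le_sum) auto
qed (simp add: in_keys_iff)

lemma bounded_linear_lookup: "bounded_linear (\<lambda>v :: cinf. coord v i)"
  by (rule bounded_linear_intro[where K = 1]) (auto simp: lookup_add norm_lookup_le)

lemma keys_scl: "Poly_Mapping.keys (c \<cdot> v) \<subseteq> Poly_Mapping.keys v"
  by (auto simp: in_keys_iff)

lemma norm_scl: "norm (c \<cdot> v) = norm c * norm v"
proof -
  have "norm (c \<cdot> v) = (\<Sum>i\<in>Poly_Mapping.keys v. norm (coord (c \<cdot> v) i))"
    by (rule norm_cinf) (auto intro: keys_scl[THEN subsetD])
  then show ?thesis
    by (simp add: norm_mult norm_cinf[OF finite_keys order_refl] sum_distrib_left)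
qed

lemma bounded_bilinear_scl: "bounded_bilinear cinf_scale"
proof
  show "\<exists>K. \<forall>a b. norm (a \<cdot> b) \<le> norm a * norm b * K"
    by (rule exI[of _ 1]) (simp add: norm_scl)
qed (auto intro!: poly_mapping_eqI simp: lookup_add algebra_simps scaleR_conv_of_real)

lemma norm_cinf_cnj: "norm (cinf_cnj v) = norm v"
proof -
  have "Poly_Mapping.keys (cinf_cnj v) \<subseteq> Poly_Mapping.keys v"
    by (auto simp: in_keys_iff)
  then show ?thesis
    by (simp add: norm_cinf[of "Poly_Mapping.keys v"])
qed

lemma cinf_cnj_add: "cinf_cnj (v + w) = cinf_cnj v + cinf_cnj w"
  by (rule poly_mapping_eqI) (simp add: lookup_add)

lemma cinf_cnj_diff: "cinf_cnj (v - w) = cinf_cnj v - cinf_cnj w"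
  by (rule poly_mapping_eqI) (simp add: lookup_minus)

lemma cinf_cnj_scl: "cinf_cnj (c \<cdot> v) = cnj c \<cdot> cinf_cnj v"
  by (rule poly_mapping_eqI) simp

lemma cinf_cnj_cnj [simp]: "cinf_cnj (cinf_cnj v) = v"
  by (rule poly_mapping_eqI) simp

lemma bounded_linear_cinf_cnj: "bounded_linear cinf_cnj"
  by (rule bounded_linear_intro[where K = 1])
    (auto simp: cinf_cnj_add norm_cinf_cnj scaleR_cinf cinf_cnj_scl)

lemma cinf_cnj_zero [simp]: "cinf_cnj 0 = 0"
  using bounded_linear_cinf_cnj linear_simps(3) by blast

lemma cinf_cnj_sum: "cinf_cnj (sum f S) = (\<Sum>i\<in>S. cinf_cnj (f i))"
  using bounded_linear.linear[OF bounded_linear_cinf_cnj] by (rule linear_sum)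

lemmas continuous_on_scl [continuous_intros] = bounded_bilinear.continuous_on[OF bounded_bilinear_scl]
lemmas continuous_on_lookup = bounded_linear.continuous_on[OF bounded_linear_lookup]
lemmas continuous_on_cinf_cnj = bounded_linear.continuous_on[OF bounded_linear_cinf_cnj]
lemmas tendsto_scl = bounded_bilinear.tendsto[OF bounded_bilinear_scl]

lemma lookup_sum_cinf: "coord (sum f S :: cinf) i = (\<Sum>x\<in>S. coord (f x) i)"
  using bounded_linear.linear[OF bounded_linear_lookup] by (rule linear_sum)

section \<open>The Hermitian form\<close>

definition hip :: "cinf \<Rightarrow> cinf \<Rightarrow> complex" where
  "hip v w = (\<Sum>i\<in>Poly_Mapping.keys v. coord v i * cnj (coord w i))"

lemma hip_eq:
  assumes "finite S" "Poly_Mapping.keys v \<subseteq> S"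
  shows "hip v w = (\<Sum>i\<in>S. coord v i * cnj (coord w i))"
  unfolding hip_def using assms by (intro sum.mono_neutral_left) (auto simp: in_keys_iff)

lemma hip_add_left: "hip (v + w) x = hip v x + hip w x"
proof -
  let ?S = "Poly_Mapping.keys v \<union> Poly_Mapping.keys w"
  have "Poly_Mapping.keys (v + w) \<subseteq> ?S" by (rule keys_add)
  then show ?thesis
    by (simp add: hip_eq[of ?S] lookup_add algebra_simps sum.distrib)
qed

lemma hip_scl_left: "hip (c \<cdot> v) x = c * hip v x"
  using keys_scl[of c v]
  by (simp add: hip_eq[of "Poly_Mapping.keys v"] sum_distrib_left mult.assoc)

lemma hip_cnj: "cnj (hip v w) = hip w v"
proof -
  let ?S = "Poly_Mapping.keys v \<union> Poly_Mapping.keys w"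
  have "hip v w = (\<Sum>i\<in>?S. coord v i * cnj (coord w i))"
    "hip w v = (\<Sum>i\<in>?S. coord w i * cnj (coord v i))"
    by (rule hip_eq; auto)+
  then show ?thesis by (simp add: mult.commute)
qed

lemma hip_add_right: "hip x (v + w) = hip x v + hip x w"
  by (metis hip_add_left hip_cnj complex_cnj_add)

lemma hip_scl_right: "hip x (c \<cdot> v) = cnj c * hip x v"
  by (metis hip_scl_left hip_cnj complex_cnj_mult)

lemma hip_diff_left: "hip (v - w) x = hip v x - hip w x"
  using hip_add_left[of "v - w" w x] by simp

lemma hip_zero [simp]: "hip 0 v = 0" "hip v 0 = 0"
  using hip_cnj[of 0 v] by (simp_all add: hip_def)

lemma hip_sum_left: "hip (sum f S) x = (\<Sum>i\<in>S. hip (f i) x)"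
  by (induction S rule: infinite_finite_induct) (auto simp: hip_add_left)

lemma hip_sum_right: "hip x (sum f S) = (\<Sum>i\<in>S. hip x (f i))"
  by (induction S rule: infinite_finite_induct) (auto simp: hip_add_right)

text \<open>The l1 norm dominates the Hermitian one, so the form is continuous for the topology in
  use.\<close>

lemma norm_hip_le: "norm (hip v w) \<le> norm v * norm w"
proof -
  have "norm (hip v w) \<le> (\<Sum>i\<in>Poly_Mapping.keys v. norm (coord v i * cnj (coord w i)))"
    unfolding hip_def by (rule norm_sum)
  also have "\<dots> \<le> (\<Sum>i\<in>Poly_Mapping.keys v. norm (coord v i) * norm w)"
    by (intro sum_mono) (auto simp: norm_mult intro!: mult_left_mono norm_lookup_le)
  also have "\<dots> = norm v * norm w"
    by (simp add: norm_cinf[OF finite_keys order_refl] sum_distrib_right)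
  finally show ?thesis .
qed

lemma bounded_bilinear_hip: "bounded_bilinear hip"
proof
  show "\<exists>K. \<forall>a b. norm (hip a b) \<le> norm a * norm b * K"
    by (rule exI[of _ 1]) (simp add: norm_hip_le)
qed (auto simp: hip_add_left hip_add_right scaleR_cinf hip_scl_left hip_scl_right scaleR_conv_of_real)

lemmas tendsto_hip = bounded_bilinear.tendsto[OF bounded_bilinear_hip]

lemma hip_self: "hip v v = complex_of_real (\<Sum>i\<in>Poly_Mapping.keys v. (cmod (coord v i))\<^sup>2)"
  unfolding hip_def of_real_sum complex_norm_square by (rule refl)

lemma hip_self_eq_0: "hip v v = 0 \<longleftrightarrow> v = 0"
proof
  assume "hip v v = 0"
  then have "(\<Sum>i\<in>Poly_Mapping.keys v. (cmod (coord v i))\<^sup>2) = 0"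
    unfolding hip_self of_real_eq_0_iff .
  then have "\<forall>i\<in>Poly_Mapping.keys v. (cmod (coord v i))\<^sup>2 = 0"
    by (subst (asm) sum_nonneg_eq_0_iff) auto
  then show "v = 0" by (intro poly_mapping_eqI) (auto simp: in_keys_iff)
qed simp

text \<open>The Euclidean norm, by which Gram-Schmidt normalises; \<open>norm\<close> is the l1
  norm.\<close>

definition hnorm :: "cinf \<Rightarrow> real" where
  "hnorm v = sqrt (Re (hip v v))"

lemma hnorm_pos: "v \<noteq> 0 \<Longrightarrow> hnorm v > 0"
proof -
  assume "v \<noteq> 0"
  then have "hip v v \<noteq> 0" by (simp add: hip_self_eq_0)
  moreover have "hip v v = complex_of_real (Re (hip v v))" by (simp add: hip_self)
  moreover have "Re (hip v v) \<ge> 0" by (simp add: hip_self sum_nonneg)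
  ultimately have "Re (hip v v) > 0" by (metis less_eq_real_def of_real_0)
  then show ?thesis by (simp add: hnorm_def)
qed

lemma hip_self_hnorm: "hip v v = complex_of_real ((hnorm v)\<^sup>2)"
  by (simp add: hnorm_def hip_self sum_nonneg)

lemma hip_cinf_cnj: "hip (cinf_cnj v) (cinf_cnj w) = cnj (hip v w)"
proof -
  have "Poly_Mapping.keys (cinf_cnj v) \<subseteq> Poly_Mapping.keys v"
    by (auto simp: in_keys_iff)
  then show ?thesis by (simp add: hip_eq[of "Poly_Mapping.keys v"])
qed

section \<open>Finite families of vectors\<close>

text \<open>A family with repeated vectors is dependent, unlike the image set.\<close>

definition lindep :: "'i set \<Rightarrow> ('i \<Rightarrow> cinf) \<Rightarrow> bool" where
  "lindep I f \<longleftrightarrow> (\<forall>c. (\<Sum>i\<in>I. c i \<cdot> f i) = 0 \<longrightarrow> (\<forall>i\<in>I. c i = 0))"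

lemma lindepI:
  "(\<And>c i. (\<Sum>i\<in>I. c i \<cdot> f i) = 0 \<Longrightarrow> i \<in> I \<Longrightarrow> c i = 0) \<Longrightarrow> lindep I f"
  unfolding lindep_def by blast

lemma lindepD: "lindep I f \<Longrightarrow> (\<Sum>i\<in>I. c i \<cdot> f i) = 0 \<Longrightarrow> i \<in> I \<Longrightarrow> c i = 0"
  unfolding lindep_def by blast

text \<open>Frames are indexed by numbers below \<open>n\<close> in the Grassmannian and by a finite
  type where matrices act; this lemma mediates between the two.\<close>

lemma lindep_reindex:
  assumes g: "bij_betw g J I"
  shows "lindep J (\<lambda>k. f (g k)) \<longleftrightarrow> lindep I f"
proof -
  have sum: "(\<Sum>k\<in>J. c (g k) \<cdot> f (g k)) = (\<Sum>i\<in>I. c i \<cdot> f i)" for c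
    using sum.reindex_bij_betw[OF g, of "\<lambda>i. c i \<cdot> f i"] .
  show ?thesis
  proof
    assume li: "lindep J (\<lambda>k. f (g k))"
    show "lindep I f"
    proof (rule lindepI)
      fix c i assume "(\<Sum>i\<in>I. c i \<cdot> f i) = 0" and "i \<in> I"
      moreover obtain k where "k \<in> J" "i = g k" using g \<open>i \<in> I\<close> by (auto simp: bij_betw_def)
      ultimately show "c i = 0" using lindepD[OF li, of "\<lambda>k. c (g k)"] sum by simp
    qed
  next
    assume li: "lindep I f"
    show "lindep J (\<lambda>k. f (g k))"
    proof (rule lindepI)
      fix c k assume c: "(\<Sum>k\<in>J. c k \<cdot> f (g k)) = 0" and k: "k \<in> J"
      have inv: "inv_into J g (g k) = k" if "k \<in> J" for k
        using g that by (simp add: bij_betw_def)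
      have "(\<Sum>i\<in>I. c (inv_into J g i) \<cdot> f i) = (\<Sum>k\<in>J. c (inv_into J g (g k)) \<cdot> f (g k))"
        by (rule sum[symmetric])
      also have "\<dots> = 0" using c inv by simp
      finally have "c (inv_into J g (g k)) = 0"
        using lindepD[OF li, of "\<lambda>i. c (inv_into J g i)" "g k"] g k by (auto simp: bij_betw_def)
      then show "c k = 0" using inv[OF k] by simp
    qed
  qed
qed

lemma sum_in_span_family: "J \<subseteq> I \<Longrightarrow> (\<Sum>i\<in>J. c i \<cdot> f i) \<in> cinf.span (f ` I)"
  by (rule cinf.span_sum, rule cinf.span_scale, rule cinf.span_base) auto

lemma span_lessThan_mono: "p \<in> cinf.span (f ` {..<i}) \<Longrightarrow> i \<le> j \<Longrightarrow> p \<in> cinf.span (f ` {..<j})"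
  for i j :: nat
proof -
  assume p: "p \<in> cinf.span (f ` {..<i})" and "i \<le> j"
  then have "f ` {..<i} \<subseteq> f ` {..<j}" by auto
  then show ?thesis using p cinf.span_mono by blast
qed

lemma span_family:
  assumes "finite I"
  shows "cinf.span (f ` I) = {\<Sum>i\<in>I. c i \<cdot> f i | c. True}"
proof (intro equalityI subsetI)
  fix v assume "v \<in> cinf.span (f ` I)"
  then have "v \<in> range (\<lambda>u. \<Sum>w\<in>f ` I. u w \<cdot> w)"
    using assms by (simp add: cinf.span_finite)
  then obtain u where u: "v = (\<Sum>w\<in>f ` I. u w \<cdot> w)" by auto
  \<comment> \<open>The family may repeat vectors; \<open>J\<close> keeps one index for each of
    them.\<close>
  obtain J where J: "J \<subseteq> I" "f ` J = f ` I" "inj_on f J"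
    using subset_image_inj[of "f ` I" f I] by auto
  have "v = (\<Sum>i\<in>J. u (f i) \<cdot> f i)"
    using sum.reindex[OF J(3), of "\<lambda>w. u w \<cdot> w"] u J(2) by (simp add: o_def)
  also have "\<dots> = (\<Sum>i\<in>I. (if i \<in> J then u (f i) else 0) \<cdot> f i)"
    using assms J(1) by (intro sum.mono_neutral_cong_left) auto
  finally show "v \<in> {\<Sum>i\<in>I. c i \<cdot> f i | c. True}"
    by (intro CollectI exI[of _ "\<lambda>i. if i \<in> J then u (f i) else 0"]) simp
next
  fix v assume "v \<in> {\<Sum>i\<in>I. c i \<cdot> f i | c. True}"
  then show "v \<in> cinf.span (f ` I)"
    by (auto intro: sum_in_span_family)
qed

lemma lindep_inj_on:
  assumes "finite I" "lindep I f"
  shows "inj_on f I"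
proof (rule inj_onI, rule ccontr)
  fix i j assume ij: "i \<in> I" "j \<in> I" "f i = f j" "i \<noteq> j"
  let ?c = "\<lambda>k. if k = i then 1 else if k = j then -1 else (0::complex)"
  have "(\<Sum>k\<in>I. ?c k \<cdot> f k) = (\<Sum>k\<in>{i,j}. ?c k \<cdot> f k)"
    using ij assms(1) by (intro sum.mono_neutral_right) auto
  also have "\<dots> = 0" using ij by simp
  finally show False using assms(2) ij unfolding lindep_def by force
qed

text \<open>Connects families with the set-based independence in
  \<open>frame_topology\<close>.\<close>

lemma lindep_iff:
  assumes "finite I"
  shows "lindep I f \<longleftrightarrow> inj_on f I \<and> cinf.independent (f ` I)"
proof
  assume li: "lindep I f"
  have inj: "inj_on f I" using assms li by (rule lindep_inj_on)
  moreover have "cinf.independent (f ` I)"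
  proof (rule cinf.independent_if_scalars_zero)
    fix u x assume "(\<Sum>w\<in>f ` I. u w \<cdot> w) = 0" and x: "x \<in> f ` I"
    then have "(\<Sum>i\<in>I. u (f i) \<cdot> f i) = 0"
      using sum.reindex[OF inj, of "\<lambda>w. u w \<cdot> w"] by (simp add: o_def)
    then show "u x = 0" using lindepD[OF li, of "\<lambda>i. u (f i)"] x by auto
  qed (use assms in simp)
  ultimately show "inj_on f I \<and> cinf.independent (f ` I)" ..
next
  assume *: "inj_on f I \<and> cinf.independent (f ` I)"
  show "lindep I f"
  proof (rule lindepI)
    fix c i assume c: "(\<Sum>i\<in>I. c i \<cdot> f i) = 0" and i: "i \<in> I"
    define u where "u w = c (the_inv_into I f w)" for w
    have "(\<Sum>w\<in>f ` I. u w \<cdot> w) = (\<Sum>i\<in>I. u (f i) \<cdot> f i)"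
      using sum.reindex[of f I "\<lambda>w. u w \<cdot> w"] * by (simp add: o_def)
    also have "\<dots> = (\<Sum>i\<in>I. c i \<cdot> f i)"
      using * by (intro sum.cong) (auto simp: u_def the_inv_into_f_f)
    finally have "(\<Sum>w\<in>f ` I. u w \<cdot> w) = 0" using c by simp
    then have "u (f i) = 0"
      using * assms i cinf.independentD[of "f ` I" "f ` I" u "f i"] by auto
    then show "c i = 0" using * i by (simp add: u_def the_inv_into_f_f)
  qed
qed

text \<open>A dimension count. The assumption \<open>n \<ge> 1\<close> forces the basis of
  \<open>W\<close> to be finite, because an infinite set has \<open>card\<close> equal to 0.\<close>

lemma lindep_spans:
  assumes "W \<in> grassmannian n" "n \<ge> 1" "finite I" "card I = n" "lindep I f" "f ` I \<subseteq> W"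
  shows "cinf.span (f ` I) = W"
proof
  have sub: "cinf.subspace W" and dim: "cinf.dim W = n" using assms(1) by (auto simp: grassmannian_def)
  show "cinf.span (f ` I) \<subseteq> W" using assms(6) sub by (rule cinf.span_minimal)
  show "W \<subseteq> cinf.span (f ` I)"
  proof (rule ccontr)
    assume "\<not> W \<subseteq> cinf.span (f ` I)"
    then obtain x where x: "x \<in> W" "x \<notin> cinf.span (f ` I)" by blast
    obtain B where B: "B \<subseteq> W" "cinf.independent B" "W \<subseteq> cinf.span B" "card B = cinf.dim W"
      using cinf.basis_exists by blast
    have finB: "finite B" using B(4) dim assms(2) card.infinite by fastforce
    have fI: "inj_on f I" "cinf.independent (f ` I)" using assms(3,5) lindep_iff by blast+
    have "cinf.independent (insert x (f ` I))" using fI(2) x(2) by (simp add: cinf.independent_insert)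
    moreover have "insert x (f ` I) \<subseteq> cinf.span B" using x(1) assms(6) B(3) by blast
    ultimately have "card (insert x (f ` I)) \<le> card B"
      using cinf.independent_span_bound[OF finB] by blast
    moreover have "x \<notin> f ` I" using x(2) cinf.span_base by blast
    ultimately show False using assms(3,4) fI(1) B(4) dim by (simp add: card_image)
  qed
qed

lemma lindep_span_in_grassmannian:
  assumes "finite I" "card I = n" "lindep I f"
  shows "cinf.span (f ` I) \<in> grassmannian n"
  using assms lindep_iff[OF assms(1), of f]
  by (simp add: grassmannian_def cinf.dim_eq_card_independent card_image)

section \<open>Gram-Schmidt orthonormalisation\<close>

text \<open>This lets the termination proof of \<open>gram_schmidt\<close> see that the calls under
  the sum are at indices \<open>i < j\<close>.\<close>

declare sum.cong [fundef_cong]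

fun gram_schmidt :: "(nat \<Rightarrow> cinf) \<Rightarrow> nat \<Rightarrow> cinf" where
  "gram_schmidt f j =
     (let w = f j - (\<Sum>i<j. hip (f j) (gram_schmidt f i) \<cdot> gram_schmidt f i)
      in complex_of_real (1 / hnorm w) \<cdot> w)"

declare gram_schmidt.simps [simp del]

definition orthonormal :: "nat \<Rightarrow> (nat \<Rightarrow> cinf) \<Rightarrow> bool" where
  "orthonormal n g \<longleftrightarrow> (\<forall>i<n. \<forall>j<n. hip (g i) (g j) = (if i = j then 1 else 0))"

lemma lindep_not_in_span:
  fixes n :: nat
  assumes "lindep {..<n} f" "j < n"
  shows "f j \<notin> cinf.span (f ` {..<j})"
proof
  assume "f j \<in> cinf.span (f ` {..<j})"
  then obtain c where c: "f j = (\<Sum>i<j. c i \<cdot> f i)"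
    unfolding span_family[OF finite_lessThan] by blast
  let ?c = "\<lambda>i. if i < j then c i else if i = j then -1 else (0::complex)"
  have "(\<Sum>i<n. ?c i \<cdot> f i) = (\<Sum>i<Suc j. ?c i \<cdot> f i)"
    using assms(2) by (intro sum.mono_neutral_right) auto
  also have "\<dots> = 0" using c by simp
  finally show False using assms unfolding lindep_def by force
qed

text \<open>The triangular form is part of the induction because it places the earlier vectors in
  the span of \<open>f\<close> below \<open>j\<close>. Positivity of the leading coefficient is what
  later keeps the segment from \<open>f\<close> to its orthonormalisation independent.\<close>

lemma gram_schmidt_step:
  assumes li: "lindep {..<n} f" and j: "j < n"
  shows "(\<forall>i<j. hip (gram_schmidt f j) (gram_schmidt f i) = 0) \<and>
         hip (gram_schmidt f j) (gram_schmidt f j) = 1 \<and>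
         (\<exists>a>0. \<exists>p\<in>cinf.span (f ` {..<j}). gram_schmidt f j = complex_of_real a \<cdot> f j + p)"
  using j
proof (induction j rule: less_induct)
  case (less j)
  let ?g = "gram_schmidt f"
  have orth: "hip (?g i) (?g k) = (if i = k then 1 else 0)" if "i < j" "k < j" for i k
  proof (cases i k rule: linorder_cases)
    case less' : less
    then have "hip (?g k) (?g i) = 0" using less.IH[of k] less.prems that by simp
    then show ?thesis using less' hip_cnj[of "?g k" "?g i"] by simp
  qed (use less.IH[of i] less.prems that in auto)
  have mem: "?g i \<in> cinf.span (f ` {..<j})" if i: "i < j" for i
  proof -
    obtain a p where p: "p \<in> cinf.span (f ` {..<i})" "?g i = complex_of_real a \<cdot> f i + p"
      using less.IH[of i] less.prems i by auto
    have "p \<in> cinf.span (f ` {..<j})"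
      using p(1) i by (auto intro: span_lessThan_mono)
    then show ?thesis
      unfolding p(2) using i by (simp add: cinf.span_add cinf.span_scale cinf.span_base)
  qed
  define q where "q = (\<Sum>i<j. hip (f j) (?g i) \<cdot> ?g i)"
  define w where "w = f j - q"
  have g: "?g j = complex_of_real (1 / hnorm w) \<cdot> w"
    by (subst gram_schmidt.simps) (simp add: w_def q_def Let_def)
  have q: "q \<in> cinf.span (f ` {..<j})"
    unfolding q_def using mem by (intro cinf.span_sum cinf.span_scale) auto
  have "w \<noteq> 0" using q lindep_not_in_span[OF li less.prems] by (auto simp: w_def)
  then have pos: "hnorm w > 0" by (rule hnorm_pos)
  have "hip w (?g i) = 0" if i: "i < j" for i
  proof -
    have "hip q (?g i) = (\<Sum>k<j. hip (f j) (?g k) * (if k = i then 1 else 0))"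
      unfolding q_def hip_sum_left hip_scl_left using orth i by (intro sum.cong) auto
    also have "\<dots> = hip (f j) (?g i)" using i by (simp add: if_distrib cong: if_cong)
    finally show ?thesis by (simp add: w_def hip_diff_left)
  qed
  then have "\<forall>i<j. hip (?g j) (?g i) = 0" by (simp add: g hip_scl_left)
  moreover have "hip (?g j) (?g j) = 1"
    using pos unfolding g hip_scl_left hip_scl_right hip_self_hnorm[of w]
    by (simp add: power2_eq_square)
  moreover have "?g j = complex_of_real (1 / hnorm w) \<cdot> f j + (- complex_of_real (1 / hnorm w)) \<cdot> q"
    unfolding g by (rule poly_mapping_eqI) (simp add: w_def lookup_add lookup_minus algebra_simps)
  moreover have "(- complex_of_real (1 / hnorm w)) \<cdot> q \<in> cinf.span (f ` {..<j})"
    using q by (rule cinf.span_scale)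
  moreover have "1 / hnorm w > 0" using pos by simp
  ultimately show ?case by blast
qed

lemma gram_schmidt_orthonormal: "lindep {..<n} f \<Longrightarrow> orthonormal n (gram_schmidt f)"
  unfolding orthonormal_def
proof (intro allI impI)
  fix i j assume li: "lindep {..<n} f" and ij: "i < n" "j < n"
  show "hip (gram_schmidt f i) (gram_schmidt f j) = (if i = j then 1 else 0)"
  proof (cases i j rule: linorder_cases)
    case less
    then have "hip (gram_schmidt f j) (gram_schmidt f i) = 0"
      using gram_schmidt_step[OF li ij(2)] by simp
    then show ?thesis using less hip_cnj[of "gram_schmidt f j" "gram_schmidt f i"] by simp
  qed (use gram_schmidt_step[OF li ij(1)] in auto)
qed

lemma orthonormal_coeff:
  assumes "orthonormal n g" "i < n"
  shows "hip (\<Sum>j<n. c j \<cdot> g j) (g i) = c i"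
proof -
  have "hip (\<Sum>j<n. c j \<cdot> g j) (g i) = (\<Sum>j<n. c j * (if j = i then 1 else 0))"
    unfolding hip_sum_left hip_scl_left using assms by (intro sum.cong) (auto simp: orthonormal_def)
  then show ?thesis using assms(2) by (simp add: if_distrib cong: if_cong)
qed

lemma orthonormal_lindep: "orthonormal n g \<Longrightarrow> lindep {..<n} g"
  by (rule lindepI) (metis orthonormal_coeff hip_zero(1) lessThan_iff)

lemma gram_schmidt_span:
  assumes li: "lindep {..<n} f"
  shows "cinf.span (gram_schmidt f ` {..<n}) = cinf.span (f ` {..<n})"
proof (cases "n = 0")
  case False
  have li': "lindep {..<n} (gram_schmidt f)"
    using gram_schmidt_orthonormal[OF li] by (rule orthonormal_lindep)
  have "gram_schmidt f j \<in> cinf.span (f ` {..<n})" if j: "j < n" for j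
  proof -
    obtain a p where p: "p \<in> cinf.span (f ` {..<j})" "gram_schmidt f j = complex_of_real a \<cdot> f j + p"
      using gram_schmidt_step[OF li j] by blast
    have "p \<in> cinf.span (f ` {..<n})"
      using p(1) j by (auto intro: span_lessThan_mono)
    then show ?thesis
      unfolding p(2) using j by (simp add: cinf.span_add cinf.span_scale cinf.span_base)
  qed
  then show ?thesis
    using False li' by (intro lindep_spans[of _ n] lindep_span_in_grassmannian li) auto
qed simp

text \<open>In a nontrivial relation let \<open>m\<close> be the largest index with a nonzero
  coefficient; solving for \<open>f m\<close> puts it into the span of its predecessors.\<close>

lemma triangular_lindep:
  fixes n :: nat
  assumes li: "lindep {..<n} f" and a: "\<And>j. j < n \<Longrightarrow> a j \<noteq> 0"
    and p: "\<And>j. j < n \<Longrightarrow> p j \<in> cinf.span (f ` {..<j})"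
    and g: "\<And>j. j < n \<Longrightarrow> g j = a j \<cdot> f j + p j"
  shows "lindep {..<n} g"
proof (rule lindepI, rule ccontr)
  fix c i assume c: "(\<Sum>j<n. c j \<cdot> g j) = 0" and i: "i \<in> {..<n}" "c i \<noteq> 0"
  let ?J = "{j. j < n \<and> c j \<noteq> 0}"
  define m where "m = Max ?J"
  have fin: "finite ?J" by simp
  have "m \<in> ?J" unfolding m_def by (rule Max_in[OF fin]) (use i in auto)
  then have m: "m < n" "c m \<noteq> 0" by auto
  have above: "c j = 0" if "j < n" "m < j" for j
  proof (rule ccontr)
    assume "c j \<noteq> 0"
    then have "j \<in> ?J" using that by simp
    then have "j \<le> m" unfolding m_def by (rule Max_ge[OF fin])
    then show False using that by simp
  qed
  have "(\<Sum>j<n. c j \<cdot> g j) = (\<Sum>j<Suc m. c j \<cdot> g j)"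
    using m(1) above by (intro sum.mono_neutral_right) auto
  then have eq: "(\<Sum>j<m. c j \<cdot> g j) + c m \<cdot> p m + (c m * a m) \<cdot> f m = 0"
    using c g[OF m(1)] by (simp add: cinf.scale_right_distrib ac_simps)
  have "g j \<in> cinf.span (f ` {..<m})" if "j < m" for j
  proof -
    have "p j \<in> cinf.span (f ` {..<m})"
      using p[of j] that m by (auto intro: span_lessThan_mono)
    moreover have "f j \<in> cinf.span (f ` {..<m})" using that by (intro cinf.span_base) auto
    ultimately show ?thesis
      using g[of j] that m by (simp add: cinf.span_add cinf.span_scale)
  qed
  then have "(\<Sum>j<m. c j \<cdot> g j) + c m \<cdot> p m \<in> cinf.span (f ` {..<m})"
    using p[OF m(1)] by (intro cinf.span_add cinf.span_sum cinf.span_scale) auto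
  moreover have "(c m * a m) \<cdot> f m = - ((\<Sum>j<m. c j \<cdot> g j) + c m \<cdot> p m)"
    using eq by (simp only: add_eq_0_iff)
  ultimately have "(c m * a m) \<cdot> f m \<in> cinf.span (f ` {..<m})"
    by (metis cinf.span_neg)
  then have "(1 / (c m * a m)) \<cdot> (c m * a m) \<cdot> f m \<in> cinf.span (f ` {..<m})"
    by (rule cinf.span_scale)
  then have "f m \<in> cinf.span (f ` {..<m})" using m a by simp
  then show False using lindep_not_in_span[OF li m(1)] by simp
qed

text \<open>Along the segment the leading coefficients are \<open>1 - t + t * a\<close> with
  \<open>a > 0\<close>, so they never vanish.\<close>

lemma gram_schmidt_interpolate_lindep:
  assumes li: "lindep {..<n} f" and t: "0 \<le> t" "t \<le> 1"
  shows "lindep {..<n} (\<lambda>j. complex_of_real (1 - t) \<cdot> f j + complex_of_real t \<cdot> gram_schmidt f j)"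
proof -
  have "\<exists>a p. a > 0 \<and> p \<in> cinf.span (f ` {..<j}) \<and> gram_schmidt f j = complex_of_real a \<cdot> f j + p"
    if "j < n" for j using gram_schmidt_step[OF li that] by blast
  then obtain a p where ap: "\<And>j. j < n \<Longrightarrow> a j > 0" "\<And>j. j < n \<Longrightarrow> p j \<in> cinf.span (f ` {..<j})"
    "\<And>j. j < n \<Longrightarrow> gram_schmidt f j = complex_of_real (a j) \<cdot> f j + p j" by metis
  show ?thesis
  proof (rule triangular_lindep[OF li, where a = "\<lambda>j. complex_of_real (1 - t + t * a j)"
        and p = "\<lambda>j. complex_of_real t \<cdot> p j"])
    fix j assume j: "j < n"
    have "1 - t + t * a j > 0"
    proof (cases "t = 1")
      case False
      then show ?thesis using t ap(1)[OF j] by (intro add_pos_nonneg) auto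
    qed (use ap(1)[OF j] in simp)
    then show "complex_of_real (1 - t + t * a j) \<noteq> 0" by (metis of_real_eq_0_iff less_irrefl)
    show "complex_of_real t \<cdot> p j \<in> cinf.span (f ` {..<j})"
      using ap(2)[OF j] by (rule cinf.span_scale)
    show "complex_of_real (1 - t) \<cdot> f j + complex_of_real t \<cdot> gram_schmidt f j =
        complex_of_real (1 - t + t * a j) \<cdot> f j + complex_of_real t \<cdot> p j"
      unfolding ap(3)[OF j] by (rule poly_mapping_eqI) (simp add: lookup_add algebra_simps)
  qed
qed

lemma gram_schmidt_of_orthonormal:
  assumes "orthonormal n f" "j < n"
  shows "gram_schmidt f j = f j"
  using assms(2)
proof (induction j rule: less_induct)
  case (less j)
  have "(\<Sum>i<j. hip (f j) (gram_schmidt f i) \<cdot> gram_schmidt f i) = (\<Sum>i<j. 0)"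
    using less assms(1) by (intro sum.cong) (auto simp: orthonormal_def)
  moreover have "hip (f j) (f j) = 1" using assms(1) less.prems by (simp add: orthonormal_def)
  ultimately show ?case by (subst gram_schmidt.simps) (simp add: hnorm_def)
qed

text \<open>The formulation with filters serves both the abstract frame topology, through
  \<open>atin\<close>, and subsets of a type, through \<open>at x within S\<close>.\<close>

lemma tendsto_gram_schmidt:
  assumes f: "\<And>i. i < n \<Longrightarrow> ((\<lambda>x. f x i) \<longlongrightarrow> l i) F"
    and li: "lindep {..<n} l" and j: "j < n"
  shows "((\<lambda>x. gram_schmidt (f x) j) \<longlongrightarrow> gram_schmidt l j) F"
  using j
proof (induction j rule: less_induct)
  case (less j)
  define w where "w f = f j - (\<Sum>i<j. hip (f j) (gram_schmidt f i) \<cdot> gram_schmidt f i)" for f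
  have gs: "gram_schmidt f j = complex_of_real (1 / hnorm (w f)) \<cdot> w f" for f
    by (subst gram_schmidt.simps) (simp add: w_def Let_def)
  have w: "((\<lambda>x. w (f x)) \<longlongrightarrow> w l) F"
    unfolding w_def using less f
    by (intro tendsto_diff tendsto_sum tendsto_scl tendsto_hip) auto
  have "gram_schmidt l j \<noteq> 0"
    using gram_schmidt_step[OF li less.prems] by (auto simp del: hip_self)
  then have "w l \<noteq> 0" using gs[of l] by auto
  then have "hnorm (w l) \<noteq> 0" using hnorm_pos by force
  then show ?case
    unfolding gs using w
    by (intro tendsto_scl tendsto_of_real tendsto_divide tendsto_const)
      (auto simp: hnorm_def intro!: tendsto_real_sqrt tendsto_Re tendsto_hip)
qed

section \<open>Orthogonal projections\<close>

text \<open>The characterisation by orthogonality mentions no basis, so this is a function on the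
  Grassmannian, and uniqueness yields linearity and compatibility with conjugation.\<close>

definition proj :: "cinf set \<Rightarrow> cinf \<Rightarrow> cinf" where
  "proj W v = (THE p. p \<in> W \<and> (\<forall>w\<in>W. hip (v - p) w = 0))"

lemma grassmannian_basis:
  assumes "W \<in> grassmannian n" "n \<ge> 1"
  obtains f where "lindep {..<n} f" "W = cinf.span (f ` {..<n})"
proof -
  obtain B where B: "B \<subseteq> W" "cinf.independent B" "W \<subseteq> cinf.span B" "card B = cinf.dim W"
    using cinf.basis_exists by blast
  have sub: "cinf.subspace W" and dim: "cinf.dim W = n" using assms(1) by (auto simp: grassmannian_def)
  have "finite B" using B(4) dim assms(2) card.infinite by fastforce
  then obtain f where f: "bij_betw f {..<n} B"
    using ex_bij_betw_nat_finite[of B] B(4) dim by (auto simp: atLeast0LessThan)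
  then have "lindep {..<n} f" using B(2) by (simp add: lindep_iff bij_betw_def)
  moreover have "W = cinf.span (f ` {..<n})"
    using f B sub cinf.span_minimal[OF B(1) sub] by (auto simp: bij_betw_def)
  ultimately show thesis by (rule that)
qed

lemma grassmannian_orthonormal_basis:
  assumes "W \<in> grassmannian n" "n \<ge> 1"
  obtains g where "orthonormal n g" "W = cinf.span (g ` {..<n})"
proof -
  obtain f where "lindep {..<n} f" "W = cinf.span (f ` {..<n})"
    using assms by (rule grassmannian_basis)
  then show thesis
    using that[of "gram_schmidt f"] by (simp add: gram_schmidt_orthonormal gram_schmidt_span)
qed

lemma proj_eqI:
  assumes "cinf.subspace W" "p \<in> W" "\<And>w. w \<in> W \<Longrightarrow> hip (v - p) w = 0"
  shows "proj W v = p"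
  unfolding proj_def
proof (rule the_equality)
  fix q assume q: "q \<in> W \<and> (\<forall>w\<in>W. hip (v - q) w = 0)"
  then have "q - p \<in> W" using assms by (simp add: cinf.subspace_diff)
  then have "hip (v - p) (q - p) = 0" "hip (v - q) (q - p) = 0" using assms q by auto
  then have "hip (q - p) (q - p) = 0"
    using hip_diff_left[of "v - p" "v - q" "q - p"] by simp
  then show "q = p" by (simp add: hip_self_eq_0)
qed (use assms in auto)

lemma orthonormal_residual:
  assumes g: "orthonormal n g" and w: "w \<in> cinf.span (g ` {..<n})"
  shows "hip (v - (\<Sum>j<n. hip v (g j) \<cdot> g j)) w = 0"
proof -
  obtain c where w: "w = (\<Sum>i<n. c i \<cdot> g i)" using w by (auto simp: span_family)
  show ?thesis
    unfolding w hip_sum_right hip_scl_right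
    by (intro sum.neutral) (simp add: hip_diff_left orthonormal_coeff[OF g])
qed

lemma proj_span_orthonormal:
  assumes "orthonormal n g"
  shows "proj (cinf.span (g ` {..<n})) v = (\<Sum>j<n. hip v (g j) \<cdot> g j)"
  by (rule proj_eqI) (auto intro: sum_in_span_family orthonormal_residual[OF assms])

lemma proj_props:
  assumes "W \<in> grassmannian n" "n \<ge> 1"
  shows proj_in: "proj W v \<in> W"
    and proj_orth: "w \<in> W \<Longrightarrow> hip (v - proj W v) w = 0"
proof -
  obtain g where g: "orthonormal n g" "W = cinf.span (g ` {..<n})"
    using assms by (rule grassmannian_orthonormal_basis)
  note eq = proj_span_orthonormal[OF g(1), of v, folded g(2)]
  show "proj W v \<in> W"
    unfolding eq unfolding g(2) by (rule sum_in_span_family) simp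
  show "hip (v - proj W v) w = 0" if "w \<in> W"
    unfolding eq using that g by (simp add: orthonormal_residual)
qed

lemma proj_id: "cinf.subspace W \<Longrightarrow> v \<in> W \<Longrightarrow> proj W v = v"
  by (rule proj_eqI) auto

lemma proj_add:
  assumes "W \<in> grassmannian n" "n \<ge> 1"
  shows "proj W (v + w) = proj W v + proj W w"
proof (rule proj_eqI)
  show sub: "cinf.subspace W" using assms(1) by (simp add: grassmannian_def)
  show "proj W v + proj W w \<in> W"
    using sub assms by (intro cinf.subspace_add proj_in)
  fix x assume "x \<in> W"
  then have "hip (v - proj W v) x + hip (w - proj W w) x = 0" using assms by (simp add: proj_orth)
  then show "hip (v + w - (proj W v + proj W w)) x = 0"
    by (simp add: hip_diff_left hip_add_left algebra_simps)
qed

lemma proj_scl: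
  assumes "W \<in> grassmannian n" "n \<ge> 1"
  shows "proj W (c \<cdot> v) = c \<cdot> proj W v"
proof (rule proj_eqI)
  show sub: "cinf.subspace W" using assms(1) by (simp add: grassmannian_def)
  show "c \<cdot> proj W v \<in> W"
    using sub assms by (intro cinf.subspace_scale proj_in)
  fix x assume "x \<in> W"
  then have "c * hip (v - proj W v) x = 0" using assms by (simp add: proj_orth)
  then show "hip (c \<cdot> v - c \<cdot> proj W v) x = 0"
    by (simp add: hip_diff_left hip_scl_left algebra_simps)
qed

lemma proj_zero: "W \<in> grassmannian n \<Longrightarrow> n \<ge> 1 \<Longrightarrow> proj W 0 = 0"
  using proj_scl[of W n 0 0] by simp

lemma proj_sum:
  assumes "W \<in> grassmannian n" "n \<ge> 1"
  shows "proj W (sum f S) = (\<Sum>i\<in>S. proj W (f i))"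
  by (induction S rule: infinite_finite_induct) (simp_all add: proj_add[OF assms] proj_zero[OF assms])

section \<open>Conjugation of subspaces and projections\<close>

lemma cinf_cnj_image_span:
  "cinf_cnj ` cinf.span S = cinf.span (cinf_cnj ` S)"
proof -
  have sub: "cinf_cnj ` cinf.span S \<subseteq> cinf.span (cinf_cnj ` S)" for S
  proof
    fix v assume "v \<in> cinf_cnj ` cinf.span S"
    then obtain w where w: "w \<in> cinf.span S" "v = cinf_cnj w" by blast
    from w(1) have "cinf_cnj w \<in> cinf.span (cinf_cnj ` S)"
    proof (induction rule: cinf.span_induct_alt)
      case base show ?case by (simp add: cinf.span_zero)
    next
      case (step c x y)
      moreover have "cinf_cnj x \<in> cinf.span (cinf_cnj ` S)"
        using step by (intro cinf.span_base) auto
      ultimately show ?case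
        by (simp add: cinf_cnj_add cinf_cnj_scl cinf.span_add cinf.span_scale)
    qed
    then show "v \<in> cinf.span (cinf_cnj ` S)" using w by simp
  qed
  have "cinf.span (cinf_cnj ` S) = cinf_cnj ` cinf_cnj ` cinf.span (cinf_cnj ` S)"
    by (simp add: image_image)
  also have "\<dots> \<subseteq> cinf_cnj ` cinf.span (cinf_cnj ` cinf_cnj ` S)"
    by (intro image_mono sub)
  finally have "cinf.span (cinf_cnj ` S) \<subseteq> cinf_cnj ` cinf.span S"
    by (simp add: image_image)
  with sub show ?thesis by (rule equalityI)
qed

lemma lindep_cnj:
  assumes "lindep I f"
  shows "lindep I (\<lambda>i. cinf_cnj (f i))"
proof (rule lindepI)
  fix c i assume c: "(\<Sum>i\<in>I. c i \<cdot> cinf_cnj (f i)) = 0" and i: "i \<in> I"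
  have "(\<Sum>i\<in>I. cnj (c i) \<cdot> f i) = cinf_cnj (\<Sum>i\<in>I. c i \<cdot> cinf_cnj (f i))"
    by (simp add: cinf_cnj_sum cinf_cnj_scl)
  then have "cnj (c i) = 0" using c i by (intro lindepD[OF assms]) simp_all
  then show "c i = 0" by simp
qed

lemma cinf_cnj_grassmannian:
  assumes "W \<in> grassmannian n" "n \<ge> 1"
  shows "cinf_cnj ` W \<in> grassmannian n"
proof -
  obtain f where f: "lindep {..<n} f" "W = cinf.span (f ` {..<n})"
    using assms by (rule grassmannian_basis)
  have "cinf_cnj ` W = cinf.span ((\<lambda>i. cinf_cnj (f i)) ` {..<n})"
    by (simp add: f(2) cinf_cnj_image_span image_image)
  then show ?thesis
    using lindep_span_in_grassmannian[OF _ _ lindep_cnj[OF f(1)]] by simp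
qed

lemma proj_cnj:
  assumes "W \<in> grassmannian n" "n \<ge> 1"
  shows "proj (cinf_cnj ` W) (cinf_cnj v) = cinf_cnj (proj W v)"
proof (rule proj_eqI)
  show "cinf.subspace (cinf_cnj ` W)"
    using cinf_cnj_grassmannian[OF assms] by (simp add: grassmannian_def)
  show "cinf_cnj (proj W v) \<in> cinf_cnj ` W" using proj_in[OF assms] by blast
  fix w assume "w \<in> cinf_cnj ` W"
  then obtain x where "x \<in> W" "w = cinf_cnj x" by blast
  then show "hip (cinf_cnj v - cinf_cnj (proj W v)) w = 0"
    using proj_orth[OF assms, of x v] by (simp add: hip_cinf_cnj flip: cinf_cnj_diff)
qed

section \<open>The topology of the Grassmannian\<close>

definition bvec :: "nat \<Rightarrow> cinf" where
  "bvec i = Poly_Mapping.single i 1"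

lemma lookup_bvec: "coord (bvec i) j = (if i = j then 1 else 0)"
  by (simp add: bvec_def lookup_single when_def)

lemma cfin_iff: "v \<in> cfin m \<longleftrightarrow> (\<forall>i\<ge>m. coord v i = 0)"
  by (auto simp: cfin_def in_keys_iff subset_iff not_le[symmetric])

lemma cfin_mono: "m \<le> m' \<Longrightarrow> cfin m \<subseteq> cfin m'"
  by (auto simp: cfin_iff)

lemma cfin_expand:
  assumes "v \<in> cfin m"
  shows "v = (\<Sum>i<m. coord v i \<cdot> bvec i)"
proof (rule poly_mapping_eqI)
  fix k
  have "coord (\<Sum>i<m. coord v i \<cdot> bvec i) k =
      (\<Sum>i<m. if i = k then coord v k else 0)"
    unfolding lookup_sum_cinf by (intro sum.cong) (auto simp: lookup_bvec)
  also have "\<dots> = coord v k" using assms by (auto simp: cfin_iff)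
  finally show "coord v k = coord (\<Sum>i<m. coord v i \<cdot> bvec i) k" ..
qed

lemma topspace_frame_topology:
  "F \<in> topspace (frame_topology n m) \<longleftrightarrow>
     F \<in> extensional {..<n} \<and> (\<forall>j<n. F j \<in> cfin m) \<and> lindep {..<n} F"
  by (auto simp: frame_topology_def cfin_topology_def topspace_pullback_topology PiE_iff lindep_iff)

text \<open>The restriction appears because the points of a product topology are extensional
  functions.\<close>

lemma continuous_map_into_frame:
  assumes cont: "\<And>j i. j < n \<Longrightarrow> continuous_map T euclidean (\<lambda>z. coord (h z j) i)"
    and fin: "\<And>z j. z \<in> topspace T \<Longrightarrow> j < n \<Longrightarrow> h z j \<in> cfin m"
    and li: "\<And>z. z \<in> topspace T \<Longrightarrow> lindep {..<n} (h z)"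
  shows "continuous_map T (frame_topology n m) (\<lambda>z. restrict (h z) {..<n})"
  unfolding frame_topology_def continuous_map_in_subtopology
proof
  have "continuous_map T (cfin_topology m) (\<lambda>z. h z j)" if j: "j < n" for j
    unfolding cfin_topology_def
  proof (rule continuous_map_pullback')
    have "continuous_map T (product_topology (\<lambda>_. euclidean) UNIV) (\<lambda>z. coord (h z j))"
      unfolding continuous_map_componentwise_UNIV using cont[OF j] by simp
    then show "continuous_map T euclidean (coord \<circ> (\<lambda>z. h z j))"
      by (simp add: euclidean_product_topology o_def)
  qed (use fin j in auto)
  then show "continuous_map T (product_topology (\<lambda>_. cfin_topology m) {..<n}) (\<lambda>z. restrict (h z) {..<n})"
    by (auto simp: continuous_map_componentwise)
  have "lindep {..<n} (restrict (h z) {..<n})" if "z \<in> topspace T" for z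
    using li[OF that] unfolding lindep_def by simp
  then show "(\<lambda>z. restrict (h z) {..<n}) \<in> topspace T \<rightarrow> {F. inj_on F {..<n} \<and> cinf.independent (F ` {..<n})}"
    using lindep_iff[of "{..<n}"] by blast
qed

lemma continuous_map_frame_span:
  "continuous_map (frame_topology n m) (grassmannian_topology n) (\<lambda>F. cinf.span (F ` {..<n}))"
  unfolding continuous_map_def
proof (intro conjI allI impI)
  show "(\<lambda>F. cinf.span (F ` {..<n})) \<in> topspace (frame_topology n m) \<rightarrow> topspace (grassmannian_topology n)"
    using frame_span_in_grassmannian(1) by auto
  fix U assume "openin (grassmannian_topology n) U"
  then have "grassmannian_fin_open n m {W \<in> U. W \<subseteq> cfin m}"
    by (simp add: openin_grassmannian_topology grassmannian_open_def)
  then have "openin (frame_topology n m)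
      {F \<in> topspace (frame_topology n m). cinf.span (F ` {..<n}) \<in> {W \<in> U. W \<subseteq> cfin m}}"
    by (simp add: grassmannian_fin_open_def)
  moreover have "{F \<in> topspace (frame_topology n m). cinf.span (F ` {..<n}) \<in> {W \<in> U. W \<subseteq> cfin m}} =
      {F \<in> topspace (frame_topology n m). cinf.span (F ` {..<n}) \<in> U}"
    using frame_span_in_grassmannian(2) by auto
  ultimately show "openin (frame_topology n m)
      {F \<in> topspace (frame_topology n m). cinf.span (F ` {..<n}) \<in> U}"
    by simp
qed

lemma continuous_map_into_grassmannian:
  assumes "\<And>j i. j < n \<Longrightarrow> continuous_map T euclidean (\<lambda>z. coord (h z j) i)"
    and "\<And>z j. z \<in> topspace T \<Longrightarrow> j < n \<Longrightarrow> h z j \<in> cfin m"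
    and "\<And>z. z \<in> topspace T \<Longrightarrow> lindep {..<n} (h z)"
  shows "continuous_map T (grassmannian_topology n) (\<lambda>z. cinf.span (h z ` {..<n}))"
proof -
  have "continuous_map T (grassmannian_topology n)
      ((\<lambda>F. cinf.span (F ` {..<n})) \<circ> (\<lambda>z. restrict (h z) {..<n}))"
    using continuous_map_into_frame[OF assms] continuous_map_frame_span by (rule continuous_map_compose)
  moreover have "restrict (h z) {..<n} ` {..<n} = h z ` {..<n}" for z
    by (rule image_cong) auto
  ultimately show ?thesis by (simp only: o_def)
qed

lemma continuous_map_from_grassmannian:
  assumes g: "g \<in> grassmannian n \<rightarrow> topspace Y"
    and cont: "\<And>m. continuous_map (frame_topology n m) Y (\<lambda>F. g (cinf.span (F ` {..<n})))"
  shows "continuous_map (grassmannian_topology n) Y g"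
  unfolding continuous_map_def
proof (intro conjI allI impI)
  fix U assume U: "openin Y U"
  have "grassmannian_fin_open n m {W \<in> {W \<in> grassmannian n. g W \<in> U}. W \<subseteq> cfin m}" for m
  proof -
    have "{F \<in> topspace (frame_topology n m).
          cinf.span (F ` {..<n}) \<in> {W \<in> {W \<in> grassmannian n. g W \<in> U}. W \<subseteq> cfin m}} =
        {F \<in> topspace (frame_topology n m). g (cinf.span (F ` {..<n})) \<in> U}"
      using frame_span_in_grassmannian[of _ n m] by auto
    then show ?thesis
      using openin_continuous_map_preimage[OF cont[of m] U] by (auto simp: grassmannian_fin_open_def)
  qed
  then show "openin (grassmannian_topology n) {W \<in> topspace (grassmannian_topology n). g W \<in> U}"
    by (auto simp: openin_grassmannian_topology grassmannian_open_def)
qed (use g in simp)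

lemma continuous_map_frame_lookup:
  assumes "j < n"
  shows "continuous_map (frame_topology n m) euclidean (\<lambda>F. coord (F j) i)"
proof -
  have 1: "continuous_map (frame_topology n m) (cfin_topology m) (\<lambda>F. F j)"
    unfolding frame_topology_def using assms
    by (intro continuous_map_from_subtopology continuous_map_product_projection) auto
  have "continuous_map (cfin_topology m) euclidean coord"
    unfolding cfin_topology_def by (rule continuous_map_pullback[where g = id, unfolded id_comp o_id]) auto
  then have 2: "continuous_map (cfin_topology m) (product_topology (\<lambda>_. euclidean) UNIV) coord"
    by (simp add: euclidean_product_topology)
  have 3: "continuous_map (product_topology (\<lambda>_. euclidean) UNIV) euclidean (\<lambda>x :: nat \<Rightarrow> complex. x i)"
    by (rule continuous_map_product_projection) simp
  from continuous_map_compose[OF 1 continuous_map_compose[OF 2 3]] show ?thesis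
    by (simp add: o_def)
qed

text \<open>Coordinatewise continuity gives continuity in norm because a vector of
  \<open>cfin m\<close> is a sum of \<open>m\<close> coordinate multiples.\<close>

lemma continuous_map_frame_vector:
  assumes "j < n"
  shows "continuous_map (frame_topology n m) euclidean (\<lambda>F. F j)"
  unfolding continuous_map_atin limitin_canonical_iff
proof
  fix F assume F: "F \<in> topspace (frame_topology n m)"
  have fin: "G j \<in> cfin m" if "G \<in> topspace (frame_topology n m)" for G
    using that assms by (simp add: topspace_frame_topology)
  have "((\<lambda>G. \<Sum>i<m. coord (G j) i \<cdot> bvec i) \<longlongrightarrow> (\<Sum>i<m. coord (F j) i \<cdot> bvec i))
      (atin (frame_topology n m) F)"
    using continuous_map_frame_lookup[OF assms] F
    by (intro tendsto_sum tendsto_scl tendsto_const) (auto simp: continuous_map_atin)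
  then have "((\<lambda>G. \<Sum>i<m. coord (G j) i \<cdot> bvec i) \<longlongrightarrow> F j) (atin (frame_topology n m) F)"
    using cfin_expand[OF fin[OF F]] by simp
  moreover have "\<forall>\<^sub>F G in atin (frame_topology n m) F.
      (\<Sum>i<m. coord (G j) i \<cdot> bvec i) = G j"
    unfolding eventually_atin using cfin_expand[OF fin] F
    by (intro disjI2 exI[of _ "topspace (frame_topology n m)"]) auto
  ultimately show "((\<lambda>G. G j) \<longlongrightarrow> F j) (atin (frame_topology n m) F)"
    by (rule Lim_transform_eventually)
qed

text \<open>The entries of projections give access to the abstract colimit topology: on frames they
  are given by the Gram-Schmidt formula, hence continuous, and together they separate
  subspaces.\<close>

lemma continuous_map_proj_lookup:
  "continuous_map (grassmannian_topology n) euclidean (\<lambda>W. coord (proj W v) i)"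
proof (rule continuous_map_from_grassmannian)
  fix m
  show "continuous_map (frame_topology n m) euclidean
      (\<lambda>F. coord (proj (cinf.span (F ` {..<n})) v) i)"
  proof (rule continuous_map_eq)
    show "continuous_map (frame_topology n m) euclidean
        (\<lambda>F. \<Sum>j<n. hip v (gram_schmidt F j) * coord (gram_schmidt F j) i)"
      unfolding continuous_map_atin limitin_canonical_iff
    proof
      fix F assume F: "F \<in> topspace (frame_topology n m)"
      have "((\<lambda>G. gram_schmidt G j) \<longlongrightarrow> gram_schmidt F j) (atin (frame_topology n m) F)"
        if "j < n" for j
        using continuous_map_frame_vector F that topspace_frame_topology[of F n m]
        by (intro tendsto_gram_schmidt[where n = n]) (auto simp: continuous_map_atin)
      then show "((\<lambda>F. \<Sum>j<n. hip v (gram_schmidt F j) * coord (gram_schmidt F j) i) \<longlongrightarrow>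
          (\<Sum>j<n. hip v (gram_schmidt F j) * coord (gram_schmidt F j) i))
          (atin (frame_topology n m) F)"
        by (intro tendsto_sum tendsto_mult tendsto_hip tendsto_const
            bounded_linear.tendsto[OF bounded_linear_lookup]) auto
    qed
    fix F assume "F \<in> topspace (frame_topology n m)"
    then have li: "lindep {..<n} F" by (simp add: topspace_frame_topology)
    have "proj (cinf.span (F ` {..<n})) v = (\<Sum>j<n. hip v (gram_schmidt F j) \<cdot> gram_schmidt F j)"
      using proj_span_orthonormal[OF gram_schmidt_orthonormal[OF li]] gram_schmidt_span[OF li] by simp
    then show "(\<Sum>j<n. hip v (gram_schmidt F j) * coord (gram_schmidt F j) i) =
        coord (proj (cinf.span (F ` {..<n})) v) i"
      by (simp add: lookup_sum_cinf)
  qed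
qed simp

lemma cfin_of_grassmannian:
  assumes "W \<in> grassmannian n" "n \<ge> 1"
  obtains m where "W \<subseteq> cfin m"
proof -
  obtain f where f: "W = cinf.span (f ` {..<n})"
    using assms by (rule grassmannian_basis)
  have "finite (\<Union>j<n. Poly_Mapping.keys (f j))" by simp
  then obtain m where "(\<Union>j<n. Poly_Mapping.keys (f j)) \<subseteq> {..<m}"
    using finite_nat_iff_bounded by blast
  then have "f ` {..<n} \<subseteq> cfin m" by (auto simp: cfin_def)
  then have "W \<subseteq> cfin m" unfolding f using cfin_subspace by (rule cinf.span_minimal)
  then show thesis by (rule that)
qed

text \<open>\<open>W\<close> is the set of vectors fixed by its projection, so it is cut out by
  closed conditions on the entries.\<close>

lemma closedin_grassmannian_singleton:
  assumes "W \<in> grassmannian n" "n \<ge> 1"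
  shows "closedin (grassmannian_topology n) {W}"
proof -
  let ?C = "\<lambda>p. {V \<in> topspace (grassmannian_topology n).
      coord (proj V (fst p)) (snd p) \<in> {coord (proj W (fst p)) (snd p)}}"
  have "closedin (grassmannian_topology n) (?C p)" for p
    by (rule closedin_continuous_map_preimage[OF continuous_map_proj_lookup]) simp
  then have "closedin (grassmannian_topology n) (\<Inter>p\<in>UNIV. ?C p)"
    by (intro closedin_INT) simp_all
  moreover have "(\<Inter>p\<in>UNIV. ?C p) = {W}"
  proof (intro equalityI subsetI)
    fix V assume V': "V \<in> (\<Inter>p\<in>UNIV. ?C p)"
    then have V: "V \<in> grassmannian n" by simp
    have eq: "proj V v = proj W v" for v
    proof (rule poly_mapping_eqI)
      fix i
      from V' have "V \<in> ?C (v, i)" by (rule INT_D) simp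
      then show "coord (proj V v) i = coord (proj W v) i" by simp
    qed
    have "v \<in> V \<longleftrightarrow> proj V v = v" "v \<in> W \<longleftrightarrow> proj W v = v" for v
      using proj_id[of V v] proj_in[OF V assms(2), of v] proj_id[of W v] proj_in[OF assms, of v] V assms(1)
      by (auto simp: grassmannian_def)
    then show "V \<in> {W}" using eq by auto
  qed (use assms in auto)
  ultimately show ?thesis by simp
qed

text \<open>Otherwise \<open>K\<close> contains a sequence meeting each \<open>Gr\<^sub>n(\<complex>\<^sup>m)\<close> in a finite set; removing
  its tails gives an increasing open cover without finite subcover.\<close>

lemma compact_image_in_cfin:
  assumes K: "compactin (grassmannian_topology n) K" and n: "n \<ge> 1"
  obtains N where "\<And>W. W \<in> K \<Longrightarrow> W \<subseteq> cfin N"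
proof (rule ccontr)
  assume "\<not> thesis"
  then have "\<forall>N. \<exists>W\<in>K. \<not> W \<subseteq> cfin N" using that by blast
  then obtain w where w: "\<And>N. w N \<in> K" "\<And>N. \<not> w N \<subseteq> cfin N" by metis
  have Kg: "K \<subseteq> grassmannian n" using compactin_subset_topspace[OF K] by simp
  define U where "U i = grassmannian n - w ` {i..}" for i
  have "openin (grassmannian_topology n) (U i)" for i
    unfolding openin_grassmannian_topology grassmannian_open_def
  proof (intro conjI allI)
    fix m
    let ?T = "w ` {j. i \<le> j \<and> j < m}"
    have "?T = (\<Union>W\<in>?T. {W})" by simp
    also have "closedin (grassmannian_topology n) \<dots>"
      using w(1) Kg by (intro closedin_Union) (auto intro!: closedin_grassmannian_singleton n)
    finally have "openin (grassmannian_topology n) (grassmannian n - ?T)"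
      using openin_diff[OF openin_topspace] by fastforce
    then have "grassmannian_fin_open n m {W \<in> grassmannian n - ?T. W \<subseteq> cfin m}"
      by (simp add: openin_grassmannian_topology grassmannian_open_def)
    moreover have "{W \<in> grassmannian n - ?T. W \<subseteq> cfin m} = {W \<in> U i. W \<subseteq> cfin m}"
    proof -
      \<comment> \<open>Since \<open>w j\<close> is not contained in \<open>cfin j\<close>, only
        indices below \<open>m\<close> can occur inside \<open>cfin m\<close>.\<close>
      have "j < m" if "w j \<subseteq> cfin m" for j
        using that w(2)[of j] cfin_mono[of m j] by force
      then show ?thesis by (auto simp: U_def)
    qed
    ultimately show "grassmannian_fin_open n m {W \<in> U i. W \<subseteq> cfin m}" by simp
  qed (auto simp: U_def)
  moreover have "K \<subseteq> \<Union> (range U)"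
  proof
    fix W assume "W \<in> K"
    then have W: "W \<in> grassmannian n" using Kg by blast
    then obtain m where m: "W \<subseteq> cfin m" using n by (rule cfin_of_grassmannian)
    have "W \<notin> w ` {m..}"
    proof
      assume "W \<in> w ` {m..}"
      then obtain j where "m \<le> j" "W = w j" by auto
      then show False using m w(2)[of j] cfin_mono[of m j] by blast
    qed
    then show "W \<in> \<Union> (range U)" using W by (auto simp: U_def)
  qed
  ultimately obtain \<F> where \<F>: "finite \<F>" "\<F> \<subseteq> range U" "K \<subseteq> \<Union>\<F>"
    using compactinD[OF K, of "range U"] by blast
  then obtain I where I: "finite I" "\<F> = U ` I" by (meson finite_subset_image)
  then obtain b where "\<forall>i\<in>I. i \<le> b" using finite_nat_set_iff_bounded_le by blast
  then have "w b \<notin> \<Union>\<F>" using I(2) by (auto simp: U_def)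
  then show False using w(1) \<F>(3) by blast
qed

lemma continuous_on_proj:
  assumes F: "continuous_map (top_of_set S) (grassmannian_topology n) F"
    and n: "n \<ge> 1" and N: "\<And>z. z \<in> S \<Longrightarrow> F z \<subseteq> cfin N"
  shows "continuous_on S (\<lambda>z. proj (F z) v)"
proof (rule continuous_on_eq)
  have "continuous_on S (\<lambda>z. coord (proj (F z) v) i)" for i
    using continuous_map_compose[OF F continuous_map_proj_lookup[of n v i]] by (simp add: o_def)
  then show "continuous_on S (\<lambda>z. \<Sum>i<N. coord (proj (F z) v) i \<cdot> bvec i)"
    by (intro continuous_intros)
  fix z assume z: "z \<in> S"
  then have "F z \<in> grassmannian n" using F by (auto simp: continuous_map_def)
  then have "proj (F z) v \<in> cfin N" using proj_in[OF _ n] N[OF z] by blast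
  then show "(\<Sum>i<N. coord (proj (F z) v) i \<cdot> bvec i) = proj (F z) v"
    by (rule cfin_expand[symmetric])
qed

lemma continuous_map_cnj_grassmannian:
  assumes "n \<ge> 1"
  shows "continuous_map (grassmannian_topology n) (grassmannian_topology n) (image cinf_cnj)"
proof (rule continuous_map_from_grassmannian)
  show "image cinf_cnj \<in> grassmannian n \<rightarrow> topspace (grassmannian_topology n)"
    using cinf_cnj_grassmannian[OF _ assms] by simp
  fix m
  have "continuous_map (frame_topology n m) (grassmannian_topology n)
      (\<lambda>F. cinf.span ((\<lambda>j. cinf_cnj (F j)) ` {..<n}))"
  proof (rule continuous_map_into_grassmannian)
    fix j i assume "j < n"
    then have "continuous_map (frame_topology n m) euclidean (cnj \<circ> (\<lambda>F. coord (F j) i))"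
      by (intro continuous_map_compose[OF continuous_map_frame_lookup]) (auto intro: continuous_on_cnj continuous_on_id)
    then show "continuous_map (frame_topology n m) euclidean (\<lambda>F. coord (cinf_cnj (F j)) i)"
      by (simp add: o_def)
  qed (auto simp: topspace_frame_topology cfin_iff intro: lindep_cnj)
  then show "continuous_map (frame_topology n m) (grassmannian_topology n)
      (\<lambda>F. cinf_cnj ` cinf.span (F ` {..<n}))"
    by (simp add: cinf_cnj_image_span image_image)
qed

section \<open>Complex-linear operators, extension and compactness in \<open>cfin N\<close>\<close>

definition clin :: "(cinf \<Rightarrow> cinf) \<Rightarrow> bool" where
  "clin T \<longleftrightarrow> (\<forall>v w. T (v + w) = T v + T w) \<and> (\<forall>c v. T (c \<cdot> v) = c \<cdot> T v)"

lemma clin_add: "clin T \<Longrightarrow> T (v + w) = T v + T w"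
  and clin_scl: "clin T \<Longrightarrow> T (c \<cdot> v) = c \<cdot> T v"
  by (auto simp: clin_def)

lemma clin_zero: "clin T \<Longrightarrow> T 0 = 0"
  using clin_scl[of T 0 0] by simp

lemma clin_sum: "clin T \<Longrightarrow> T (sum f S) = (\<Sum>i\<in>S. T (f i))"
  by (induction S rule: infinite_finite_induct) (auto simp: clin_add clin_zero)

lemma lindep_clin:
  assumes T: "clin T" and f: "lindep I f"
    and inj: "\<And>v. v \<in> cinf.span (f ` I) \<Longrightarrow> T v = 0 \<Longrightarrow> v = 0"
  shows "lindep I (\<lambda>i. T (f i))"
proof (rule lindepI)
  fix c i assume "(\<Sum>i\<in>I. c i \<cdot> T (f i)) = 0" and i: "i \<in> I"
  then have "T (\<Sum>i\<in>I. c i \<cdot> f i) = 0" by (simp add: clin_sum[OF T] clin_scl[OF T])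
  then have "(\<Sum>i\<in>I. c i \<cdot> f i) = 0" by (rule inj[OF sum_in_span_family[OF order_refl]])
  then show "c i = 0" using i by (rule lindepD[OF f])
qed

lemma clin_compose: "clin S \<Longrightarrow> clin T \<Longrightarrow> clin (\<lambda>v. S (T v))"
  by (simp add: clin_def)

lemma clin_proj: "W \<in> grassmannian n \<Longrightarrow> n \<ge> 1 \<Longrightarrow> clin (proj W)"
  by (simp add: clin_def proj_add proj_scl)

lemma clin_combination: "clin T \<Longrightarrow> clin (\<lambda>v. \<Sum>i\<in>S. coord (T v) i \<cdot> h i)"
  by (simp add: clin_def lookup_add cinf.scale_left_distrib sum.distrib cinf.scale_sum_right)

text \<open>The part of \<open>v\<close> in coordinates from \<open>N\<close> on is orthogonal to
  \<open>W\<close>, so finitely many basis vectors determine the projection on all of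
  \<open>cinf\<close>.\<close>

lemma proj_expand:
  assumes "W \<in> grassmannian n" "n \<ge> 1" "W \<subseteq> cfin N"
  shows "proj W v = (\<Sum>i<N. coord v i \<cdot> proj W (bvec i))"
proof -
  let ?t = "\<Sum>i<N. coord v i \<cdot> bvec i"
  have look: "coord ?t k = (if k < N then coord v k else 0)" for k
  proof -
    have "coord ?t k = (\<Sum>i<N. if i = k then coord v k else 0)"
      unfolding lookup_sum_cinf by (intro sum.cong) (auto simp: lookup_bvec)
    then show ?thesis by simp
  qed
  have "hip (v - ?t) w = 0" if "w \<in> W" for w
  proof -
    have "w \<in> cfin N" using that assms(3) by blast
    then have "coord (v - ?t) k * cnj (coord w k) = 0" for k
      by (cases "k < N") (auto simp: lookup_minus look cfin_iff)
    then show ?thesis unfolding hip_def by (intro sum.neutral) auto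
  qed
  moreover have "cinf.subspace W" using assms(1) by (simp add: grassmannian_def)
  ultimately have "proj W (v - ?t) = 0"
    by (intro proj_eqI) (auto simp: cinf.subspace_0)
  then have "proj W v = proj W ?t"
    using proj_add[OF assms(1,2), of "v - ?t" ?t] by simp
  then show ?thesis by (simp add: proj_sum[OF assms(1,2)] proj_scl[OF assms(1,2)])
qed

lemma continuous_on_joint_compose:
  assumes f: "continuous_on ((A \<times> B) \<times> UNIV) (\<lambda>z. f (fst (fst z)) (snd (fst z)) (snd z))"
    and "continuous_on S a" "continuous_on S b" "continuous_on S v"
    and "\<And>x. x \<in> S \<Longrightarrow> a x \<in> A" "\<And>x. x \<in> S \<Longrightarrow> b x \<in> B"
  shows "continuous_on S (\<lambda>x. f (a x) (b x) (v x))"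
proof -
  have 1: "continuous_on S (\<lambda>x. ((a x, b x), v x))" using assms(2-4) by (intro continuous_intros)
  have 2: "(\<lambda>x. ((a x, b x), v x)) ` S \<subseteq> (A \<times> B) \<times> UNIV" using assms(5,6) by blast
  show ?thesis using continuous_on_compose2[OF f 1 2] by simp
qed

text \<open>Each coordinate is extended separately; the bound \<open>N\<close> leaves finitely many,
  whose sum is again continuous.\<close>

lemma Dugundji_cinf:
  fixes G :: "'k::{metric_space,second_countable_topology} \<Rightarrow> cinf"
  assumes D: "closedin (top_of_set U) D" and G: "continuous_on D G"
    and N: "\<And>z. z \<in> D \<Longrightarrow> G z \<in> cfin N"
  obtains H where "continuous_on U H" "\<And>z. z \<in> D \<Longrightarrow> H z = G z"
proof -
  have "\<exists>h. continuous_on U h \<and> (\<forall>z\<in>D. h z = coord (G z) c)" for c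
  proof -
    have "continuous_on D (\<lambda>z. coord (G z) c)"
      using G by (rule continuous_on_lookup)
    then obtain h where "continuous_on U h" "h ` U \<subseteq> UNIV"
      "\<And>z. z \<in> D \<Longrightarrow> h z = coord (G z) c"
      by (rule Dugundji[OF convex_UNIV UNIV_not_empty D]) auto
    then show ?thesis by auto
  qed
  then obtain h where h: "\<And>c. continuous_on U (h c)"
    "\<And>c z. z \<in> D \<Longrightarrow> h c z = coord (G z) c" by metis
  show thesis
  proof
    show "continuous_on U (\<lambda>z. \<Sum>c<N. h c z \<cdot> bvec c)"
      using h(1) by (intro continuous_intros)
    show "(\<Sum>c<N. h c z \<cdot> bvec c) = G z" if "z \<in> D" for z
      using cfin_expand[OF N[OF that]] h(2)[OF that] by simp
  qed
qed

lemma compact_unit_sphere_cfin: "compact {v \<in> cfin N. norm v = 1}"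
proof -
  let ?C = "PiE UNIV (\<lambda>_::nat. cball (0::complex) 1)"
  let ?f = "\<lambda>c. \<Sum>i<N. c i \<cdot> bvec i"
  have "compact (?f ` ?C)"
    by (intro compact_continuous_image compact_PiE_UNIV compact_cball)
      (auto intro!: continuous_intros continuous_on_subset[OF continuous_on_product_coordinates])
  moreover have "closed {v :: cinf. norm v = 1}"
    by (intro closed_Collect_eq continuous_intros)
  ultimately have "compact (?f ` ?C \<inter> {v. norm v = 1})" by (rule compact_Int_closed)
  moreover have "?f ` ?C \<inter> {v. norm v = 1} = {v \<in> cfin N. norm v = 1}"
  proof (intro equalityI subsetI)
    fix v assume "v \<in> ?f ` ?C \<inter> {v. norm v = 1}"
    moreover have "?f c \<in> cfin N" for c
      by (intro cinf.subspace_sum cinf.subspace_scale cfin_subspace) (auto simp: cfin_iff lookup_bvec)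
    ultimately show "v \<in> {v \<in> cfin N. norm v = 1}" by auto
  next
    fix v :: cinf assume v: "v \<in> {v \<in> cfin N. norm v = 1}"
    then have "v = ?f (coord v)" by (intro cfin_expand) simp
    moreover have "coord v \<in> ?C" using norm_lookup_le[of v] v by auto
    ultimately show "v \<in> ?f ` ?C \<inter> {v. norm v = 1}" using v by blast
  qed
  ultimately show ?thesis by simp
qed

section \<open>Transport along families of subspaces\<close>

text \<open>The bound \<open>N\<close> is supplied by \<open>compact_image_in_cfin\<close>; with it,
  the projections are controlled by their values on \<open>N\<close> basis vectors.\<close>

locale gr_family =
  fixes K :: "'k::{metric_space,second_countable_topology} set"
    and F :: "'k \<Rightarrow> real \<Rightarrow> cinf set" and n N :: nat
  assumes compact_K: "compact K" and n: "n \<ge> 1"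
    and cont: "continuous_map (top_of_set (K \<times> {-1..1})) (grassmannian_topology n)
                 (\<lambda>z. F (fst z) (snd z))"
    and bound: "\<And>k t. k \<in> K \<Longrightarrow> t \<in> {-1..1} \<Longrightarrow> F k t \<subseteq> cfin N"
begin

lemma F_gr: "k \<in> K \<Longrightarrow> t \<in> {-1..1} \<Longrightarrow> F k t \<in> grassmannian n"
  using cont Pi_mem[of "\<lambda>z. F (fst z) (snd z)" "K \<times> {-1..1}" "\<lambda>_. grassmannian n" "(k, t)"]
  by (simp add: continuous_map_def)

lemma F_subspace: "k \<in> K \<Longrightarrow> t \<in> {-1..1} \<Longrightarrow> cinf.subspace (F k t)"
  using F_gr by (simp add: grassmannian_def)

definition P :: "'k \<Rightarrow> real \<Rightarrow> cinf \<Rightarrow> cinf" where "P k t = proj (F k t)"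

lemma P_in: "k \<in> K \<Longrightarrow> t \<in> {-1..1} \<Longrightarrow> P k t v \<in> F k t"
  unfolding P_def using F_gr n by (rule proj_in)

lemma P_id: "k \<in> K \<Longrightarrow> t \<in> {-1..1} \<Longrightarrow> v \<in> F k t \<Longrightarrow> P k t v = v"
  unfolding P_def using F_subspace by (rule proj_id)

lemma clin_P: "k \<in> K \<Longrightarrow> t \<in> {-1..1} \<Longrightarrow> clin (P k t)"
  unfolding P_def using F_gr n by (rule clin_proj)

lemma P_cnj:
  assumes "k \<in> K" "t \<in> {-1..1}" "F k (-t) = cinf_cnj ` F k t"
  shows "P k (-t) (cinf_cnj v) = cinf_cnj (P k t v)"
  unfolding P_def assms(3) using F_gr[OF assms(1,2)] n by (rule proj_cnj)

lemma P_expand: "k \<in> K \<Longrightarrow> t \<in> {-1..1} \<Longrightarrow>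
    P k t v = (\<Sum>i<N. coord v i \<cdot> P k t (bvec i))"
  unfolding P_def using F_gr n bound by (rule proj_expand)

lemma continuous_on_P_vector: "continuous_on (K \<times> {-1..1}) (\<lambda>z. P (fst z) (snd z) v)"
  unfolding P_def
proof (rule continuous_on_proj[OF cont n])
  fix z assume "z \<in> K \<times> {-1..1::real}"
  then show "F (fst z) (snd z) \<subseteq> cfin N" by (intro bound) auto
qed

lemma continuous_on_P:
  assumes "continuous_on S a" "continuous_on S b" "continuous_on S v"
    and "\<And>x. x \<in> S \<Longrightarrow> a x \<in> K" "\<And>x. x \<in> S \<Longrightarrow> b x \<in> {-1..1}"
  shows "continuous_on S (\<lambda>x. P (a x) (b x) (v x))"
proof (rule continuous_on_eq)
  have "continuous_on S (\<lambda>x. P (a x) (b x) (bvec i))" for i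
  proof -
    have 1: "continuous_on S (\<lambda>x. (a x, b x))" using assms(1,2) by (intro continuous_intros)
    have 2: "(\<lambda>x. (a x, b x)) ` S \<subseteq> K \<times> {-1..1}" using assms(4,5) by blast
    show ?thesis using continuous_on_compose2[OF continuous_on_P_vector 1 2] by simp
  qed
  then show "continuous_on S (\<lambda>x. \<Sum>i<N. coord (v x) i \<cdot> P (a x) (b x) (bvec i))"
    using assms by (intro continuous_intros continuous_on_lookup)
qed (use assms P_expand in auto)

text \<open>Uniform continuity on the \<open>N\<close> basis vectors suffices, because the sum of
  the first \<open>N\<close> coordinate sizes is at most the l1 norm. The number 2/m bounds one of
  \<open>m\<close> equal steps between points of [-1, 1], and the factor 1/2, being less than 1,
  makes a step injective.\<close>

lemma P_uniform:
  obtains m :: nat where "m \<ge> 1"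
    "\<And>k s t v. k \<in> K \<Longrightarrow> s \<in> {-1..1} \<Longrightarrow> t \<in> {-1..1} \<Longrightarrow> \<bar>s - t\<bar> \<le> 2 / m \<Longrightarrow>
       norm (P k s v - P k t v) \<le> norm v / 2"
proof -
  have "\<exists>d>0. \<forall>k\<in>K. \<forall>s\<in>{-1..1}. \<forall>t\<in>{-1..1}. \<bar>s - t\<bar> < d \<longrightarrow>
          norm (P k s (bvec i) - P k t (bvec i)) < 1 / 2" for i
  proof -
    have "uniformly_continuous_on (K \<times> {-1..1}) (\<lambda>z. P (fst z) (snd z) (bvec i))"
      by (intro compact_uniformly_continuous continuous_on_P_vector compact_Times compact_K compact_Icc)
    then obtain d where d: "d > 0" "\<And>z z'. z \<in> K \<times> {-1..1} \<Longrightarrow> z' \<in> K \<times> {-1..1} \<Longrightarrow> dist z' z < d \<Longrightarrow>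
        dist (P (fst z') (snd z') (bvec i)) (P (fst z) (snd z) (bvec i)) < 1 / 2"
      unfolding uniformly_continuous_on_def by (metis half_gt_zero zero_less_one)
    show ?thesis
    proof (intro exI[of _ d] conjI ballI impI d(1))
      fix k s t assume "k \<in> K" "s \<in> {-1..1::real}" "t \<in> {-1..1::real}" "\<bar>s - t\<bar> < d"
      then show "norm (P k s (bvec i) - P k t (bvec i)) < 1 / 2"
        using d(2)[of "(k, t)" "(k, s)"] by (simp add: dist_Pair_Pair dist_norm)
    qed
  qed
  then obtain d where d: "\<And>i. d i > 0" "\<And>i k s t. k \<in> K \<Longrightarrow> s \<in> {-1..1} \<Longrightarrow> t \<in> {-1..1} \<Longrightarrow>
      \<bar>s - t\<bar> < d i \<Longrightarrow> norm (P k s (bvec i) - P k t (bvec i)) < 1 / 2" by metis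
  \<comment> \<open>The element 1 keeps the minimum defined when \<open>N\<close> is 0.\<close>
  define e where "e = Min (insert 1 (d ` {..<N}))"
  have e: "e > 0" using d(1) by (auto simp: e_def)
  obtain m :: nat where m: "2 / e < m" using reals_Archimedean2 by blast
  then have "real m > 0" using e by (smt (verit) divide_pos_pos)
  have "2 / m < e" using m e \<open>real m > 0\<close> by (simp add: field_simps)
  show thesis
  proof
    show "m \<ge> 1" using \<open>real m > 0\<close> by simp
    fix k s t v assume k: "k \<in> K" and st: "s \<in> {-1..1::real}" "t \<in> {-1..1::real}" "\<bar>s - t\<bar> \<le> 2 / m"
    have eq: "P k s v - P k t v = (\<Sum>i<N. coord v i \<cdot> (P k s (bvec i) - P k t (bvec i)))"
      using P_expand[OF k st(1), of v] P_expand[OF k st(2), of v]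
      by (simp add: cinf.scale_right_diff_distrib sum_subtractf)
    have "norm (P k s v - P k t v) \<le>
        (\<Sum>i<N. norm (coord v i \<cdot> (P k s (bvec i) - P k t (bvec i))))"
      unfolding eq by (rule norm_sum)
    also have "\<dots> \<le> (\<Sum>i<N. norm (coord v i) * (1 / 2))"
      unfolding norm_scl
    proof (intro sum_mono mult_left_mono)
      fix i assume "i \<in> {..<N}"
      then have "e \<le> d i" unfolding e_def by (intro Min_le) auto
      then have "\<bar>s - t\<bar> < d i" using st(3) \<open>2 / m < e\<close> by linarith
      then show "norm (P k s (bvec i) - P k t (bvec i)) \<le> 1 / 2"
        using d(2)[OF k st(1,2)] by (simp add: less_imp_le)
    qed auto
    also have "\<dots> = (\<Sum>i<N. norm (coord v i)) / 2"
      by (simp add: sum_divide_distrib)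
    also have "(\<Sum>i<N. norm (coord v i)) \<le> norm v"
    proof -
      have "(\<Sum>i<N. norm (coord v i)) \<le>
          (\<Sum>i\<in>{..<N} \<union> Poly_Mapping.keys v. norm (coord v i))"
        by (intro sum_mono2) auto
      then show ?thesis by (simp add: norm_cinf[of "{..<N} \<union> Poly_Mapping.keys v"])
    qed
    finally show "norm (P k s v - P k t v) \<le> norm v / 2" by simp
  qed
qed

text \<open>Successive projection along \<open>m\<close> equal steps from \<open>s\<close> to \<open>t\<close>. For \<open>m\<close> large it is injective
  on \<open>F k s\<close>, and it is compatible with the symmetry \<open>t \<mapsto> -t\<close>.\<close>

primrec transport :: "nat \<Rightarrow> 'k \<Rightarrow> real \<Rightarrow> real \<Rightarrow> nat \<Rightarrow> cinf \<Rightarrow> cinf" where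
  "transport m k s t 0 v = P k s v"
| "transport m k s t (Suc j) v = P k (s + real (Suc j) / real m * (t - s)) (transport m k s t j v)"

lemma between_mem:
  assumes "s \<in> {-1..1::real}" "t \<in> {-1..1}" "j \<le> m" "m \<ge> 1"
  shows "s + real j / real m * (t - s) \<in> {-1..1}"
proof -
  let ?u = "real j / real m"
  have u: "0 \<le> ?u" "?u \<le> 1" using assms(3,4) by auto
  have "s + u * (t - s) = (1 - u) * s + u * t" for u by (simp add: algebra_simps)
  moreover have "(1 - ?u) *\<^sub>R s + ?u *\<^sub>R t \<in> {-1..1}"
    using convex_real_interval(5)[of "-1" "1::real"] assms(1,2) u by (intro convexD) auto
  ultimately show ?thesis by (simp only: real_scaleR_def)
qed

lemma transport_in:
  assumes "k \<in> K" "s \<in> {-1..1}" "t \<in> {-1..1}" "j \<le> m" "m \<ge> 1"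
  shows "transport m k s t j v \<in> F k (s + real j / real m * (t - s))"
proof (cases j)
  case 0
  then show ?thesis using P_in assms by simp
next
  case (Suc i)
  then show ?thesis using P_in[OF assms(1) between_mem[OF assms(2-5)]] by simp
qed

lemma clin_transport:
  assumes "k \<in> K" "s \<in> {-1..1}" "t \<in> {-1..1}" "m \<ge> 1" "j \<le> m"
  shows "clin (transport m k s t j)"
  using assms(5)
proof (induction j)
  case 0
  have "transport m k s t 0 = P k s" by (simp add: fun_eq_iff)
  then show ?case using clin_P assms by simp
next
  case (Suc j)
  have "transport m k s t (Suc j) =
      (\<lambda>v. P k (s + real (Suc j) / real m * (t - s)) (transport m k s t j v))"
    by (simp add: fun_eq_iff)
  then show ?case
    using clin_compose[OF clin_P[OF assms(1) between_mem[OF assms(2,3) Suc.prems assms(4)]]] Suc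
    by simp
qed

text \<open>The vector reached after \<open>j\<close> steps is fixed by the projection at its own
  parameter, so the next projection moves it by at most half its norm and cannot kill it.\<close>

lemma transport_nonzero:
  assumes k: "k \<in> K" and st: "s \<in> {-1..1}" "t \<in> {-1..1}" and m: "m \<ge> 1" and j: "j \<le> m"
    and unif: "\<And>k s t v. k \<in> K \<Longrightarrow> s \<in> {-1..1} \<Longrightarrow> t \<in> {-1..1} \<Longrightarrow> \<bar>s - t\<bar> \<le> 2 / m \<Longrightarrow>
       norm (P k s v - P k t v) \<le> norm v / 2"
    and v: "v \<in> F k s" "v \<noteq> 0"
  shows "transport m k s t j v \<noteq> 0"
  using j
proof (induction j)
  case 0
  then show ?case using P_id k st v by simp
next
  case (Suc j)
  let ?w = "transport m k s t j v"
  let ?a = "s + real j / real m * (t - s)" and ?b = "s + real (Suc j) / real m * (t - s)"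
  have mem: "?a \<in> {-1..1}" "?b \<in> {-1..1}"
    using between_mem[OF st _ m, of j] between_mem[OF st Suc.prems m] Suc.prems by auto
  have "?w \<in> F k ?a" using Suc.prems by (intro transport_in k st m) simp
  then have w: "P k ?a ?w = ?w" using P_id k mem by blast
  have "?b - ?a = (t - s) / m"
    by (simp add: algebra_simps add_divide_distrib diff_divide_distrib)
  then have "\<bar>?b - ?a\<bar> \<le> 2 / m" using st by (auto simp: abs_divide intro!: divide_right_mono)
  then have "norm (P k ?b ?w - P k ?a ?w) \<le> norm ?w / 2" using unif k mem by blast
  moreover have "norm ?w > 0" using Suc by simp
  ultimately have "P k ?b ?w \<noteq> 0" using w by auto
  then show ?case by simp
qed

lemma transport_same:
  assumes "k \<in> K" "s \<in> {-1..1}" "v \<in> F k s"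
  shows "transport m k s s j v = v"
proof -
  have "P k s v = v" using assms by (rule P_id)
  then show ?thesis by (induction j) simp_all
qed

lemma transport_cnj:
  assumes "\<And>t. t \<in> {-1..1} \<Longrightarrow> F k (-t) = cinf_cnj ` F k t"
    and "k \<in> K" "s \<in> {-1..1}" "t \<in> {-1..1}" "m \<ge> 1" "j \<le> m"
  shows "transport m k (-s) (-t) j (cinf_cnj v) = cinf_cnj (transport m k s t j v)"
  using assms(6)
proof (induction j)
  case 0
  then show ?case using P_cnj assms by simp
next
  case (Suc j)
  have mem: "s + real (Suc j) / real m * (t - s) \<in> {-1..1}"
    using between_mem[OF assms(3,4) Suc.prems assms(5)] .
  have "- s + c * (- t - - s) = - (s + c * (t - s))" for c
    by (simp add: algebra_simps)
  then show ?case
    using Suc P_cnj[OF assms(2) mem assms(1)[OF mem]] by simp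
qed

lemma continuous_on_transport:
  assumes "continuous_on S a" "continuous_on S b" "continuous_on S c" "continuous_on S v"
    and "\<And>x. x \<in> S \<Longrightarrow> a x \<in> K" "\<And>x. x \<in> S \<Longrightarrow> b x \<in> {-1..1}" "\<And>x. x \<in> S \<Longrightarrow> c x \<in> {-1..1}"
    and "m \<ge> 1" "j \<le> m"
  shows "continuous_on S (\<lambda>x. transport m (a x) (b x) (c x) j (v x))"
  using assms(9)
proof (induction j)
  case 0
  then show ?case using assms by (auto intro!: continuous_on_P)
next
  case (Suc j)
  have "s + real (Suc j) / real m * (t - s) \<in> {-1..1}" if "s \<in> {-1..1}" "t \<in> {-1..1}" for s t
    using between_mem[OF that Suc.prems assms(8)] .
  then show ?case
    unfolding transport.simps using assms Suc
    by (intro continuous_on_P continuous_intros) auto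
qed

end

context gr_family
begin

text \<open>Isomorphisms \<open>F k 0 \<rightarrow> F k t\<close> prescribed over \<open>L\<close> extend to \<open>K\<close>. An extension by Dugundji's
  theorem is injective for all \<open>t\<close> except when \<open>k\<close> lies in a compact set \<open>Bad\<close> disjoint from \<open>L\<close>.
  It is used for \<open>\<bar>t\<bar> \<le> \<tau> k\<close> only, where \<open>\<tau>\<close> is \<open>1\<close> on \<open>L\<close> and \<open>0\<close> on \<open>Bad\<close>, and continued by
  transport. The flag \<open>fx\<close> stands for invariance of all data under the involution.\<close>

lemma lift_operators:
  fixes Y :: "'k \<Rightarrow> real \<Rightarrow> cinf \<Rightarrow> cinf" and fx :: bool
  assumes L: "closed L" "L \<subseteq> K"
    and Yc: "continuous_on ((L \<times> {-1..1}) \<times> UNIV) (\<lambda>z. Y (fst (fst z)) (snd (fst z)) (snd z))"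
    and Ylin: "\<And>l t. l \<in> L \<Longrightarrow> t \<in> {-1..1} \<Longrightarrow> clin (Y l t)"
    and Yin: "\<And>l t v. l \<in> L \<Longrightarrow> t \<in> {-1..1} \<Longrightarrow> v \<in> F l 0 \<Longrightarrow> Y l t v \<in> F l t"
    and Ynz: "\<And>l t v. l \<in> L \<Longrightarrow> t \<in> {-1..1} \<Longrightarrow> v \<in> F l 0 \<Longrightarrow> v \<noteq> 0 \<Longrightarrow> Y l t v \<noteq> 0"
    and Y0: "\<And>l v. l \<in> L \<Longrightarrow> v \<in> F l 0 \<Longrightarrow> Y l 0 v = v"
    and Ffx: "\<And>k t. fx \<Longrightarrow> k \<in> K \<Longrightarrow> t \<in> {-1..1} \<Longrightarrow> F k (-t) = cinf_cnj ` F k t"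
    and Yfx: "\<And>l t v. fx \<Longrightarrow> l \<in> L \<Longrightarrow> t \<in> {-1..1} \<Longrightarrow> v \<in> F l 0 \<Longrightarrow>
                Y l (-t) (cinf_cnj v) = cinf_cnj (Y l t v)"
  obtains X where
    "continuous_on ((K \<times> {-1..1}) \<times> UNIV) (\<lambda>z. X (fst (fst z)) (snd (fst z)) (snd z))"
    "\<And>k t. k \<in> K \<Longrightarrow> t \<in> {-1..1} \<Longrightarrow> clin (X k t)"
    "\<And>k t v. k \<in> K \<Longrightarrow> t \<in> {-1..1} \<Longrightarrow> X k t v \<in> F k t"
    "\<And>k t v. k \<in> K \<Longrightarrow> t \<in> {-1..1} \<Longrightarrow> v \<in> F k 0 \<Longrightarrow> v \<noteq> 0 \<Longrightarrow> X k t v \<noteq> 0"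
    "\<And>l t v. l \<in> L \<Longrightarrow> t \<in> {-1..1} \<Longrightarrow> v \<in> F l 0 \<Longrightarrow> X l t v = Y l t v"
    "\<And>k t v. fx \<Longrightarrow> k \<in> K \<Longrightarrow> t \<in> {-1..1} \<Longrightarrow> X k (-t) (cinf_cnj v) = cinf_cnj (X k t v)"
proof -
  let ?I = "{-1..1::real}"
  have zero_I: "0 \<in> ?I" by simp
  have neg_I: "-t \<in> ?I" if "t \<in> ?I" for t using that by auto
  \<comment> \<open>The data to be extended are the given family over \<open>L\<close> and the
    identity at \<open>t = 0\<close> over all of \<open>K\<close>. In \<open>G\<close> both are
    preceded by the projection onto \<open>F k 0\<close>, which makes them defined on the basis
    vectors.\<close>
  define D where "D = L \<times> ?I \<union> K \<times> {0}"
  define G where "G i z = (if snd z = 0 then P (fst z) 0 (bvec i)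
      else Y (fst z) (snd z) (P (fst z) 0 (bvec i)))" for i and z :: "'k \<times> real"
  have closed_D: "closed (L \<times> ?I)" "closed (K \<times> {0::real})"
    using L(1) compact_imp_closed[OF compact_K] by (auto intro: closed_Times)
  have D_sub: "D \<subseteq> K \<times> ?I" using L(2) by (auto simp: D_def)
  have D: "closedin (top_of_set (K \<times> ?I)) D"
    unfolding D_def using closed_D D_sub by (intro closed_subset closed_Un) (auto simp: D_def)
  have G_L: "G i (l, t) = Y l t (P l 0 (bvec i))" if "l \<in> L" for l t i
    using Y0[OF that P_in] that L(2) by (auto simp: G_def)
  have "continuous_on (L \<times> ?I) (\<lambda>z. Y (fst z) (snd z) (P (fst z) 0 (bvec i)))" for i
    using L(2) by (intro continuous_on_joint_compose[OF Yc] continuous_on_P continuous_intros) auto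
  then have "continuous_on (L \<times> ?I) (G i)" for i
    by (rule continuous_on_eq) (auto simp: G_L)
  moreover have "continuous_on (K \<times> {0}) (\<lambda>z. P (fst z) 0 (bvec i))" for i
    by (intro continuous_on_P continuous_intros) auto
  then have "continuous_on (K \<times> {0}) (G i)" for i
    by (rule continuous_on_eq) (auto simp: G_def)
  ultimately have Gc: "continuous_on D (G i)" for i
    unfolding D_def using closed_D by (intro continuous_on_closed_Un)
  have "G i z \<in> cfin N" if "z \<in> D" for i z
  proof -
    obtain k t where z: "z = (k, t)" by (cases z)
    show ?thesis
    proof (cases "t = 0")
      case True
      then have "k \<in> K" using that D_sub z by auto
      then show ?thesis using P_in[of k 0 "bvec i"] bound[of k 0] True by (auto simp: G_def z)
    next
      case False
      then have k: "k \<in> L" "t \<in> ?I" using that by (auto simp: D_def z)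
      then have "k \<in> K" using L(2) by auto
      then have "Y k t (P k 0 (bvec i)) \<in> F k t" using k Yin P_in by simp
      then show ?thesis using G_L[OF k(1)] bound[OF \<open>k \<in> K\<close> k(2)] by (auto simp: z)
    qed
  qed
  then have "\<exists>H. continuous_on (K \<times> ?I) H \<and> (\<forall>z\<in>D. H z = G i z)" for i
    by (rule Dugundji_cinf[OF D Gc]) blast+
  then obtain H0 where H0: "\<And>i. continuous_on (K \<times> ?I) (H0 i)" "\<And>i z. z \<in> D \<Longrightarrow> H0 i z = G i z"
    by metis
  \<comment> \<open>Averaging over the involution makes the extension equivariant. On
    \<open>D\<close> it changes nothing, because the data there are equivariant already.\<close>
  define H where "H i z = (if fx then (1/2) \<cdot> (H0 i z + cinf_cnj (H0 i (fst z, - snd z))) else H0 i z)"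
    for i z
  have Hc: "continuous_on (K \<times> ?I) (H i)" for i
  proof (cases fx)
    case True
    have "continuous_on (K \<times> ?I) (\<lambda>z. H0 i (fst z, - snd z))"
      by (rule continuous_on_compose2[OF H0(1)]) (auto intro!: continuous_intros)
    then have "continuous_on (K \<times> ?I) (\<lambda>z. (1/2) \<cdot> (H0 i z + cinf_cnj (H0 i (fst z, - snd z))))"
      by (intro continuous_on_scl continuous_on_const continuous_on_add H0(1) continuous_on_cinf_cnj)
    moreover have "H i = (\<lambda>z. (1/2) \<cdot> (H0 i z + cinf_cnj (H0 i (fst z, - snd z))))"
      using True by (simp add: H_def fun_eq_iff)
    ultimately show ?thesis by simp
  next
    case False
    then have "H i = H0 i" by (simp add: H_def fun_eq_iff)
    then show ?thesis using H0(1) by simp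
  qed
  have P0_cnj: "P k 0 (cinf_cnj v) = cinf_cnj (P k 0 v)" if "fx" "k \<in> K" for k v
    using P_cnj[OF that(2) zero_I, of v] Ffx[OF that zero_I] by simp
  have bvec_cnj: "cinf_cnj (bvec i) = bvec i" for i
    by (rule poly_mapping_eqI) (simp add: lookup_bvec)
  have H_D: "H i z = G i z" if z: "z \<in> D" for i z
  proof (cases fx)
    case True
    obtain k t where kt: "z = (k, t)" by (cases z)
    have k: "k \<in> K" using z kt D_sub by auto
    have "(k, -t) \<in> D" using z by (auto simp: kt D_def)
    then have eq: "H0 i (fst z, - snd z) = G i (k, -t)" using H0(2) by (simp add: kt)
    have PP: "cinf_cnj (P k 0 (bvec i)) = P k 0 (bvec i)"
      using P0_cnj[OF True k, of "bvec i"] by (simp add: bvec_cnj)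
    have "cinf_cnj (G i (k, -t)) = G i (k, t)"
    proof (cases "t = 0")
      case False
      then have l: "k \<in> L" "t \<in> ?I" using z by (auto simp: kt D_def)
      have "Y k t (cinf_cnj (P k 0 (bvec i))) = cinf_cnj (Y k (-t) (P k 0 (bvec i)))"
        using Yfx[OF True l(1) neg_I[OF l(2)] P_in[OF k zero_I]] by simp
      then show ?thesis by (simp add: G_L[OF l(1)] PP)
    qed (simp add: G_def PP)
    then have "H i z = (1/2) \<cdot> (G i z + G i z)"
      using True H0(2)[OF z] eq by (simp add: H_def kt)
    also have "\<dots> = G i z" by (rule poly_mapping_eqI) (simp only: lookup_cinf_scale lookup_add, simp)
    finally show ?thesis .
  next
    case False
    then show ?thesis using H0(2)[OF z] by (simp add: H_def)
  qed
  \<comment> \<open>The extended vectors may leave the family; the outer projection brings them back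
    into \<open>F k t\<close> and does not move them over \<open>D\<close>.\<close>
  define Xt where "Xt k t v = P k t (\<Sum>i<N. coord (P k 0 v) i \<cdot> H i (k, t))" for k t v
  have Xt_lin: "clin (Xt k t)" if "k \<in> K" "t \<in> ?I" for k t
  proof -
    have "clin (\<lambda>v. \<Sum>i<N. coord (P k 0 v) i \<cdot> H i (k, t))"
      by (intro clin_combination clin_P that zero_I)
    then show ?thesis
      unfolding Xt_def using clin_P[OF that] by (rule_tac clin_compose)
  qed
  have Xt_in: "Xt k t v \<in> F k t" if "k \<in> K" "t \<in> ?I" for k t v
    unfolding Xt_def using that by (rule P_in)
  have Xt_L: "Xt l t v = Y l t v" if l: "l \<in> L" and t: "t \<in> ?I" and v: "v \<in> F l 0" for l t v
  proof -
    have k: "l \<in> K" using l L(2) by auto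
    have "(l, t) \<in> D" using l t by (simp add: D_def)
    then have "(\<Sum>i<N. coord (P l 0 v) i \<cdot> H i (l, t)) =
        (\<Sum>i<N. coord v i \<cdot> Y l t (P l 0 (bvec i)))"
      using P_id[OF k zero_I v] by (simp add: H_D G_L[OF l])
    also have "\<dots> = Y l t (\<Sum>i<N. coord v i \<cdot> P l 0 (bvec i))"
      by (simp add: clin_sum[OF Ylin[OF l t]] clin_scl[OF Ylin[OF l t]])
    also have "\<dots> = Y l t v" using P_expand[OF k zero_I, of v] P_id[OF k zero_I v] by simp
    finally show ?thesis unfolding Xt_def using P_id[OF k t Yin[OF l t v]] by simp
  qed
  have Xt_0: "Xt k 0 v = v" if k: "k \<in> K" and v: "v \<in> F k 0" for k v
  proof -
    have "(k, 0) \<in> D" using k by (simp add: D_def)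
    then have "(\<Sum>i<N. coord (P k 0 v) i \<cdot> H i (k, 0)) =
        (\<Sum>i<N. coord v i \<cdot> P k 0 (bvec i))"
      using P_id[OF k zero_I v] by (simp add: H_D G_def)
    also have "\<dots> = v" using P_expand[OF k zero_I, of v] P_id[OF k zero_I v] by simp
    finally show ?thesis unfolding Xt_def using P_id[OF k zero_I v] by simp
  qed
  have Xt_cnj: "Xt k (-t) (cinf_cnj v) = cinf_cnj (Xt k t v)" if fx: fx and k: "k \<in> K" and t: "t \<in> ?I" for k t v
  proof -
    have "H i (k, -t) = cinf_cnj (H i (k, t))" for i
      using fx by (simp add: H_def cinf_cnj_scl cinf_cnj_add add.commute)
    then have "(\<Sum>i<N. coord (P k 0 (cinf_cnj v)) i \<cdot> H i (k, -t)) =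
        cinf_cnj (\<Sum>i<N. coord (P k 0 v) i \<cdot> H i (k, t))"
      by (simp add: P0_cnj[OF fx k] cinf_cnj_sum cinf_cnj_scl)
    then show ?thesis unfolding Xt_def using P_cnj[OF k t Ffx[OF fx k t]] by simp
  qed
  have Xt_c: "continuous_on S (\<lambda>x. Xt (a x) (b x) (v x))"
    if "continuous_on S a" "continuous_on S b" "continuous_on S v"
      "\<And>x. x \<in> S \<Longrightarrow> a x \<in> K" "\<And>x. x \<in> S \<Longrightarrow> b x \<in> ?I"
    for S :: "(('k \<times> real) \<times> cinf) set" and a b v
  proof -
    have 1: "continuous_on S (\<lambda>x. (a x, b x))" using that(1,2) by (intro continuous_intros)
    have 2: "(\<lambda>x. (a x, b x)) ` S \<subseteq> K \<times> ?I" using that(4,5) by blast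
    have "continuous_on S (\<lambda>x. H i (a x, b x))" for i
      using continuous_on_compose2[OF Hc 1 2] .
    moreover have "continuous_on S (\<lambda>x. P (a x) 0 (v x))"
      using that by (intro continuous_on_P continuous_intros) auto
    ultimately have "continuous_on S (\<lambda>x. \<Sum>i<N. coord (P (a x) 0 (v x)) i \<cdot> H i (a x, b x))"
      by (intro continuous_on_sum continuous_on_scl continuous_on_lookup)
    then show ?thesis unfolding Xt_def using that by (intro continuous_on_P)
  qed
  \<comment> \<open>By homogeneity degeneracy is visible on unit vectors, and
    \<open>P k 0 v = v\<close> expresses \<open>v \<in> F k 0\<close> by a closed equation. Hence
    \<open>B\<close> is compact, and so is its image \<open>Bad\<close> in \<open>K\<close>.\<close>
  define C where "C = (K \<times> ?I) \<times> {v \<in> cfin N. norm v = 1}"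
  define B where "B = {z \<in> C. (P (fst (fst z)) 0 (snd z) - snd z,
      Xt (fst (fst z)) (snd (fst z)) (snd z)) = (0, 0)}"
  have "compact C"
    unfolding C_def by (intro compact_Times compact_K compact_Icc compact_unit_sphere_cfin)
  moreover have "closedin (top_of_set C) B"
    unfolding B_def
    by (intro continuous_closedin_preimage_constant continuous_on_Pair continuous_on_diff
        continuous_on_P Xt_c continuous_intros) (auto simp: C_def)
  ultimately have "compact B" by (rule closedin_compact)
  define Bad where "Bad = (\<lambda>z. fst (fst z)) ` B"
  have compact_Bad: "compact Bad"
    unfolding Bad_def by (intro compact_continuous_image \<open>compact B\<close> continuous_intros)
  have Bad_sub: "Bad \<subseteq> K" by (auto simp: Bad_def B_def C_def)
  have badI: "k \<in> Bad" if k: "k \<in> K" and t: "t \<in> ?I" and v: "v \<in> F k 0" "v \<noteq> 0" "Xt k t v = 0" for k t v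
  proof -
    define w where "w = complex_of_real (1 / norm v) \<cdot> v"
    have w: "w \<in> F k 0" unfolding w_def using F_subspace[OF k zero_I] v(1) by (rule cinf.subspace_scale)
    have "norm w = 1" using v(2) by (simp add: w_def norm_scl norm_divide)
    moreover have "w \<in> cfin N" using w bound[OF k zero_I] by blast
    moreover have "P k 0 w = w" using P_id[OF k zero_I w] .
    moreover have "Xt k t w = 0"
      using clin_scl[OF Xt_lin[OF k t]] v(3) by (simp add: w_def)
    ultimately have "((k, t), w) \<in> B" using k t by (simp add: B_def C_def)
    then show ?thesis unfolding Bad_def by force
  qed
  have "L \<inter> Bad = {}"
  proof -
    have False if "((l, t), v) \<in> B" "l \<in> L" for l t v
    proof -
      have "v = P l 0 v" "l \<in> K" "t \<in> ?I" "norm v = 1" "Xt l t v = 0"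
        using that(1) by (auto simp: B_def C_def)
      moreover then have "v \<in> F l 0" using P_in[of l 0 v] by simp
      ultimately have "Y l t v = 0" "v \<noteq> 0" "v \<in> F l 0" using Xt_L[OF that(2)] by auto
      then show False using Ynz[OF that(2) \<open>t \<in> ?I\<close>] by blast
    qed
    then show ?thesis by (force simp: Bad_def)
  qed
  then have "disjnt Bad L" by (auto simp: disjnt_def)
  moreover have "normal_space (top_of_set K)"
    using compact_K by (intro compact_Hausdorff_or_regular_imp_normal_space)
      (auto simp: compact_space_subtopology Hausdorff_space_subtopology)
  moreover have "closedin (top_of_set K) Bad" "closedin (top_of_set K) L"
    using compact_imp_closed[OF compact_Bad] Bad_sub L by (auto intro: closed_subset)
  ultimately obtain \<tau> where \<tau>: "continuous_map (top_of_set K) (top_of_set {0..1::real}) \<tau>"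
    "\<tau> ` Bad \<subseteq> {0}" "\<tau> ` L \<subseteq> {1}"
    by (rule_tac Urysohn_lemma[of "top_of_set K" Bad L 0 1]) auto
  have \<tau>c: "continuous_on K \<tau>" and \<tau>_mem: "\<And>k. k \<in> K \<Longrightarrow> 0 \<le> \<tau> k \<and> \<tau> k \<le> 1"
    using \<tau>(1) by (auto simp: continuous_map_in_subtopology)
  \<comment> \<open>Truncation of \<open>t\<close> to the interval from \<open>- \<tau> k\<close> to
    \<open>\<tau> k\<close>; being odd in \<open>t\<close>, it respects the symmetry.\<close>
  define cl where "cl k t = max (- \<tau> k) (min (\<tau> k) t)" for k t
  have cl_I: "cl k t \<in> ?I" if "k \<in> K" "t \<in> ?I" for k t
    using \<tau>_mem[OF that(1)] that(2) by (auto simp: cl_def)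
  have cl_L: "cl l t = t" if "l \<in> L" "t \<in> ?I" for l t
  proof -
    have "\<tau> l = 1" using \<tau>(3) that(1) by auto
    then show ?thesis using that(2) by (auto simp: cl_def)
  qed
  have cl_neg: "cl k (-t) = - cl k t" if "k \<in> K" for k t
    using \<tau>_mem[OF that] by (auto simp: cl_def max_def min_def)
  have Xt_cl: "Xt k (cl k t) v \<noteq> 0" if "k \<in> K" "t \<in> ?I" "v \<in> F k 0" "v \<noteq> 0" for k t v
  proof (cases "k \<in> Bad")
    case True
    then have "\<tau> k = 0" using \<tau>(2) by auto
    then have "cl k t = 0" by (simp add: cl_def)
    then show ?thesis using Xt_0 that by simp
  next
    case False
    then show ?thesis using badI[OF that(1) cl_I] that by blast
  qed
  obtain m :: nat where m: "m \<ge> 1" and unif: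
    "\<And>k s t v. k \<in> K \<Longrightarrow> s \<in> ?I \<Longrightarrow> t \<in> ?I \<Longrightarrow> \<bar>s - t\<bar> \<le> 2 / m \<Longrightarrow>
       norm (P k s v - P k t v) \<le> norm v / 2"
    using P_uniform by blast
  define X where "X k t v = transport m k (cl k t) t m (Xt k (cl k t) v)" for k t v
  have final: "s + real m / real m * (t - s) = t" for s t using m by simp
  show thesis
  proof
    have clc: "continuous_on ((K \<times> ?I) \<times> UNIV) (\<lambda>z :: ('k \<times> real) \<times> cinf. cl (fst (fst z)) (snd (fst z)))"
    proof -
      have "continuous_on ((K \<times> ?I) \<times> UNIV) (\<lambda>z :: ('k \<times> real) \<times> cinf. \<tau> (fst (fst z)))"
        by (rule continuous_on_compose2[OF \<tau>c]) (auto intro!: continuous_intros)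
      then show ?thesis unfolding cl_def by (intro continuous_intros) auto
    qed
    show "continuous_on ((K \<times> ?I) \<times> UNIV) (\<lambda>z. X (fst (fst z)) (snd (fst z)) (snd z))"
      unfolding X_def
    proof (rule continuous_on_transport)
      show "continuous_on ((K \<times> ?I) \<times> UNIV)
          (\<lambda>z. Xt (fst (fst z)) (cl (fst (fst z)) (snd (fst z))) (snd z))"
        using cl_I by (intro Xt_c clc continuous_intros) (auto simp: mem_Times_iff)
    qed (use clc cl_I m in \<open>auto intro!: continuous_intros simp: mem_Times_iff\<close>)
    show "clin (X k t)" if kt: "k \<in> K" "t \<in> ?I" for k t
      unfolding X_def using clin_transport[OF kt(1) cl_I[OF kt] kt(2) m order_refl] Xt_lin[OF kt(1) cl_I[OF kt]]
      by (rule clin_compose)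
    show "X k t v \<in> F k t" if kt: "k \<in> K" "t \<in> ?I" for k t v
      using transport_in[OF kt(1) cl_I[OF kt] kt(2) order_refl m] unfolding X_def final .
    show "X k t v \<noteq> 0" if kt: "k \<in> K" "t \<in> ?I" and v: "v \<in> F k 0" "v \<noteq> 0" for k t v
      unfolding X_def
      by (intro transport_nonzero[OF kt(1) cl_I[OF kt] kt(2) m order_refl unif] Xt_in kt(1) cl_I[OF kt] Xt_cl kt v)
    show "X l t v = Y l t v" if l: "l \<in> L" "t \<in> ?I" "v \<in> F l 0" for l t v
    proof -
      have k: "l \<in> K" using l L(2) by auto
      have "X l t v = Xt l t v"
        unfolding X_def cl_L[OF l(1,2)] using Xt_in[OF k l(2)] by (rule transport_same[OF k l(2)])
      then show ?thesis using Xt_L[OF l] by simp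
    qed
    show "X k (-t) (cinf_cnj v) = cinf_cnj (X k t v)" if fx and kt: "k \<in> K" "t \<in> ?I" for k t v
      unfolding X_def cl_neg[OF kt(1)] Xt_cnj[OF that(1) kt(1) cl_I[OF kt]]
      by (rule transport_cnj[OF Ffx[OF that(1) kt(1)] kt(1) cl_I[OF kt] kt(2) m order_refl])
  qed
qed

text \<open>In \<open>frame_lift\<close> the fibre at -1 is the constant space
  \<open>cfin n\<close>, so this carries its standard frame to a continuous family of frames of the
  central fibres.\<close>

lemma transport_to_center:
  obtains Z where
    "continuous_on (K \<times> UNIV) (\<lambda>z. Z (fst z) (snd z))"
    "\<And>k. k \<in> K \<Longrightarrow> clin (Z k)"
    "\<And>k v. k \<in> K \<Longrightarrow> Z k v \<in> F k 0"
    "\<And>k v. k \<in> K \<Longrightarrow> v \<in> F k (-1) \<Longrightarrow> v \<noteq> 0 \<Longrightarrow> Z k v \<noteq> 0"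
proof -
  obtain m :: nat where m: "m \<ge> 1" and unif:
    "\<And>k s t v. k \<in> K \<Longrightarrow> s \<in> {-1..1} \<Longrightarrow> t \<in> {-1..1} \<Longrightarrow> \<bar>s - t\<bar> \<le> 2 / m \<Longrightarrow>
       norm (P k s v - P k t v) \<le> norm v / 2"
    using P_uniform by blast
  have mem: "-1 \<in> {-1..1::real}" "0 \<in> {-1..1::real}" by auto
  show thesis
  proof
    show "continuous_on (K \<times> UNIV) (\<lambda>z. transport m (fst z) (-1) 0 m (snd z))"
      using m by (intro continuous_on_transport continuous_intros) auto
    show "clin (transport m k (-1) 0 m)" if "k \<in> K" for k
      using that mem m by (intro clin_transport) auto
    show "transport m k (-1) 0 m v \<in> F k 0" if "k \<in> K" for k v
      using transport_in[OF that mem order_refl m] m by simp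
    show "transport m k (-1) 0 m v \<noteq> 0" if "k \<in> K" "v \<in> F k (-1)" "v \<noteq> 0" for k v
      by (rule transport_nonzero[OF that(1) mem m order_refl unif that(2,3)])
  qed
qed

end

section \<open>Frames and matrices\<close>

definition idx :: "'n::finite \<Rightarrow> nat" where
  "idx = (SOME f. bij_betw f UNIV {..<CARD('n)})"

lemma bij_betw_idx: "bij_betw (idx :: 'n::finite \<Rightarrow> nat) UNIV {..<CARD('n)}"
proof -
  obtain f where "bij_betw f (UNIV :: 'n set) {0..<CARD('n)}"
    using ex_bij_betw_finite_nat[of "UNIV :: 'n set"] by auto
  then have "\<exists>f. bij_betw f (UNIV :: 'n set) {..<CARD('n)}" by (auto simp: atLeast0LessThan)
  then show ?thesis unfolding idx_def by (rule someI_ex)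
qed

lemma idx_less: "idx (j :: 'n::finite) < CARD('n)"
  using bij_betw_idx[where 'n = 'n] by (auto simp: bij_betw_def)

lemma idx_eq_iff [simp]: "idx i = idx j \<longleftrightarrow> i = j"
  using bij_betw_idx[where 'n = 'a] by (auto simp: bij_betw_def inj_on_def)

definition unidx :: "nat \<Rightarrow> 'n::finite" where "unidx = inv_into UNIV idx"

lemma unidx_idx [simp]: "unidx (idx j) = j"
  by (simp add: unidx_def inv_into_f_f inj_on_def)

lemma bij_betw_unidx: "bij_betw (unidx :: nat \<Rightarrow> 'n::finite) {..<CARD('n)} UNIV"
  unfolding unidx_def using bij_betw_inv_into[OF bij_betw_idx] .

lemma image_unidx: "(\<lambda>k. f (unidx k :: 'n::finite)) ` {..<CARD('n)} = range f"
  using bij_betw_imp_surj_on[OF bij_betw_unidx] by (metis image_image)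

lemma idx_surj: "k < CARD('n) \<Longrightarrow> \<exists>j :: 'n::finite. k = idx j"
  using bij_betw_idx[where 'n = 'n] by (auto simp: bij_betw_def)

text \<open>The standard frame of the coordinate block that starts at \<open>c\<close>; different
  summands of a frame are placed in disjoint blocks.\<close>

definition bv :: "nat \<Rightarrow> 'n::finite \<Rightarrow> cinf" where
  "bv c j = bvec (c + idx j)"

lemma bv_cfin: "c + CARD('n) \<le> N \<Longrightarrow> bv c (j :: 'n::finite) \<in> cfin N"
  using idx_less[of j] by (auto simp: cfin_iff bv_def lookup_bvec)

lemma cinf_cnj_bv: "cinf_cnj (bv c j) = bv c j"
  by (rule poly_mapping_eqI) (simp add: bv_def lookup_bvec)

text \<open>A frame is regarded as a row of vectors, on which matrices act from the right.\<close>

definition mulm :: "('n::finite \<Rightarrow> cinf) \<Rightarrow> complex ^ 'n ^ 'n \<Rightarrow> 'n \<Rightarrow> cinf" where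
  "mulm h A j = (\<Sum>i\<in>UNIV. (A $ i $ j) \<cdot> h i)"

definition mcnj :: "complex ^ 'n ^ 'n \<Rightarrow> complex ^ 'n ^ 'n" where
  "mcnj A = (\<chi> i j. cnj (A $ i $ j))"

lemma mcnj_nth [simp]: "mcnj A $ i $ j = cnj (A $ i $ j)"
  by (simp add: mcnj_def)

lemma mcnj_mcnj [simp]: "mcnj (mcnj A) = A"
  by (simp add: vec_eq_iff)

lemma mcnj_mult: "mcnj (A ** B) = mcnj A ** mcnj (B :: complex ^ 'n ^ 'n)"
  by (simp add: vec_eq_iff matrix_matrix_mult_def)

lemma mcnj_one [simp]: "mcnj (mat 1) = mat 1"
  by (simp add: vec_eq_iff mat_def)

lemma lookup_mulm: "coord (mulm h A j) k = (\<Sum>i\<in>UNIV. A $ i $ j * coord (h i) k)"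
  by (simp add: mulm_def lookup_sum_cinf)

lemma mulm_mulm: "mulm (mulm h A) B = mulm h (A ** B)"
proof
  fix j
  have "mulm (mulm h A) B j = (\<Sum>i\<in>UNIV. \<Sum>k\<in>UNIV. (B $ i $ j * A $ k $ i) \<cdot> h k)"
    by (simp add: mulm_def cinf.scale_sum_right)
  also have "\<dots> = (\<Sum>k\<in>UNIV. \<Sum>i\<in>UNIV. (B $ i $ j * A $ k $ i) \<cdot> h k)"
    by (rule sum.swap)
  also have "\<dots> = mulm h (A ** B) j"
    by (simp add: mulm_def matrix_matrix_mult_def cinf.scale_sum_left mult.commute)
  finally show "mulm (mulm h A) B j = mulm h (A ** B) j" .
qed

lemma mulm_one: "mulm h (mat 1) = h"
proof
  fix j
  have "mulm h (mat 1) j = (\<Sum>i\<in>UNIV. if i = j then h i else 0)"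
    unfolding mulm_def by (rule sum.cong) (auto simp: mat_def)
  then show "mulm h (mat 1) j = h j" by simp
qed

lemma mulm_add: "mulm (\<lambda>j. f j + g j) A j = mulm f A j + mulm g A j"
  by (simp add: mulm_def cinf.scale_right_distrib sum.distrib)

lemma mulm_scl: "mulm (\<lambda>j. c \<cdot> f j) A j = c \<cdot> mulm f A j"
  by (simp add: mulm_def cinf.scale_sum_right mult.commute)

lemma mulm_mat_diff: "mulm h (A - B) j = mulm h A j - mulm h B j"
  by (simp add: mulm_def cinf.scale_left_diff_distrib sum_subtractf)

lemma cinf_cnj_mulm: "cinf_cnj (mulm h A j) = mulm (\<lambda>i. cinf_cnj (h i)) (mcnj A) j"
  by (simp add: mulm_def cinf_cnj_sum cinf_cnj_scl)

lemma mulm_cfin: "(\<And>i. h i \<in> cfin N) \<Longrightarrow> mulm h A j \<in> cfin N"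
  unfolding mulm_def by (intro cinf.subspace_sum cinf.subspace_scale cfin_subspace)

lemma continuous_on_mulm:
  assumes "\<And>i. continuous_on S (\<lambda>x. h x i)" "continuous_on S A"
  shows "continuous_on S (\<lambda>x. mulm (h x) (A x) j)"
  unfolding mulm_def using assms by (intro continuous_intros)

lemma sum_mulm: "(\<Sum>j\<in>UNIV. c j \<cdot> mulm h A j) = (\<Sum>i\<in>UNIV. (\<Sum>j\<in>UNIV. A $ i $ j * c j) \<cdot> h i)"
proof -
  have "(\<Sum>j\<in>UNIV. c j \<cdot> mulm h A j) = (\<Sum>j\<in>UNIV. \<Sum>i\<in>UNIV. (A $ i $ j * c j) \<cdot> h i)"
    by (simp add: mulm_def cinf.scale_sum_right mult.commute)
  also have "\<dots> = (\<Sum>i\<in>UNIV. \<Sum>j\<in>UNIV. (A $ i $ j * c j) \<cdot> h i)" by (rule sum.swap)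
  finally show ?thesis by (simp add: cinf.scale_sum_left)
qed

text \<open>This is the form in which invertibility matches \<open>lindep\<close>: the coefficients
  of a relation form a vector in the kernel.\<close>

lemma invertible_iff_inj:
  fixes A :: "complex ^ 'n ^ 'n"
  shows "invertible A \<longleftrightarrow> (\<forall>c. (\<forall>i. (\<Sum>j\<in>UNIV. A $ i $ j * c j) = 0) \<longrightarrow> (\<forall>j. c j = 0))"
proof -
  have "invertible A \<longleftrightarrow> (\<forall>x. A *v x = 0 \<longrightarrow> x = 0)"
    using matrix_left_invertible_ker[of A] invertible_left_inverse[of A] by simp
  also have "\<dots> \<longleftrightarrow> (\<forall>c. (\<forall>i. (\<Sum>j\<in>UNIV. A $ i $ j * c j) = 0) \<longrightarrow> (\<forall>j. c j = 0))"
  proof (intro iffI allI impI)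
    fix c and j assume *: "\<forall>x. A *v x = 0 \<longrightarrow> x = 0" and c: "\<forall>i. (\<Sum>j\<in>UNIV. A $ i $ j * c j) = 0"
    have "A *v (\<chi> j. c j) = 0" using c by (simp add: vec_eq_iff matrix_vector_mult_def)
    then have "(\<chi> j. c j) = 0" using * by blast
    then show "c j = 0" by (simp add: vec_eq_iff)
  next
    fix x assume *: "\<forall>c. (\<forall>i. (\<Sum>j\<in>UNIV. A $ i $ j * c j) = 0) \<longrightarrow> (\<forall>j. c j = 0)" and x: "A *v x = 0"
    have "\<forall>i. (\<Sum>j\<in>UNIV. A $ i $ j * x $ j) = 0"
      using x by (simp add: vec_eq_iff matrix_vector_mult_def)
    then have "\<forall>j. x $ j = 0" using *[THEN spec[of _ "\<lambda>j. x $ j"]] by simp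
    then show "x = 0" by (simp add: vec_eq_iff)
  qed
  finally show ?thesis .
qed

lemma lindep_mulm:
  assumes "lindep UNIV h" "invertible A"
  shows "lindep UNIV (mulm h A)"
proof (rule lindepI)
  fix c j assume "(\<Sum>j\<in>UNIV. c j \<cdot> mulm h A j) = 0"
  then have "(\<Sum>j\<in>UNIV. A $ i $ j * c j) = 0" for i
    using lindepD[OF assms(1)] by (simp add: sum_mulm)
  then show "c j = 0" using assms(2) unfolding invertible_iff_inj by blast
qed

lemma mulm_inject:
  assumes "lindep UNIV h"
  shows "mulm h A = mulm h B \<longleftrightarrow> A = B"
proof
  assume "mulm h A = mulm h B"
  then have "(\<Sum>i\<in>UNIV. (A $ i $ j - B $ i $ j) \<cdot> h i) = 0" for j
    by (simp add: fun_eq_iff mulm_def cinf.scale_left_diff_distrib sum_subtractf)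
  then have "A $ i $ j - B $ i $ j = 0" for i j by (rule lindepD[OF assms]) simp
  then show "A = B" by (simp add: vec_eq_iff)
qed simp

lemma lindep_mulm_imp_invertible:
  assumes "lindep UNIV (mulm h A)"
  shows "invertible A"
  unfolding invertible_iff_inj
proof (intro allI impI)
  fix c j assume "\<forall>i. (\<Sum>j\<in>UNIV. A $ i $ j * c j) = 0"
  then have "(\<Sum>j\<in>UNIV. c j \<cdot> mulm h A j) = 0" by (simp add: sum_mulm)
  then show "c j = 0" using lindepD[OF assms] by simp
qed

lemma matrix_inv_props:
  fixes A :: "'a::semiring_1 ^ 'n ^ 'n"
  assumes "invertible A"
  shows "A ** matrix_inv A = mat 1" "matrix_inv A ** A = mat 1"
proof -
  have "\<exists>A'. A ** A' = mat 1 \<and> A' ** A = mat 1" using assms by (simp add: invertible_def)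
  then have "A ** matrix_inv A = mat 1 \<and> matrix_inv A ** A = mat 1"
    unfolding matrix_inv_def by (rule someI_ex)
  then show "A ** matrix_inv A = mat 1" "matrix_inv A ** A = mat 1" by auto
qed

lemma span_mulm:
  assumes "invertible A"
  shows "cinf.span (range (mulm h A)) = cinf.span (range h)"
proof -
  have sub: "cinf.span (range (mulm h B)) \<subseteq> cinf.span (range h)" for h :: "'a \<Rightarrow> cinf" and B
  proof (rule cinf.span_minimal)
    show "range (mulm h B) \<subseteq> cinf.span (range h)"
      unfolding mulm_def by (auto intro: sum_in_span_family)
  qed (rule cinf.subspace_span)
  have "h = mulm (mulm h A) (matrix_inv A)"
    using matrix_inv_props[OF assms] by (simp add: mulm_mulm mulm_one)
  then have "cinf.span (range h) \<subseteq> cinf.span (range (mulm h A))" using sub by metis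
  then show ?thesis using sub by blast
qed

lemma lookup_mulm_bv: "coord (mulm (bv c) A j) (c + idx i) = A $ i $ j"
proof -
  have "coord (mulm (bv c) A j) (c + idx i) = (\<Sum>k\<in>UNIV. if k = i then A $ k $ j else 0)"
    unfolding lookup_mulm by (rule sum.cong) (auto simp: bv_def lookup_bvec)
  then show ?thesis by simp
qed

lemma lookup_mulm_bv_zero:
  assumes "k < c \<or> c + CARD('n) \<le> k"
  shows "coord (mulm (bv c) (A :: complex ^ 'n ^ 'n) j) k = 0"
  unfolding lookup_mulm
proof (intro sum.neutral ballI)
  fix i :: 'n
  have "c + idx i \<noteq> k" using assms idx_less[of i] by auto
  then show "A $ i $ j * coord (bv c i) k = 0" by (simp add: bv_def lookup_bvec)
qed

lemma lindep_bv: "lindep UNIV (bv c :: 'n::finite \<Rightarrow> cinf)"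
proof (rule lindepI)
  fix a :: "'n \<Rightarrow> complex" and i assume s: "(\<Sum>i\<in>UNIV. a i \<cdot> (bv c i :: cinf)) = 0"
  have "mulm (bv c) (\<chi> i j. a i) i = 0" using s by (simp add: mulm_def)
  then have "coord (mulm (bv c) (\<chi> i j. a i) i) (c + idx i) = 0" by simp
  then show "a i = 0" by (simp add: lookup_mulm_bv)
qed

lemma cfin_expand_bv:
  assumes "v \<in> cfin CARD('n::finite)"
  shows "v = (\<Sum>i\<in>(UNIV :: 'n set). coord v (idx i) \<cdot> bv 0 i)"
proof -
  have "(\<Sum>i<CARD('n). coord v i \<cdot> bvec i) =
      (\<Sum>i\<in>(UNIV :: 'n set). coord v (idx i) \<cdot> bv 0 i)"
    using sum.reindex_bij_betw[OF bij_betw_idx[where 'n = 'n],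
        of "\<lambda>i. coord v i \<cdot> bvec i"] by (simp add: bv_def)
  then show ?thesis using cfin_expand[OF assms] by simp
qed

lemma span_bv: "cinf.span (range (bv 0 :: 'n::finite \<Rightarrow> cinf)) = cfin CARD('n)"
proof
  have "bv 0 i \<in> cfin CARD('n)" for i :: 'n by (rule bv_cfin) simp
  then show "cinf.span (range (bv 0 :: 'n \<Rightarrow> cinf)) \<subseteq> cfin CARD('n)"
    using cfin_subspace by (intro cinf.span_minimal) auto
  show "cfin CARD('n) \<subseteq> cinf.span (range (bv 0 :: 'n \<Rightarrow> cinf))"
  proof
    fix v assume "v \<in> cfin CARD('n)"
    then have "v = (\<Sum>i\<in>(UNIV :: 'n set). coord v (idx i) \<cdot> bv 0 i)"
      by (rule cfin_expand_bv)
    then show "v \<in> cinf.span (range (bv 0 :: 'n \<Rightarrow> cinf))"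
      using sum_in_span_family[of UNIV UNIV "\<lambda>i. coord v (idx i)" "bv 0 :: 'n \<Rightarrow> cinf"] by simp
  qed
qed

text \<open>\<open>1 + A\<close> and \<open>1 - A\<close> have no common kernel, whatever \<open>A\<close> is. The factor \<open>\<i>\<close> makes both blocks
  invariant under \<open>X \<mapsto> X\<^sup>* A'\<close>, with \<open>X\<^sup>*\<close> the entrywise conjugate and \<open>A'\<close> the inverse of that of
  \<open>A\<close>; see \<open>cnj_kappa\<close>.\<close>

definition kappa :: "nat \<Rightarrow> complex ^ 'n ^ 'n \<Rightarrow> 'n \<Rightarrow> cinf" where
  "kappa N A j = mulm (bv N) (mat 1 + A) j + \<i> \<cdot> mulm (bv (N + CARD('n))) (mat 1 - A) j"

lemma kappa_cfin: "kappa N (A :: complex ^ 'n ^ 'n) j \<in> cfin (N + 2 * CARD('n))"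
  unfolding kappa_def
  by (intro cinf.subspace_add cinf.subspace_scale cfin_subspace mulm_cfin bv_cfin) auto

lemma lookup_kappa:
  fixes A :: "complex ^ 'n ^ 'n"
  shows "coord (kappa N A j) (N + idx i) = (mat 1 + A) $ i $ j"
    and "coord (kappa N A j) (N + CARD('n) + idx i) = \<i> * (mat 1 - A) $ i $ j"
proof -
  show "coord (kappa N A j) (N + idx i) = (mat 1 + A) $ i $ j"
    using idx_less[of i] by (simp add: kappa_def lookup_add lookup_mulm_bv lookup_mulm_bv_zero)
  have "coord (mulm (bv N) (mat 1 + A) j) (N + CARD('n) + idx i) = 0"
    by (rule lookup_mulm_bv_zero) simp
  then show "coord (kappa N A j) (N + CARD('n) + idx i) = \<i> * (mat 1 - A) $ i $ j"
    by (simp add: kappa_def lookup_add lookup_mulm_bv)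
qed

text \<open>Coordinates from \<open>N\<close> on see only the multiple of \<open>kappa\<close>. For
  the coefficient vector c of a relation they give (1 + A) c = 0 and (1 - A) c = 0, and the sum is 2
  c = 0.\<close>

lemma lindep_add_kappa:
  fixes A :: "complex ^ 'n ^ 'n"
  assumes h: "\<And>j. h j \<in> cfin N" and d: "d \<noteq> 0"
  shows "lindep UNIV (\<lambda>j. h j + d \<cdot> kappa N A j)"
proof (rule lindepI)
  fix c :: "'n \<Rightarrow> complex" and i assume c: "(\<Sum>j\<in>UNIV. c j \<cdot> (h j + d \<cdot> kappa N A j)) = 0"
  have look: "(\<Sum>j\<in>UNIV. c j * coord (kappa N A j) k) = 0" if "k \<ge> N" for k
  proof -
    have "0 = coord (\<Sum>j\<in>UNIV. c j \<cdot> (h j + d \<cdot> kappa N A j)) k"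
      using c by simp
    also have "\<dots> = (\<Sum>j\<in>UNIV. d * (c j * coord (kappa N A j) k))"
      unfolding lookup_sum_cinf using h that by (intro sum.cong) (auto simp: lookup_add cfin_iff)
    also have "\<dots> = d * (\<Sum>j\<in>UNIV. c j * coord (kappa N A j) k)"
      by (rule sum_distrib_left[symmetric])
    finally show ?thesis using d by simp
  qed
  have 1: "(\<Sum>j\<in>UNIV. c j * (mat 1 + A) $ i $ j) = 0"
    using look[of "N + idx i"] by (simp only: lookup_kappa)
  have "(\<Sum>j\<in>UNIV. c j * (\<i> * (mat 1 - A) $ i $ j)) = 0"
    using look[of "N + CARD('n) + idx i"] by (simp only: lookup_kappa)
  moreover have "(\<Sum>j\<in>UNIV. c j * (\<i> * (mat 1 - A) $ i $ j)) = \<i> * (\<Sum>j\<in>UNIV. c j * (mat 1 - A) $ i $ j)"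
    unfolding sum_distrib_left by (intro sum.cong) (simp_all only: ac_simps)
  ultimately have 2: "(\<Sum>j\<in>UNIV. c j * (mat 1 - A) $ i $ j) = 0" by simp
  have "(\<Sum>j\<in>UNIV. if j = i then 2 * c j else 0) =
      (\<Sum>j\<in>UNIV. c j * (mat 1 + A) $ i $ j) + (\<Sum>j\<in>UNIV. c j * (mat 1 - A) $ i $ j)"
    unfolding sum.distrib[symmetric] by (intro sum.cong) (auto simp: mat_def algebra_simps)
  then show "c i = 0" using 1 2 by simp
qed

text \<open>Right multiplication by \<open>A'\<close> turns the conjugate of 1 + A into 1 + A' and
  that of 1 - A into the negative of 1 - A'; conjugating \<i> absorbs the sign.\<close>

lemma cnj_kappa:
  assumes "mcnj A ** A' = mat 1"
  shows "mulm (\<lambda>i. cinf_cnj (kappa N A i)) A' = kappa N A'"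
proof
  fix j
  have cnj: "cinf_cnj (kappa N A i) = mulm (bv N) (mcnj (mat 1 + A)) i +
      (- \<i>) \<cdot> mulm (bv (N + CARD('a))) (mcnj (mat 1 - A)) i" for i
    by (simp add: kappa_def cinf_cnj_add cinf_cnj_scl cinf_cnj_mulm cinf_cnj_bv)
  have distr: "(X + Y) ** A' = X ** A' + Y ** A'" "(X - Y) ** A' = X ** A' - Y ** A'" for X Y
    by (simp_all add: vec_eq_iff matrix_matrix_mult_def algebra_simps sum.distrib sum_subtractf)
  have "mcnj (mat 1 + A) = mat 1 + mcnj A" "mcnj (mat 1 - A) = mat 1 - mcnj A"
    by (simp_all add: vec_eq_iff mat_def)
  then have 1: "mcnj (mat 1 + A) ** A' = mat 1 + A'" and 2: "mcnj (mat 1 - A) ** A' = A' - mat 1"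
    using assms by (simp_all add: distr add.commute)
  have "mulm (\<lambda>i. cinf_cnj (kappa N A i)) A' j = mulm (bv N) (mat 1 + A') j +
      (- \<i>) \<cdot> mulm (bv (N + CARD('a))) (A' - mat 1) j"
    unfolding cnj mulm_add mulm_scl by (simp add: mulm_mulm 1 2)
  also have "\<dots> = kappa N A' j"
    by (rule poly_mapping_eqI) (simp add: kappa_def lookup_add mulm_mat_diff lookup_minus algebra_simps)
  finally show "mulm (\<lambda>i. cinf_cnj (kappa N A i)) A' j = kappa N A' j" .
qed

lemma continuous_on_kappa:
  assumes "continuous_on S A"
  shows "continuous_on S (\<lambda>x. kappa N (A x) j)"
  unfolding kappa_def using assms
  by (intro continuous_on_add continuous_on_scl continuous_on_mulm continuous_intros)

text \<open>The factor of \<open>kappa\<close> vanishes at both ends, leaving the end frames alone,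
  and is even in \<open>u\<close>, as the reversal of the loop requires.\<close>

definition sec :: "complex ^ 'n ^ 'n \<Rightarrow> real \<Rightarrow> 'n \<Rightarrow> cinf" where
  "sec A u j = complex_of_real ((1 - u) / 2) \<cdot> bv 0 j + complex_of_real ((1 + u) / 2) \<cdot> mulm (bv 0) A j +
     complex_of_real (1 - u\<^sup>2) \<cdot> kappa CARD('n) A j"

lemma sec_cfin: "sec (A :: complex ^ 'n ^ 'n) u j \<in> cfin (3 * CARD('n))"
proof -
  have "bv 0 i \<in> cfin (3 * CARD('n))" for i :: 'n by (rule bv_cfin) simp
  moreover have "kappa CARD('n) A j \<in> cfin (3 * CARD('n))"
    using kappa_cfin[of "CARD('n)" A j] by (simp add: algebra_simps)
  ultimately show ?thesis
    unfolding sec_def by (intro cinf.subspace_add cinf.subspace_scale cfin_subspace mulm_cfin)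
qed

lemma sec_ends: "sec A (-1) = bv 0" "sec A 1 = mulm (bv 0) A"
  by (auto simp: sec_def fun_eq_iff)

lemma lindep_sec:
  fixes A :: "complex ^ 'n ^ 'n"
  assumes "invertible A" "u \<in> {-1..1}"
  shows "lindep UNIV (sec A u)"
proof -
  consider "u = -1" | "u = 1" | "1 - u\<^sup>2 \<noteq> 0" by (metis eq_iff_diff_eq_0 power2_eq_1_iff)
  then show ?thesis
  proof cases
    case 3
    then have d: "complex_of_real (1 - u\<^sup>2) \<noteq> 0" by (metis of_real_eq_0_iff)
    have "bv 0 i \<in> cfin CARD('n)" for i :: 'n by (rule bv_cfin) simp
    then show ?thesis
      unfolding sec_def
      by (intro lindep_add_kappa d cinf.subspace_add cinf.subspace_scale cfin_subspace mulm_cfin)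
  qed (simp_all add: sec_ends lindep_bv lindep_mulm assms)
qed

text \<open>Conjugation followed by \<open>A'\<close> sends the identity to \<open>A'\<close> and
  \<open>A\<close> to the identity, so the two linear weights change places, just as under
  \<open>u \<mapsto> -u\<close>. It is applied with \<open>A'\<close> the transpose for equivariance
  and with \<open>A' = A\<close> for fixed points.\<close>

lemma cnj_sec:
  assumes "mcnj A ** A' = mat 1"
  shows "mulm (\<lambda>i. cinf_cnj (sec A u i)) A' = sec A' (-u)"
proof
  fix j
  have cnj: "cinf_cnj (sec A u i) = complex_of_real ((1 - u) / 2) \<cdot> bv 0 i +
      complex_of_real ((1 + u) / 2) \<cdot> mulm (bv 0) (mcnj A) i +
      complex_of_real (1 - u\<^sup>2) \<cdot> cinf_cnj (kappa CARD('a) A i)" for i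
    by (simp add: sec_def cinf_cnj_add cinf_cnj_scl cinf_cnj_mulm cinf_cnj_bv)
  show "mulm (\<lambda>i. cinf_cnj (sec A u i)) A' j = sec A' (-u) j"
    unfolding cnj mulm_add mulm_scl
    by (simp add: mulm_mulm assms mulm_one cnj_kappa[OF assms] sec_def add.commute)
qed

lemma continuous_on_sec:
  assumes "continuous_on S A" "continuous_on S u"
  shows "continuous_on S (\<lambda>x. sec (A x) (u x) j)"
  unfolding sec_def using assms
  by (intro continuous_on_add continuous_on_scl continuous_on_mulm continuous_on_kappa continuous_intros) auto

section \<open>Loops of subspaces spanned by frames\<close>

definition frame_loop :: "(real \<Rightarrow> 'n \<Rightarrow> cinf) \<Rightarrow> real option \<Rightarrow> cinf set" where
  "frame_loop h = loop_of (\<lambda>t. cinf.span (range (h t)))"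

text \<open>The flag treats the loop space and its fixed points in one argument; the condition
  spells out the action of \<open>Omega_sigma\<close>.\<close>

definition Omega_fx :: "bool \<Rightarrow> nat \<Rightarrow> (real option \<Rightarrow> cinf set) topology" where
  "Omega_fx fx n = subtopology (sign_loop_topology (grassmannian_topology n) (cfin n))
     {f. fx \<longrightarrow> (\<lambda>s. cinf_cnj ` f (map_option uminus s)) = f}"

text \<open>The last condition makes the loops spanned by the frames fixed points of the action: it is
  \<open>cnj_sec\<close> for families of frames other than \<open>sec\<close>.\<close>

definition good_family ::
  "bool \<Rightarrow> 's::topological_space set \<Rightarrow> ('s \<Rightarrow> real \<Rightarrow> 'n::finite \<Rightarrow> cinf) \<Rightarrow> ('s \<Rightarrow> complex ^ 'n ^ 'n) \<Rightarrow> bool" where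
  "good_family fx S h A \<longleftrightarrow>
     (\<exists>N. \<forall>s\<in>S. \<forall>t\<in>{-1..1}. \<forall>j. h s t j \<in> cfin N) \<and>
     (\<forall>j. continuous_on (S \<times> {-1..1}) (\<lambda>z. h (fst z) (snd z) j)) \<and>
     (\<forall>s\<in>S. \<forall>t\<in>{-1..1}. lindep UNIV (h s t)) \<and>
     (\<forall>s\<in>S. h s (-1) = bv 0 \<and> h s 1 = mulm (bv 0) (A s)) \<and>
     (fx \<longrightarrow> (\<forall>s\<in>S. \<forall>t\<in>{-1..1}. h s (-t) = mulm (\<lambda>i. cinf_cnj (h s t i)) (A s)))"

lemma good_familyD:
  assumes "good_family fx S h A"
  shows "\<exists>N. \<forall>s\<in>S. \<forall>t\<in>{-1..1}. \<forall>j. h s t j \<in> cfin N"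
    and "continuous_on (S \<times> {-1..1}) (\<lambda>z. h (fst z) (snd z) j)"
    and "s \<in> S \<Longrightarrow> t \<in> {-1..1} \<Longrightarrow> lindep UNIV (h s t)"
    and "s \<in> S \<Longrightarrow> h s (-1) = bv 0" "s \<in> S \<Longrightarrow> h s 1 = mulm (bv 0) (A s)"
    and "fx \<Longrightarrow> s \<in> S \<Longrightarrow> t \<in> {-1..1} \<Longrightarrow> h s (-t) = mulm (\<lambda>i. cinf_cnj (h s t i)) (A s)"
  using assms unfolding good_family_def by blast+

lemma good_family_invertible: "good_family fx S h A \<Longrightarrow> s \<in> S \<Longrightarrow> invertible (A s)"
  using good_familyD(3)[of fx S h A s 1] good_familyD(5)[of fx S h A s]
  by (auto intro: lindep_mulm_imp_invertible)

lemma good_family_sec: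
  assumes "continuous_on S A" "\<And>s. s \<in> S \<Longrightarrow> invertible (A s)"
    and "\<And>s. fx \<Longrightarrow> s \<in> S \<Longrightarrow> mcnj (A s) ** A s = mat 1"
  shows "good_family fx S (\<lambda>s. sec (A s)) A"
  unfolding good_family_def
proof (intro conjI ballI allI impI)
  show "\<exists>N. \<forall>s\<in>S. \<forall>t\<in>{-1..1}. \<forall>j. sec (A s) t j \<in> cfin N" using sec_cfin by blast
  show "continuous_on (S \<times> {-1..1}) (\<lambda>z. sec (A (fst z)) (snd z) j)" for j
    by (intro continuous_on_sec continuous_intros continuous_on_compose2[OF assms(1)]) auto
  show "sec (A s) (-t) = mulm (\<lambda>i. cinf_cnj (sec (A s) t i)) (A s)" if fx "s \<in> S" for s t
    using cnj_sec[OF assms(3)[OF that]] by simp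
qed (simp_all add: lindep_sec assms(2) sec_ends)

lemma frame_loop_compactify:
  fixes h :: "real \<Rightarrow> 'n::finite \<Rightarrow> cinf"
  assumes "h (-1) = bv 0" "h 1 = mulm (bv 0) A" "invertible A" "u \<in> {-1..1}"
  shows "frame_loop h (compactify u) = cinf.span (range (h u))"
  unfolding frame_loop_def using assms by (intro loop_of_compactify) (simp_all add: span_mulm)

text \<open>The matrix \<open>A'\<close> only changes the frame inside its span. With
  \<open>h' = h\<close> this says that a loop is a fixed point; with two matrices it gives
  equivariance of \<open>bott\<close>.\<close>

lemma cinf_cnj_frame_loop:
  fixes h h' :: "real \<Rightarrow> 'n::finite \<Rightarrow> cinf"
  assumes "h (-1) = bv 0" "h 1 = mulm (bv 0) A" "invertible A"
    and "h' (-1) = bv 0" "h' 1 = mulm (bv 0) A'" "invertible A'"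
    and fx: "\<And>t. t \<in> {-1..1} \<Longrightarrow> h' (-t) = mulm (\<lambda>i. cinf_cnj (h t i)) A'"
  shows "(\<lambda>s. cinf_cnj ` frame_loop h (map_option uminus s)) = frame_loop h'"
proof
  fix s
  define u where "u = uncompactify s"
  have u: "u \<in> {-1..1}" "-u \<in> {-1..1}" using uncompactify_bounds[of s] by (auto simp: u_def)
  have s: "s = compactify u" by (simp add: u_def compactify_uncompactify)
  have "cinf_cnj ` frame_loop h (map_option uminus s) = cinf_cnj ` cinf.span (range (h (-u)))"
    unfolding s compactify_uminus[symmetric] using frame_loop_compactify[OF assms(1-3) u(2)] by simp
  also have "\<dots> = cinf.span (range (\<lambda>i. cinf_cnj (h (-u) i)))"
    by (simp add: cinf_cnj_image_span image_image)
  also have "\<dots> = cinf.span (range (h' u))"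
    using fx[OF u(2)] span_mulm[OF assms(6), of "\<lambda>i. cinf_cnj (h (-u) i)"] by simp
  also have "\<dots> = frame_loop h' s"
    unfolding s using frame_loop_compactify[OF assms(4-6) u(1)] by simp
  finally show "cinf_cnj ` frame_loop h (map_option uminus s) = frame_loop h' s" .
qed

lemma good_family_map:
  fixes h :: "'s::topological_space \<Rightarrow> real \<Rightarrow> 'n::finite \<Rightarrow> cinf"
  assumes good: "good_family fx S h A"
  shows "continuous_map (top_of_set S) (Omega_fx fx CARD('n)) (\<lambda>s. frame_loop (h s))"
  unfolding Omega_fx_def continuous_map_in_subtopology
proof
  obtain N where N: "\<And>s t j. s \<in> S \<Longrightarrow> t \<in> {-1..1} \<Longrightarrow> h s t j \<in> cfin N"
    using good_familyD(1)[OF good] by blast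
  note ends = good_familyD(4,5)[OF good] and inv = good_family_invertible[OF good]
  have "continuous_map (top_of_set (S \<times> {-1..1})) (grassmannian_topology CARD('n))
      (\<lambda>z. cinf.span ((\<lambda>j. h (fst z) (snd z) (unidx j)) ` {..<CARD('n)}))"
  proof (rule continuous_map_into_grassmannian)
    show "continuous_map (top_of_set (S \<times> {-1..1})) euclidean
        (\<lambda>z. coord (h (fst z) (snd z) (unidx j)) i)" for i j
      using continuous_on_lookup[OF good_familyD(2)[OF good]] by simp
    fix z assume "z \<in> topspace (top_of_set (S \<times> {-1..1::real}))"
    then show "h (fst z) (snd z) (unidx j) \<in> cfin N" "lindep {..<CARD('n)} (\<lambda>j. h (fst z) (snd z) (unidx j))" for j
      using N good_familyD(3)[OF good] by (auto simp: lindep_reindex[OF bij_betw_unidx])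
  qed
  moreover have "(\<lambda>j. h (fst z) (snd z) (unidx j)) ` {..<CARD('n)} = range (h (fst z) (snd z))" for z
    by (rule image_unidx)
  ultimately have "continuous_map (prod_topology (top_of_set S) (top_of_set {-1..1})) (grassmannian_topology CARD('n))
      (\<lambda>(z, u). cinf.span (range (h z u)))"
    by (simp add: case_prod_unfold)
  then show "continuous_map (top_of_set S) (sign_loop_topology (grassmannian_topology CARD('n)) (cfin CARD('n)))
      (\<lambda>s. frame_loop (h s))"
    unfolding frame_loop_def
    by (rule continuous_map_loop_of) (simp_all add: ends span_bv span_mulm inv)
  show "(\<lambda>s. frame_loop (h s)) \<in> topspace (top_of_set S) \<rightarrow>
      {f. fx \<longrightarrow> (\<lambda>s. cinf_cnj ` f (map_option uminus s)) = f}"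
  proof (intro Pi_I CollectI impI)
    fix s assume "s \<in> topspace (top_of_set S)" fx
    then have s: "s \<in> S" and fx: "\<And>t. t \<in> {-1..1} \<Longrightarrow> h s (-t) = mulm (\<lambda>i. cinf_cnj (h s t i)) (A s)"
      using good_familyD(6)[OF good] by auto
    show "(\<lambda>x. cinf_cnj ` frame_loop (h s) (map_option uminus x)) = frame_loop (h s)"
      by (rule cinf_cnj_frame_loop[OF ends[OF s] inv[OF s] ends[OF s] inv[OF s] fx])
  qed
qed

section \<open>Lifting families of loops to families of frames\<close>

lemma continuous_on_det:
  fixes A :: "'s::topological_space \<Rightarrow> complex ^ 'n ^ 'n"
  assumes "\<And>i j. continuous_on S (\<lambda>x. A x $ i $ j)"
  shows "continuous_on S (\<lambda>x. det (A x))"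
  unfolding det_def
  by (intro continuous_on_sum continuous_on_mult continuous_on_const continuous_on_prod assms)

text \<open>By Cramer's rule the entries of the inverse are quotients of determinants.\<close>

lemma continuous_on_matrix_inv:
  fixes A :: "'s::topological_space \<Rightarrow> complex ^ 'n ^ 'n"
  assumes A: "continuous_on S A" and inv: "\<And>x. x \<in> S \<Longrightarrow> invertible (A x)"
  shows "continuous_on S (\<lambda>x. matrix_inv (A x))"
proof (rule continuous_on_eq)
  have entries: "continuous_on S (\<lambda>x. A x $ i $ j)" for i j
    using A by (intro continuous_intros)
  let ?C = "\<lambda>x k l. \<chi> i j. if j = k then (if i = l then 1 else 0) else A x $ i $ j"
  have "continuous_on S (\<lambda>x. ?C x k l $ i $ j)" for k l i j
    using entries by (cases "j = k") auto
  then have "continuous_on S (\<lambda>x. det (?C x k l) / det (A x))" for k l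
    using inv by (intro continuous_on_divide continuous_on_det entries) (auto simp: invertible_det_nz)
  then show "continuous_on S (\<lambda>x. \<chi> k l. det (?C x k l) / det (A x))"
    by (intro continuous_on_vec_lambda)
  fix x assume x: "x \<in> S"
  show "(\<chi> k l. det (?C x k l) / det (A x)) = matrix_inv (A x)"
  proof -
    have d: "det (A x) \<noteq> 0" using inv[OF x] by (simp add: invertible_det_nz)
    have "det (?C x k l) / det (A x) = matrix_inv (A x) $ k $ l" for k l
    proof -
      have "A x *v (\<chi> k. matrix_inv (A x) $ k $ l) = (\<chi> i. if i = l then 1 else 0)"
        using matrix_inv_props(1)[OF inv[OF x]]
        by (simp add: vec_eq_iff matrix_vector_mult_def matrix_matrix_mult_def mat_def)
      then have "(\<chi> k. matrix_inv (A x) $ k $ l) = (\<chi> k. det (\<chi> i j. if j = k then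
          (\<chi> i. if i = l then 1 else 0) $ i else A x $ i $ j) / det (A x))"
        using cramer[OF d] by blast
      then show ?thesis by (simp add: vec_eq_iff cong: if_cong)
    qed
    then show ?thesis by (simp add: vec_eq_iff)
  qed
qed

lemma continuous_on_matrix_mult:
  fixes A B :: "'s::topological_space \<Rightarrow> complex ^ 'n ^ 'n"
  assumes "continuous_on S A" "continuous_on S B"
  shows "continuous_on S (\<lambda>x. A x ** B x)"
  unfolding matrix_matrix_mult_def using assms by (intro continuous_intros)

lemma clin_mulm: "clin T \<Longrightarrow> T (mulm h A j) = mulm (\<lambda>i. T (h i)) A j"
  by (simp add: mulm_def clin_sum clin_scl)

text \<open>The symmetry condition at \<open>t = 1\<close> compares the two end frames.\<close>

lemma good_family_real:
  assumes "good_family True S h A" "s \<in> S"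
  shows "mcnj (A s) ** A s = mat 1"
proof -
  note ends = good_familyD(4,5)[OF assms]
  have "mulm (bv 0) (mat 1) = h s (-1)" by (simp add: mulm_one ends)
  also have "\<dots> = mulm (\<lambda>i. cinf_cnj (h s 1 i)) (A s)" using good_familyD(6)[OF assms(1) _ assms(2), of 1] by simp
  also have "\<dots> = mulm (bv 0) (mcnj (A s) ** A s)"
    by (simp add: ends cinf_cnj_mulm cinf_cnj_bv flip: mulm_mulm)
  finally show ?thesis by (simp add: mulm_inject[OF lindep_bv])
qed

text \<open>A left inverse of \<open>sec B 0\<close> that does not depend on \<open>B\<close>, from \<open>(1 + B) - \<i> (\<i> (1 - B)) = 2\<close>.\<close>

definition sec_coeff :: "cinf \<Rightarrow> 'n::finite \<Rightarrow> complex" where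
  "sec_coeff v j = (coord v (CARD('n) + idx j) -
     \<i> * coord v (CARD('n) + CARD('n) + idx j)) / 2"

lemma sec_coeff_sum:
  "sec_coeff (\<Sum>i\<in>I. c i \<cdot> f i) j = (\<Sum>i\<in>I. c i * sec_coeff (f i) j)"
  by (simp add: sec_coeff_def lookup_sum_cinf sum_subtractf sum_distrib_left right_diff_distrib
      sum_divide_distrib diff_divide_distrib mult.left_commute)

lemma sec_coeff_sec:
  fixes B :: "complex ^ 'n ^ 'n"
  shows "sec_coeff (sec B 0 j) i = (if i = j then 1 else 0)"
proof -
  have z: "coord (mulm (bv 0) B j) (CARD('n) + k) = 0"
    "coord (bv 0 j) (CARD('n) + k) = 0" for k
    using lookup_mulm_bv_zero[of "CARD('n) + k" 0 B j] lookup_mulm_bv_zero[of "CARD('n) + k" 0 "mat 1" j]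
    by (simp_all add: mulm_one)
  have a: "coord (sec B 0 j) (CARD('n) + idx i) = (mat 1 + B) $ i $ j"
    by (simp add: sec_def lookup_add z lookup_kappa(1))
  have b: "coord (sec B 0 j) (CARD('n) + CARD('n) + idx i) = \<i> * (mat 1 - B) $ i $ j"
    using z[of "CARD('n) + idx i"] lookup_kappa(2)[of "CARD('n)" B j i]
    by (simp add: sec_def lookup_add add.assoc)
  show ?thesis unfolding sec_coeff_def a b by (simp add: mat_def algebra_simps)
qed

lemma sec_coeff_combination:
  "sec_coeff (\<Sum>j\<in>UNIV. c j \<cdot> sec B 0 j) i = c i"
proof -
  have "sec_coeff (\<Sum>j\<in>UNIV. c j \<cdot> sec B 0 j) i = (\<Sum>j\<in>UNIV. if j = i then c j else 0)"
    unfolding sec_coeff_sum by (intro sum.cong) (auto simp: sec_coeff_sec)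
  then show ?thesis by simp
qed

lemma in_span_range: "v \<in> cinf.span (range h) \<Longrightarrow> \<exists>c. v = (\<Sum>j\<in>UNIV. c j \<cdot> h j)"
  for h :: "'n::finite \<Rightarrow> cinf"
  using span_family[of UNIV h] by auto

text \<open>The isomorphism between fibres that carries the frame \<open>sec B 0\<close> to
  \<open>sec B t\<close>. Written with \<open>sec_coeff\<close>, it is an operator on all of
  \<open>cinf\<close>, continuous jointly in \<open>B\<close>, \<open>t\<close> and the
  vector.\<close>

definition sec_transport :: "complex ^ 'n ^ 'n \<Rightarrow> real \<Rightarrow> cinf \<Rightarrow> cinf" where
  "sec_transport B t v = (\<Sum>j\<in>UNIV. sec_coeff v j \<cdot> sec B t j)"

lemma sec_transport_combination:
  "sec_transport B t (\<Sum>j\<in>UNIV. c j \<cdot> sec B 0 j) = (\<Sum>j\<in>UNIV. c j \<cdot> sec B t j)"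
  by (simp add: sec_transport_def sec_coeff_combination)

lemma clin_sec_transport: "clin (sec_transport B t)"
proof -
  have "sec_coeff (v + w) j = sec_coeff v j + sec_coeff w j" for v w and j :: 'a
    by (simp add: sec_coeff_def lookup_add algebra_simps add_divide_distrib diff_divide_distrib)
  moreover have "sec_coeff (c \<cdot> v) j = c * sec_coeff v j" for c v and j :: 'a
    by (simp add: sec_coeff_def algebra_simps diff_divide_distrib)
  ultimately show ?thesis
    by (simp add: clin_def sec_transport_def cinf.scale_left_distrib sum.distrib cinf.scale_sum_right)
qed

lemma sec_transport_cnj:
  fixes B :: "complex ^ 'n ^ 'n"
  assumes B: "mcnj B ** B = mat 1" and v: "v \<in> cinf.span (range (sec B 0))"
  shows "sec_transport B (-t) (cinf_cnj v) = cinf_cnj (sec_transport B t v)"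
proof -
  obtain c where c: "v = (\<Sum>j\<in>UNIV. c j \<cdot> sec B 0 j)" using in_span_range[OF v] by blast
  have "cinf_cnj (sec B t j) = mulm (sec B (-t)) (mcnj B) j" for t j
    using arg_cong[OF fun_cong[OF cnj_sec[OF B, of "-t"], of j], of cinf_cnj]
    by (simp add: cinf_cnj_mulm)
  then have cnj: "cinf_cnj (\<Sum>j\<in>UNIV. c j \<cdot> sec B t j) =
      (\<Sum>i\<in>UNIV. (\<Sum>j\<in>UNIV. mcnj B $ i $ j * cnj (c j)) \<cdot> sec B (-t) i)" for t
    by (simp add: cinf_cnj_sum cinf_cnj_scl sum_mulm)
  show ?thesis
    unfolding c sec_transport_combination cnj using cnj[of 0]
    by (simp add: sec_transport_combination cnj)
qed

text \<open>\<open>Z\<close> frames the central fibre and \<open>X\<close> spreads this frame over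
  the interval. The central frame is then multiplied by the inverse of \<open>M k\<close>, the
  matrix of the result at -1, so that the frame starts at the standard one.\<close>

lemma frame_lift:
  fixes K :: "'k::{metric_space,second_countable_topology} set" and B :: "'k \<Rightarrow> complex ^ 'n ^ 'n"
  assumes K: "compact K" and L: "closed L" "L \<subseteq> K"
    and \<alpha>: "continuous_map (top_of_set K) (Omega_fx fx CARD('n)) \<alpha>"
    and B: "continuous_on L B" "\<And>l. l \<in> L \<Longrightarrow> invertible (B l)"
      "\<And>l. fx \<Longrightarrow> l \<in> L \<Longrightarrow> mcnj (B l) ** B l = mat 1"
    and \<alpha>L: "\<And>l. l \<in> L \<Longrightarrow> \<alpha> l = frame_loop (sec (B l))"
  obtains h A where "good_family fx K h (A :: 'k \<Rightarrow> complex ^ 'n ^ 'n)" "continuous_on K A"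
    "\<And>k. k \<in> K \<Longrightarrow> frame_loop (h k) = \<alpha> k"
    "\<And>l t. l \<in> L \<Longrightarrow> t \<in> {-1..1} \<Longrightarrow> h l t = sec (B l) t" "\<And>l. l \<in> L \<Longrightarrow> A l = B l"
proof -
  let ?I = "{-1..1::real}" and ?n = "CARD('n)"
  define F where "F k t = \<alpha> k (compactify t)" for k t
  have \<alpha>c: "continuous_map (top_of_set K) (sign_loop_topology (grassmannian_topology ?n) (cfin ?n)) \<alpha>"
    and \<alpha>fx: "\<And>k. k \<in> K \<Longrightarrow> fx \<Longrightarrow> (\<lambda>s. cinf_cnj ` \<alpha> k (map_option uminus s)) = \<alpha> k"
    using \<alpha> by (auto simp: Omega_fx_def continuous_map_in_subtopology)
  have \<alpha>loop: "\<alpha> k \<in> sign_loops (grassmannian_topology ?n) (cfin ?n)" if "k \<in> K" for k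
    using \<alpha>c that by (auto simp: continuous_map_def Pi_iff)
  have Fc: "continuous_map (top_of_set (K \<times> ?I)) (grassmannian_topology ?n) (\<lambda>z. F (fst z) (snd z))"
    using continuous_map_eval_loop[OF \<alpha>c] by (simp add: F_def case_prod_unfold)
  have F_ends: "F k (-1) = cfin ?n" "F k 1 = cfin ?n" if "k \<in> K" for k
    using \<alpha>loop[OF that] by (simp_all add: F_def compactify_def sign_loops_def)
  have F_L: "F l t = cinf.span (range (sec (B l) t))" if "l \<in> L" "t \<in> ?I" for l t
    unfolding F_def \<alpha>L[OF that(1)]
    by (rule frame_loop_compactify[OF sec_ends B(2)[OF that(1)] that(2)])
  have cpt: "compactin (grassmannian_topology ?n) ((\<lambda>z. F (fst z) (snd z)) ` (K \<times> ?I))"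
    by (rule image_compactin[OF _ Fc]) (simp add: compactin_subtopology compact_Times K)
  have "\<exists>N. \<forall>W\<in>(\<lambda>z. F (fst z) (snd z)) ` (K \<times> ?I). W \<subseteq> cfin N"
  proof (rule compact_image_in_cfin[OF cpt])
    show "1 \<le> ?n" by (simp add: Suc_leI)
  qed blast
  then obtain N where N: "\<forall>W\<in>(\<lambda>z. F (fst z) (snd z)) ` (K \<times> ?I). W \<subseteq> cfin N" by blast
  interpret gr_family K F ?n N
  proof
    show "F k t \<subseteq> cfin N" if "k \<in> K" "t \<in> ?I" for k t
      using that by (intro bspec[OF N] image_eqI[of _ _ "(k, t)"]) auto
  qed (use K Fc in \<open>auto simp: Suc_leI\<close>)
  have zero_I: "0 \<in> ?I" and end_I: "-1 \<in> ?I" "1 \<in> ?I" by auto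
  have Ffx: "F k (-t) = cinf_cnj ` F k t" if fx: fx and k: "k \<in> K" for k t
  proof -
    have "cinf_cnj ` \<alpha> k (compactify t) = cinf_cnj ` \<alpha> k (map_option uminus (compactify (-t)))"
      using compactify_uminus[of "-t"] by simp
    also have "\<dots> = \<alpha> k (compactify (-t))" using fun_cong[OF \<alpha>fx[OF k fx]] by simp
    finally show ?thesis by (simp add: F_def)
  qed
  have rep: "\<exists>c. v = (\<Sum>j\<in>UNIV. c j \<cdot> sec (B l) 0 j)" if "l \<in> L" "v \<in> F l 0" for l v
    using that(2) unfolding F_L[OF that(1) zero_I] by (rule in_span_range)
  have "continuous_on ((L \<times> ?I) \<times> UNIV) (\<lambda>z. sec (B (fst (fst z))) (snd (fst z)) j)" for j
    by (intro continuous_on_sec continuous_on_compose2[OF B(1)] continuous_intros) auto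
  then have Yc: "continuous_on ((L \<times> ?I) \<times> UNIV)
      (\<lambda>z. sec_transport (B (fst (fst z))) (snd (fst z)) (snd z))"
    unfolding sec_transport_def sec_coeff_def
    by (intro continuous_on_sum continuous_on_scl continuous_on_divide continuous_on_diff
        continuous_on_mult continuous_on_lookup continuous_intros) auto
  obtain X where X:
    "continuous_on ((K \<times> ?I) \<times> UNIV) (\<lambda>z. X (fst (fst z)) (snd (fst z)) (snd z))"
    and X_lin: "\<And>k t. k \<in> K \<Longrightarrow> t \<in> ?I \<Longrightarrow> clin (X k t)"
    and X_in: "\<And>k t v. k \<in> K \<Longrightarrow> t \<in> ?I \<Longrightarrow> X k t v \<in> F k t"
    and X_nz: "\<And>k t v. k \<in> K \<Longrightarrow> t \<in> ?I \<Longrightarrow> v \<in> F k 0 \<Longrightarrow> v \<noteq> 0 \<Longrightarrow> X k t v \<noteq> 0"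
    and X_L: "\<And>l t v. l \<in> L \<Longrightarrow> t \<in> ?I \<Longrightarrow> v \<in> F l 0 \<Longrightarrow> X l t v = sec_transport (B l) t v"
    and X_fx: "\<And>k t v. fx \<Longrightarrow> k \<in> K \<Longrightarrow> t \<in> ?I \<Longrightarrow> X k (-t) (cinf_cnj v) = cinf_cnj (X k t v)"
  proof (rule lift_operators[OF L Yc, where fx = fx])
    fix l t v assume l: "l \<in> L" and t: "t \<in> ?I" and v: "v \<in> F l 0"
    obtain c where c: "v = (\<Sum>j\<in>UNIV. c j \<cdot> sec (B l) 0 j)" using rep[OF l v] by blast
    show "sec_transport (B l) t v \<in> F l t"
      unfolding c sec_transport_combination F_L[OF l t] by (rule sum_in_span_family) simp
    show "sec_transport (B l) t v \<noteq> 0" if "v \<noteq> 0"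
    proof
      assume "sec_transport (B l) t v = 0"
      then have "c j = 0" for j
        using lindepD[OF lindep_sec[OF B(2)[OF l] t]] unfolding c sec_transport_combination by blast
      then show False using that c by simp
    qed
  next
    fix l v assume l: "l \<in> L" and v: "v \<in> F l 0"
    obtain c where c: "v = (\<Sum>j\<in>UNIV. c j \<cdot> sec (B l) 0 j)" using rep[OF l v] by blast
    show "sec_transport (B l) 0 v = v" unfolding c sec_transport_combination ..
  next
    fix l t v assume fx: fx and l: "l \<in> L" and v: "v \<in> F l 0"
    show "sec_transport (B l) (-t) (cinf_cnj v) = cinf_cnj (sec_transport (B l) t v)"
      using v unfolding F_L[OF l zero_I] by (rule sec_transport_cnj[OF B(3)[OF fx l]])
  qed (use Ffx in \<open>simp_all add: clin_sec_transport\<close>)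
  obtain Z where Z: "continuous_on (K \<times> UNIV) (\<lambda>z. Z (fst z) (snd z))"
    and Z_lin: "\<And>k. k \<in> K \<Longrightarrow> clin (Z k)"
    and Z_in: "\<And>k v. k \<in> K \<Longrightarrow> Z k v \<in> F k 0"
    and Z_nz: "\<And>k v. k \<in> K \<Longrightarrow> v \<in> F k (-1) \<Longrightarrow> v \<noteq> 0 \<Longrightarrow> Z k v \<noteq> 0"
    using transport_to_center by blast
  define zb where "zb k i = Z k (bv 0 i)" for k and i :: 'n
  have Xc: "continuous_on S (\<lambda>x. X (a x) (b x) (v x))"
    if "continuous_on S a" "continuous_on S b" "continuous_on S v"
      "\<And>x. x \<in> S \<Longrightarrow> a x \<in> K" "\<And>x. x \<in> S \<Longrightarrow> b x \<in> ?I"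
    for S :: "'s::topological_space set" and a b v
    using that by (rule continuous_on_joint_compose[OF X])
  have zb_c: "continuous_on K (\<lambda>k. zb k i)" for i
  proof -
    have 1: "continuous_on K (\<lambda>k. (k, bv 0 i :: cinf))" by (intro continuous_intros)
    have 2: "(\<lambda>k. (k, bv 0 i :: cinf)) ` K \<subseteq> K \<times> UNIV" by auto
    show ?thesis using continuous_on_compose2[OF Z 1 2] by (simp add: zb_def)
  qed
  have lindep_zb: "lindep UNIV (zb k)" if k: "k \<in> K" for k
    unfolding zb_def
    by (rule lindep_clin[OF Z_lin[OF k] lindep_bv]) (use Z_nz[OF k] in \<open>auto simp: F_ends[OF k] span_bv\<close>)
  have lindep_X: "lindep UNIV (\<lambda>i. X k t (f i))"
    if k: "k \<in> K" and t: "t \<in> ?I" and f: "lindep UNIV f" "\<And>i. f i \<in> F k 0" for k t and f :: "'n \<Rightarrow> cinf"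
  proof (rule lindep_clin[OF X_lin[OF k t] f(1)])
    have "cinf.span (range f) \<subseteq> F k 0"
      using f(2) F_subspace[OF k zero_I] by (intro cinf.span_minimal) auto
    then show "v = 0" if "v \<in> cinf.span (range f)" "X k t v = 0" for v
      using that X_nz[OF k t] by blast
  qed
  have expand: "f = mulm (bv 0) (\<chi> i j. coord (f j) (idx i))"
    if "\<And>j. f j \<in> cfin ?n" for f :: "'n \<Rightarrow> cinf"
    using cfin_expand_bv[OF that] by (simp add: fun_eq_iff mulm_def)
  define M :: "'k \<Rightarrow> complex ^ 'n ^ 'n" where "M k = (\<chi> i j. coord (X k (-1) (zb k j)) (idx i))" for k
  have zb_in: "zb k i \<in> F k 0" if "k \<in> K" for k i
    unfolding zb_def using that by (rule Z_in)
  have M: "(\<lambda>j. X k (-1) (zb k j)) = mulm (bv 0) (M k)" if k: "k \<in> K" for k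
    unfolding M_def using X_in[OF k end_I(1)] F_ends[OF k] by (intro expand) simp
  have M_inv: "invertible (M k)" if k: "k \<in> K" for k
    using lindep_X[OF k end_I(1) lindep_zb[OF k] zb_in[OF k]] unfolding M[OF k]
    by (rule lindep_mulm_imp_invertible)
  have M_c: "continuous_on K M"
    unfolding M_def
    by (intro continuous_on_vec_lambda continuous_on_lookup Xc zb_c continuous_intros) auto
  define y where "y k = mulm (zb k) (matrix_inv (M k))" for k
  have y_c: "continuous_on K (\<lambda>k. y k j)" for j
    unfolding y_def by (intro continuous_on_mulm zb_c continuous_on_matrix_inv M_c M_inv)
  have y_in: "y k j \<in> F k 0" if k: "k \<in> K" for k j
    unfolding y_def mulm_def
    by (intro cinf.subspace_sum cinf.subspace_scale F_subspace[OF k zero_I] zb_in[OF k])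
  have Minv_inv: "invertible (matrix_inv (M k))" if k: "k \<in> K" for k
    using matrix_inv_props[OF M_inv[OF k]] unfolding invertible_def by blast
  have lindep_y: "lindep UNIV (y k)" if k: "k \<in> K" for k
    unfolding y_def by (rule lindep_mulm[OF lindep_zb[OF k] Minv_inv[OF k]])
  define h where "h k t j = X k t (y k j)" for k t j
  define A :: "'k \<Rightarrow> complex ^ 'n ^ 'n" where "A k = (\<chi> i j. coord (h k 1 j) (idx i))" for k
  have h_start: "h k (-1) = bv 0" if k: "k \<in> K" for k
  proof -
    have "h k (-1) = mulm (\<lambda>i. X k (-1) (zb k i)) (matrix_inv (M k))"
      by (simp add: fun_eq_iff h_def y_def clin_mulm[OF X_lin[OF k end_I(1)]])
    then show ?thesis
      unfolding M[OF k] by (simp add: mulm_mulm matrix_inv_props[OF M_inv[OF k]] mulm_one)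
  qed
  have h_end: "h k 1 = mulm (bv 0) (A k)" if k: "k \<in> K" for k
    unfolding A_def using X_in[OF k end_I(2)] F_ends[OF k] by (intro expand) (simp add: h_def)
  have h_lindep: "lindep UNIV (h k t)" if k: "k \<in> K" and t: "t \<in> ?I" for k t
    using lindep_X[OF k t lindep_y[OF k] y_in[OF k]] by (simp add: h_def[abs_def])
  have h_in: "h k t j \<in> F k t" if "k \<in> K" "t \<in> ?I" for k t j
    unfolding h_def using that by (rule X_in)
  have h_span: "cinf.span (range (h k t)) = F k t" if "k \<in> K" "t \<in> ?I" for k t
    using F_gr[OF that] h_lindep[OF that] h_in[OF that] by (intro lindep_spans[of _ ?n]) (auto simp: Suc_leI)
  have h_c: "continuous_on (K \<times> ?I) (\<lambda>z. h (fst z) (snd z) j)" for j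
    unfolding h_def
    by (intro Xc continuous_on_compose2[OF y_c] continuous_intros) auto
  have A_c: "continuous_on K A"
    unfolding A_def h_def
    by (intro continuous_on_vec_lambda continuous_on_lookup Xc y_c continuous_intros) auto
  have h_fx: "h k (-t) = mulm (\<lambda>i. cinf_cnj (h k t i)) (A k)" if fx: fx and k: "k \<in> K" and t: "t \<in> ?I" for k t
  proof
    fix j
    have mt: "-t \<in> ?I" using t by auto
    have cnj_in: "cinf_cnj (y k i) \<in> F k 0" for i
      using y_in[OF k, of i] Ffx[OF fx k, of 0] by auto
    \<comment> \<open>The frame \<open>y k\<close> and its conjugate times \<open>A k\<close> have
      the same image under \<open>X k 1\<close>, which is injective on \<open>F k 0\<close>. So they
      agree, and the symmetry for all \<open>t\<close> is inherited from \<open>X\<close>.\<close>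
    let ?w = "mulm (\<lambda>i. cinf_cnj (y k i)) (A k) j"
    have w_in: "?w \<in> F k 0"
      unfolding mulm_def by (intro cinf.subspace_sum cinf.subspace_scale F_subspace[OF k zero_I] cnj_in)
    have "X k 1 (cinf_cnj (y k i)) = bv 0 i" for i
      using X_fx[OF fx k end_I(1), of "y k i"] fun_cong[OF h_start[OF k], of i]
      by (simp add: h_def cinf_cnj_bv)
    then have "X k 1 ?w = mulm (bv 0) (A k) j" by (simp add: clin_mulm[OF X_lin[OF k end_I(2)]])
    also have "\<dots> = X k 1 (y k j)" using fun_cong[OF h_end[OF k], of j] by (simp add: h_def)
    finally have eq: "X k 1 ?w = X k 1 (y k j)" .
    have "X k 1 (?w - y k j + y k j) = X k 1 (?w - y k j) + X k 1 (y k j)"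
      by (rule clin_add[OF X_lin[OF k end_I(2)]])
    then have "X k 1 (?w - y k j) = 0" using eq by simp
    moreover have "?w - y k j \<in> F k 0"
      using F_subspace[OF k zero_I] w_in y_in[OF k] by (rule cinf.subspace_diff)
    ultimately have "?w - y k j = 0" using X_nz[OF k end_I(2)] by blast
    then have "y k j = ?w" by simp
    then have "h k (-t) j = X k (-t) ?w" by (simp add: h_def)
    also have "\<dots> = mulm (\<lambda>i. X k (-t) (cinf_cnj (y k i))) (A k) j"
      by (rule clin_mulm[OF X_lin[OF k mt]])
    also have "\<dots> = mulm (\<lambda>i. cinf_cnj (h k t i)) (A k) j"
      by (simp add: X_fx[OF fx k t] h_def)
    finally show "h k (-t) j = mulm (\<lambda>i. cinf_cnj (h k t i)) (A k) j" .
  qed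
  have good: "good_family fx K h A"
    unfolding good_family_def
  proof (intro conjI ballI allI impI)
    show "\<exists>N. \<forall>k\<in>K. \<forall>t\<in>?I. \<forall>j. h k t j \<in> cfin N"
      using h_in bound by (intro exI[of _ N]) blast
  qed (simp_all add: h_c h_lindep h_start h_end h_fx)
  \<comment> \<open>Over \<open>L\<close> transport keeps coefficients with respect to
    \<open>sec (B l)\<close>. At -1 both frames are standard, so the coefficient matrix is the
    identity there, hence for all \<open>t\<close>.\<close>
  have h_L: "h l t = sec (B l) t" if l: "l \<in> L" and t: "t \<in> ?I" for l t
  proof
    fix j
    have k: "l \<in> K" using l L(2) by auto
    obtain c where c: "y l j = (\<Sum>i\<in>UNIV. c i \<cdot> sec (B l) 0 i)" using rep[OF l y_in[OF k]] by blast
    have X_y: "X l t (y l j) = (\<Sum>i\<in>UNIV. c i \<cdot> sec (B l) t i)" if "t \<in> ?I" for t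
      using X_L[OF l that y_in[OF k], of j] unfolding c sec_transport_combination .
    have "bv 0 j = (\<Sum>i\<in>UNIV. c i \<cdot> (bv 0 i :: cinf))"
      using X_y[OF end_I(1)] fun_cong[OF h_start[OF k], of j] by (simp add: h_def sec_ends)
    then have "(\<Sum>i\<in>UNIV. (c i - (if i = j then 1 else 0)) \<cdot> (bv 0 i :: cinf)) = 0"
      by (simp add: cinf.scale_left_diff_distrib sum_subtractf if_distrib[of "\<lambda>c. c \<cdot> _"] cong: if_cong)
    then have "c i - (if i = j then 1 else 0) = 0" for i by (rule lindepD[OF lindep_bv]) simp
    then have "c = (\<lambda>i. if i = j then 1 else 0)" by (simp add: fun_eq_iff)
    then show "h l t j = sec (B l) t j"
      using X_y[OF t] by (simp add: h_def if_distrib[of "\<lambda>c. c \<cdot> _"] cong: if_cong)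
  qed
  show thesis
  proof (rule that[OF good A_c _ h_L])
    show "frame_loop (h k) = \<alpha> k" if k: "k \<in> K" for k
    proof
      fix s
      have u: "uncompactify s \<in> ?I" by (rule uncompactify_bounds)
      have "frame_loop (h k) s = F k (uncompactify s)"
        unfolding frame_loop_def loop_of_def using h_span[OF k u] by simp
      then show "frame_loop (h k) s = \<alpha> k s" by (simp add: F_def compactify_uncompactify)
    qed
    show "A l = B l" if l: "l \<in> L" for l
      using h_end[of l] h_L[OF l end_I(2)] l L(2) by (auto simp: sec_ends mulm_inject[OF lindep_bv])
  qed
qed

section \<open>Homotopies of families of frames\<close>

lemma good_family_homotopic:
  fixes G :: "real \<Rightarrow> 'k::topological_space \<Rightarrow> real \<Rightarrow> 'n::finite \<Rightarrow> cinf"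
  assumes good: "good_family fx ({0..1} \<times> K) (\<lambda>p. G (fst p) (snd p)) A"
    and L: "\<And>u l. u \<in> {0..1} \<Longrightarrow> l \<in> L \<Longrightarrow> frame_loop (G u l) = \<alpha> l"
  shows "homotopic_with (\<lambda>f. \<forall>l\<in>L. f l = \<alpha> l) (top_of_set K) (Omega_fx fx CARD('n))
           (\<lambda>k. frame_loop (G 0 k)) (\<lambda>k. frame_loop (G 1 k))"
  unfolding homotopic_with_def
proof (intro exI conjI allI ballI)
  show "continuous_map (prod_topology (top_of_set {0..1}) (top_of_set K)) (Omega_fx fx CARD('n))
      (\<lambda>p. frame_loop (G (fst p) (snd p)))"
    using good_family_map[OF good] by simp
qed (simp_all add: L)

lemma cfin_mono_mem: "v \<in> cfin m \<Longrightarrow> m \<le> m' \<Longrightarrow> v \<in> cfin m'"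
  using cfin_mono by blast

text \<open>The linear homotopy from \<open>h\<close> to \<open>sec A\<close> may degenerate. Adding a multiple of \<open>kappa N' A\<close> in
  coordinates \<open>\<ge> N'\<close>, which nothing else uses, restores independence.\<close>

lemma good_family_homotopic_sec:
  fixes K :: "'k::metric_space set" and h :: "'k \<Rightarrow> real \<Rightarrow> 'n::finite \<Rightarrow> cinf"
  assumes good: "good_family fx K h A" and A: "continuous_on K A"
    and L: "closed L" "L \<subseteq> K"
    and hL: "\<And>l t. l \<in> L \<Longrightarrow> t \<in> {-1..1} \<Longrightarrow> h l t = sec (A l) t"
  shows "homotopic_with (\<lambda>f. \<forall>l\<in>L. f l = frame_loop (h l)) (top_of_set K) (Omega_fx fx CARD('n))
           (\<lambda>k. frame_loop (h k)) (\<lambda>k. frame_loop (sec (A k)))"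
proof -
  let ?I = "{-1..1::real}"
  obtain N where N: "\<And>k t j. k \<in> K \<Longrightarrow> t \<in> ?I \<Longrightarrow> h k t j \<in> cfin N"
    using good_familyD(1)[OF good] by blast
  note c = good_familyD(2)[OF good] and li = good_familyD(3)[OF good]
    and ends = good_familyD(4,5)[OF good] and hfx = good_familyD(6)[OF good]
    and inv = good_family_invertible[OF good]
  have real: "mcnj (A k) ** A k = mat 1" if fx "k \<in> K" for k
    using good_family_real[of K h A k] good that by simp
  define N' where "N' = max N (3 * CARD('n))"
  \<comment> \<open>\<open>infdist\<close> from the empty set is 0, hence the separate value
    1.\<close>
  define \<eta> where "\<eta> k = (if L = {} then 1 else infdist k L)" for k
  have \<eta>_0: "\<eta> k = 0 \<longleftrightarrow> k \<in> L" for k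
    using in_closed_iff_infdist_zero[OF L(1)] by (auto simp: \<eta>_def)
  have \<eta>_c: "continuous_on S \<eta>" for S
    unfolding \<eta>_def by (cases "L = {}") (auto intro!: continuous_intros)
  \<comment> \<open>This vanishes only where the linear homotopy is independent anyway: at its two
    ends, at \<open>t = -1\<close> and \<open>t = 1\<close>, and over \<open>L\<close>, where both
    frames agree. It is even in \<open>t\<close>, which keeps the symmetry.\<close>
  define d where "d u k t = u * (1 - u) * (1 - t\<^sup>2) * \<eta> k" for u k t
  define G where "G u k t j = complex_of_real (1 - u) \<cdot> h k t j + complex_of_real u \<cdot> sec (A k) t j +
      complex_of_real (d u k t) \<cdot> kappa N' (A k) j" for u k t j
  have same: "complex_of_real (1 - u) \<cdot> v + complex_of_real u \<cdot> v = v" for u v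
    by (simp flip: cinf.scale_left_distrib)
  have G_same: "G u k t = sec (A k) t" if "h k t = sec (A k) t" "d u k t = 0" for u k t
    using that same by (simp add: G_def fun_eq_iff)
  have G_0: "G 0 k t = h k t" and G_1: "G 1 k t = sec (A k) t" for k t
    by (simp_all add: G_def d_def fun_eq_iff)
  have ends_sec: "h k t = sec (A k) t" if "k \<in> K" "t = -1 \<or> t = 1" for k t
    using ends[OF that(1)] that(2) by (auto simp: sec_ends)
  have d_ends: "d u k t = 0" if "t = -1 \<or> t = 1" for u k t using that by (auto simp: d_def)
  have "good_family fx ({0..1} \<times> K) (\<lambda>p. G (fst p) (snd p)) (\<lambda>p. A (snd p))"
    unfolding good_family_def
  proof (intro conjI ballI allI impI)
    show "\<exists>N. \<forall>p\<in>{0..1} \<times> K. \<forall>t\<in>?I. \<forall>j. G (fst p) (snd p) t j \<in> cfin N"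
    proof (intro exI[of _ "N' + 2 * CARD('n)"] ballI allI)
      fix p t j assume p: "p \<in> {0..1::real} \<times> K" and t: "t \<in> ?I"
      have 1: "h (snd p) t j \<in> cfin (N' + 2 * CARD('n))"
        by (rule cfin_mono_mem[OF N]) (use p t in \<open>auto simp: N'_def\<close>)
      have 2: "sec (A (snd p)) t j \<in> cfin (N' + 2 * CARD('n))"
        by (rule cfin_mono_mem[OF sec_cfin]) (simp add: N'_def)
      show "G (fst p) (snd p) t j \<in> cfin (N' + 2 * CARD('n))"
        unfolding G_def using 1 2 kappa_cfin[of N' "A (snd p)" j]
        by (intro cinf.subspace_add cinf.subspace_scale cfin_subspace)
    qed
    fix j
    let ?S = "(({0..1::real} \<times> K) \<times> ?I)"
    have 1: "continuous_on ?S (\<lambda>z. h (snd (fst z)) (snd z) j)"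
    proof -
      have "continuous_on ?S (\<lambda>z. (snd (fst z), snd z))" by (intro continuous_intros)
      moreover have "(\<lambda>z. (snd (fst z), snd z)) ` ?S \<subseteq> K \<times> ?I" by auto
      ultimately show ?thesis using continuous_on_compose2[OF c, of ?S "\<lambda>z. (snd (fst z), snd z)"] by simp
    qed
    have 2: "continuous_on ?S (\<lambda>z. A (snd (fst z)))"
      by (rule continuous_on_compose2[OF A]) (auto intro!: continuous_intros)
    have 3: "continuous_on ?S (\<lambda>z. \<eta> (snd (fst z)))"
      by (rule continuous_on_compose2[OF \<eta>_c]) (auto intro!: continuous_intros)
    show "continuous_on ?S (\<lambda>z. G (fst (fst z)) (snd (fst z)) (snd z) j)"
      unfolding G_def d_def
      by (intro continuous_on_add continuous_on_scl continuous_on_kappa continuous_on_sec 1 2 3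
          continuous_intros)
  next
    fix p t assume p: "p \<in> {0..1::real} \<times> K" and t: "t \<in> ?I"
    let ?u = "fst p" and ?k = "snd p"
    have k: "?k \<in> K" using p by auto
    consider "?u = 0" | "?u = 1" | "t = -1 \<or> t = 1" | "?k \<in> L" | "d ?u ?k t \<noteq> 0"
      by (auto simp: d_def \<eta>_0 power2_eq_1_iff)
    then show "lindep UNIV (G ?u ?k t)"
    proof cases
      case 1 then show ?thesis by (simp add: G_0 li[OF k t])
    next
      case 2 then show ?thesis by (simp add: G_1 lindep_sec[OF inv[OF k] t])
    next
      case 3 then show ?thesis
        by (simp add: G_same ends_sec[OF k] d_ends lindep_sec[OF inv[OF k] t])
    next
      case 4 then show ?thesis
        using G_same[OF hL[OF 4 t]] \<eta>_0 lindep_sec[OF inv[OF k] t] by (simp add: d_def)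
    next
      case 5
      have "h ?k t j \<in> cfin N'" for j by (rule cfin_mono_mem[OF N[OF k t]]) (simp add: N'_def)
      moreover have "sec (A ?k) t j \<in> cfin N'" for j by (rule cfin_mono_mem[OF sec_cfin]) (simp add: N'_def)
      ultimately show ?thesis
        unfolding G_def[abs_def] using 5
        by (intro lindep_add_kappa cinf.subspace_add cinf.subspace_scale cfin_subspace) auto
    qed
  next
    fix p assume p: "p \<in> {0..1::real} \<times> K"
    then have k: "snd p \<in> K" by auto
    show "G (fst p) (snd p) (-1) = bv 0" "G (fst p) (snd p) 1 = mulm (bv 0) (A (snd p))"
      by (simp_all add: G_same ends_sec[OF k] d_ends sec_ends)
  next
    fix p t assume fx: fx and p: "p \<in> {0..1::real} \<times> K" and t: "t \<in> ?I"
    let ?u = "fst p" and ?k = "snd p"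
    have k: "?k \<in> K" using p by auto
    show "G ?u ?k (-t) = mulm (\<lambda>i. cinf_cnj (G ?u ?k t i)) (A ?k)"
    proof
      fix j
      have cnj: "cinf_cnj (G ?u ?k t i) = complex_of_real (1 - ?u) \<cdot> cinf_cnj (h ?k t i) +
          complex_of_real ?u \<cdot> cinf_cnj (sec (A ?k) t i) +
          complex_of_real (d ?u ?k t) \<cdot> cinf_cnj (kappa N' (A ?k) i)" for i
        by (simp add: G_def cinf_cnj_add cinf_cnj_scl)
      have "d ?u ?k (-t) = d ?u ?k t" by (simp add: d_def)
      then show "G ?u ?k (-t) j = mulm (\<lambda>i. cinf_cnj (G ?u ?k t i)) (A ?k) j"
        unfolding cnj mulm_add mulm_scl
        using hfx[OF fx k t] cnj_sec[OF real[OF fx k], of t] cnj_kappa[OF real[OF fx k], of N']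
        by (simp add: G_def)
    qed
  qed
  moreover have "frame_loop (G u l) = frame_loop (h l)" if u: "u \<in> {0..1}" and l: "l \<in> L" for u l
  proof -
    have "G u l t = h l t" if "t \<in> ?I" for t
      using G_same[OF hL[OF l that]] hL[OF l that] \<eta>_0 l by (simp add: d_def)
    then show ?thesis
      using uncompactify_bounds by (simp add: frame_loop_def loop_of_def fun_eq_iff)
  qed
  ultimately have "homotopic_with (\<lambda>f. \<forall>l\<in>L. f l = frame_loop (h l)) (top_of_set K) (Omega_fx fx CARD('n))
           (\<lambda>k. frame_loop (G 0 k)) (\<lambda>k. frame_loop (G 1 k))"
    by (rule good_family_homotopic)
  moreover have "G 0 k = h k" "G 1 k = sec (A k)" for k by (simp_all add: fun_eq_iff G_0 G_1)
  ultimately show ?thesis by simp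
qed

section \<open>Deforming invertible matrices to unitary ones\<close>

definition adj :: "complex ^ 'n ^ 'n \<Rightarrow> complex ^ 'n ^ 'n" where
  "adj A = mcnj (transpose A)"

lemma adj_nth [simp]: "adj A $ i $ j = cnj (A $ j $ i)"
  by (simp add: adj_def transpose_def)

lemma adj_mult: "adj (A ** B) = adj B ** adj A"
  by (simp add: adj_def matrix_transpose_mul mcnj_mult)

lemma adj_one [simp]: "adj (mat 1) = mat 1"
  by (simp add: adj_def)

lemma adj_mcnj: "adj (mcnj A) = mcnj (adj A)"
  by (simp add: vec_eq_iff)

lemma unitary_matrices_iff: "A \<in> unitary_matrices \<longleftrightarrow> adj A ** A = mat 1"
proof -
  have "map_matrix cnj (transpose A) = adj A" by (simp add: vec_eq_iff transpose_def)
  then show ?thesis unfolding unitary_matrices_def using matrix_left_right_inverse by auto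
qed

lemma matrix_inv_eqI:
  fixes A B :: "complex ^ 'n ^ 'n"
  assumes "B ** A = mat 1"
  shows "invertible A" "matrix_inv A = B"
proof -
  show inv: "invertible A" using assms by (auto simp: invertible_left_inverse)
  have "matrix_inv A = (B ** A) ** matrix_inv A" by (simp add: assms)
  also have "\<dots> = B" by (simp add: matrix_inv_props[OF inv] flip: matrix_mul_assoc)
  finally show "matrix_inv A = B" .
qed

text \<open>For invertible \<open>A\<close> let \<open>Q\<^sub>A = (1 + (A A\<^sup>*)\<^sup>-\<^sup>1) / 2\<close>, the Gram matrix of \<open>stack A\<close>, and let
  \<open>A'\<close> be the conjugate of \<open>A\<^sup>-\<^sup>1\<close>. Then \<open>A\<^sup>* Q\<^sub>A A\<close> is the conjugate of \<open>Q\<^sub>A\<^sub>'\<close>, so a matrix \<open>C\<^sub>A\<close> with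
  \<open>C\<^sub>A\<^sup>* Q\<^sub>A C\<^sub>A = 1\<close> makes \<open>C\<^sub>A\<^sup>-\<^sup>1 A\<close> times the conjugate of \<open>C\<^sub>A\<^sub>'\<close> unitary. Gram-Schmidt provides a
  triangular \<open>C\<^sub>A\<close>, which is connected to \<open>1\<close> by a segment. If \<open>A' = A\<close>, the product keeps this
  property.\<close>

definition stack :: "complex ^ 'n ^ 'n \<Rightarrow> 'n \<Rightarrow> cinf" where
  "stack A j = complex_of_real (1 / sqrt 2) \<cdot> (bv 0 j + mulm (bv CARD('n)) (matrix_inv A) j)"

text \<open>The factor 1/2 makes this the identity for unitary \<open>A\<close>, so that the
  deformation is stationary on unitary matrices.\<close>

definition gram :: "complex ^ 'n ^ 'n \<Rightarrow> complex ^ 'n ^ 'n" where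
  "gram A = (\<chi> i j. (mat 1 + adj (matrix_inv A) ** matrix_inv A) $ i $ j / 2)"

lemma hip_mulm_bv:
  "hip (mulm (bv c) X j) (mulm (bv c) Y i) = (adj Y ** X) $ i $ j"
proof -
  have b: "hip (bv c k) (bv c l) = (if k = l then 1 else 0)" for k l :: 'a
  proof -
    have "Poly_Mapping.keys (bv c k) \<subseteq> {c + idx k}" by (auto simp: bv_def bvec_def split: if_splits)
    then have "hip (bv c k) (bv c l) = (\<Sum>i\<in>{c + idx k}. coord (bv c k) i * cnj (coord (bv c l) i))"
      by (intro hip_eq) auto
    then show ?thesis by (auto simp: bv_def lookup_bvec)
  qed
  have "hip (mulm (bv c) X j) (mulm (bv c) Y i) =
      (\<Sum>k\<in>UNIV. \<Sum>l\<in>UNIV. X $ k $ j * (cnj (Y $ l $ i) * (if k = l then 1 else 0)))"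
    unfolding mulm_def hip_sum_left hip_scl_left
    unfolding hip_sum_right hip_scl_right b sum_distrib_left by (rule refl)
  also have "\<dots> = (\<Sum>k\<in>UNIV. X $ k $ j * cnj (Y $ k $ i))"
    by (simp add: if_distrib[of "\<lambda>x. _ * x"] cong: if_cong)
  also have "\<dots> = (adj Y ** X) $ i $ j" by (simp add: matrix_matrix_mult_def mult.commute)
  finally show ?thesis .
qed

lemma hip_mulm_bv_disjoint:
  "c + CARD('n) \<le> c' \<Longrightarrow> hip (mulm (bv c) (X :: complex ^ 'n ^ 'n) j) (mulm (bv c') (Y :: complex ^ 'n ^ 'n) i) = 0"
  unfolding hip_def
proof (intro sum.neutral ballI)
  fix k assume c: "c + CARD('n) \<le> c'"
  show "coord (mulm (bv c) X j) k * cnj (coord (mulm (bv c') Y i) k) = 0"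
    using lookup_mulm_bv_zero[of k c X j] lookup_mulm_bv_zero[of k c' Y i] c by (cases "k < c'") auto
qed

lemma hip_stack: "hip (stack A j) (stack A i) = gram A $ i $ j"
proof -
  have st: "stack A k = complex_of_real (1 / sqrt 2) \<cdot>
      (mulm (bv 0) (mat 1) k + mulm (bv CARD('a)) (matrix_inv A) k)" for k
    by (simp add: stack_def mulm_one)
  have s: "complex_of_real (1 / sqrt 2) * complex_of_real (1 / sqrt 2) = 1 / 2"
    by (simp flip: of_real_mult)
  have z: "hip (mulm (bv 0) (mat 1) j) (mulm (bv CARD('a)) (matrix_inv A) i) = 0"
    "hip (mulm (bv CARD('a)) (matrix_inv A) j) (mulm (bv 0) (mat 1) i) = 0"
    using hip_mulm_bv_disjoint[of 0 "CARD('a)" "mat 1" j "matrix_inv A" i]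
      hip_mulm_bv_disjoint[of 0 "CARD('a)" "mat 1" i "matrix_inv A" j]
      hip_cnj[of "mulm (bv 0) (mat 1) i" "mulm (bv CARD('a)) (matrix_inv A) j"] by auto
  have "hip (stack A j) (stack A i) = complex_of_real (1 / sqrt 2) * complex_of_real (1 / sqrt 2) *
      ((adj (mat 1) ** mat 1) $ i $ j + (adj (matrix_inv A) ** matrix_inv A) $ i $ j)"
    unfolding st
    by (simp only: hip_scl_left hip_scl_right hip_add_left hip_add_right z hip_mulm_bv
        complex_cnj_complex_of_real add_0_left add_0_right mult.assoc distrib_left)
  then show ?thesis unfolding s by (simp add: gram_def)
qed

lemma lookup_stack:
  "coord (stack A j) (idx i) = complex_of_real (1 / sqrt 2) * (if j = i then 1 else 0)"
  for A :: "complex ^ 'n ^ 'n"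
  using lookup_mulm_bv_zero[of "idx i" "CARD('n)" "matrix_inv A" j] idx_less[of i]
  by (simp add: stack_def lookup_add bv_def lookup_bvec)

text \<open>The first block of \<open>stack A\<close> is a multiple of the identity, so coefficients
  can be read off from coordinates. This explains the factor \<open>sqrt 2\<close> in
  \<open>chol\<close>.\<close>

lemma lookup_stack_combination:
  "coord (\<Sum>j\<in>UNIV. c j \<cdot> stack A j) (idx i) = complex_of_real (1 / sqrt 2) * c i"
proof -
  have "coord (\<Sum>j\<in>UNIV. c j \<cdot> stack A j) (idx i) =
      complex_of_real (1 / sqrt 2) * (\<Sum>j\<in>UNIV. if j = i then c j else 0)"
    unfolding lookup_sum_cinf sum_distrib_left by (intro sum.cong) (auto simp: lookup_stack)
  then show ?thesis by simp
qed

lemma lindep_stack: "lindep UNIV (stack A)"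
proof (rule lindepI)
  fix c i assume "(\<Sum>j\<in>UNIV. c j \<cdot> stack A j) = 0"
  then show "c i = 0" using lookup_stack_combination[of c A i] by simp
qed

definition gs_stack :: "complex ^ 'n ^ 'n \<Rightarrow> 'n \<Rightarrow> cinf" where
  "gs_stack A j = gram_schmidt (\<lambda>k. stack A (unidx k)) (idx j)"

definition chol :: "complex ^ 'n ^ 'n \<Rightarrow> complex ^ 'n ^ 'n" where
  "chol A = (\<chi> i j. complex_of_real (sqrt 2) * coord (gs_stack A j) (idx i))"

lemma gs_stack_chol: "gs_stack A = mulm (stack A) (chol (A :: complex ^ 'n ^ 'n))"
proof
  fix j
  let ?f = "\<lambda>k. stack A (unidx k)"
  have li: "lindep {..<CARD('n)} ?f" using lindep_stack by (simp add: lindep_reindex[OF bij_betw_unidx])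
  have "gs_stack A j \<in> cinf.span (gram_schmidt ?f ` {..<CARD('n)})"
    unfolding gs_stack_def using idx_less[of j] by (intro cinf.span_base) auto
  then have "gs_stack A j \<in> cinf.span (range (stack A))"
    unfolding gram_schmidt_span[OF li] image_unidx .
  then obtain c where c: "gs_stack A j = (\<Sum>i\<in>UNIV. c i \<cdot> stack A i)" using in_span_range by blast
  have "chol A $ i $ j = c i" for i
    by (simp add: chol_def c lookup_stack_combination)
  then show "gs_stack A j = mulm (stack A) (chol A) j" unfolding c mulm_def by simp
qed

lemma hip_gs_stack: "hip (gs_stack A j) (gs_stack A i) = (if i = j then 1 else 0)"
proof -
  have "orthonormal CARD('a) (gram_schmidt (\<lambda>k. stack A (unidx k)))"
    using lindep_stack[of A] by (intro gram_schmidt_orthonormal) (simp add: lindep_reindex[OF bij_betw_unidx])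
  then show ?thesis using idx_less[of i] idx_less[of j] by (auto simp: orthonormal_def gs_stack_def)
qed

lemma chol_gram: "adj (chol A) ** gram A ** chol A = mat 1"
proof -
  have "(adj (chol A) ** gram A ** chol A) $ i $ j = mat 1 $ i $ j" for i j
  proof -
    have "(adj (chol A) ** gram A ** chol A) $ i $ j =
        (\<Sum>k\<in>UNIV. \<Sum>l\<in>UNIV. chol A $ k $ j * (cnj (chol A $ l $ i) * gram A $ l $ k))"
      by (simp add: matrix_matrix_mult_def sum_distrib_right sum_distrib_left mult_ac)
    also have "\<dots> = hip (gs_stack A j) (gs_stack A i)"
      unfolding gs_stack_chol mulm_def hip_sum_left hip_scl_left
      unfolding hip_sum_right hip_scl_right hip_stack sum_distrib_left by (rule refl)
    finally show ?thesis by (simp add: hip_gs_stack mat_def)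
  qed
  then show ?thesis by (simp add: vec_eq_iff)
qed

definition chol_path :: "real \<Rightarrow> complex ^ 'n ^ 'n \<Rightarrow> complex ^ 'n ^ 'n" where
  "chol_path u A = (\<chi> i j. complex_of_real (1 - u) * mat 1 $ i $ j + complex_of_real u * chol A $ i $ j)"

text \<open>Applied to \<open>stack A\<close>, the path of matrices becomes the segment from that
  frame to its orthonormalisation, which stays independent.\<close>

lemma invertible_chol_path:
  fixes A :: "complex ^ 'n ^ 'n"
  assumes "u \<in> {0..1}"
  shows "invertible (chol_path u A)"
proof -
  let ?f = "\<lambda>k. stack A (unidx k)"
  have eq: "complex_of_real (1 - u) \<cdot> ?f k + complex_of_real u \<cdot> gram_schmidt ?f k =
      mulm (stack A) (chol_path u A) (unidx k)" if kn: "k < CARD('n)" for k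
  proof -
    from idx_surj[OF kn] obtain j :: 'n where k: "k = idx j" ..
    have "mulm (stack A) (chol_path u A) j =
        complex_of_real (1 - u) \<cdot> mulm (stack A) (mat 1) j + complex_of_real u \<cdot> mulm (stack A) (chol A) j"
      unfolding mulm_def cinf.scale_sum_right
      by (simp add: chol_path_def cinf.scale_left_distrib sum.distrib)
    then show ?thesis unfolding k by (simp add: mulm_one gs_stack_def flip: gs_stack_chol)
  qed
  have "lindep {..<CARD('n)} (\<lambda>k. complex_of_real (1 - u) \<cdot> ?f k + complex_of_real u \<cdot> gram_schmidt ?f k)"
    using lindep_stack[of A] assms by (intro gram_schmidt_interpolate_lindep) (simp_all add: lindep_reindex[OF bij_betw_unidx])
  then have "lindep {..<CARD('n)} (\<lambda>k. mulm (stack A) (chol_path u A) (unidx k))"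
    using eq unfolding lindep_def by simp
  then show ?thesis unfolding lindep_reindex[OF bij_betw_unidx] by (rule lindep_mulm_imp_invertible)
qed

lemma chol_of_unitary:
  fixes A :: "complex ^ 'n ^ 'n"
  assumes "A \<in> unitary_matrices"
  shows "chol A = mat 1"
proof -
  have A: "adj A ** A = mat 1" using assms by (simp add: unitary_matrices_iff)
  then have inv: "matrix_inv A = adj A" by (rule matrix_inv_eqI)
  have "adj (adj A) = A" by (simp add: vec_eq_iff)
  then have "adj (matrix_inv A) ** matrix_inv A = mat 1"
    using A matrix_left_right_inverse unfolding inv by metis
  then have "gram A = mat 1" by (simp add: gram_def vec_eq_iff mat_def)
  then have "hip (stack A j) (stack A i) = (if i = j then 1 else 0)" for i j
    by (simp add: hip_stack mat_def)
  then have "orthonormal CARD('n) (\<lambda>k. stack A (unidx k))"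
    using inj_on_eq_iff[OF bij_betw_imp_inj_on[OF bij_betw_unidx[where 'n = 'n]]]
    by (auto simp: orthonormal_def)
  then have "gs_stack A j = stack A j" for j
    using gram_schmidt_of_orthonormal[of "CARD('n)" "\<lambda>k. stack A (unidx k)" "idx j"] idx_less[of j]
    by (simp add: gs_stack_def)
  then have "mulm (stack A) (chol A) = mulm (stack A) (mat 1)"
    by (simp add: fun_eq_iff mulm_one flip: gs_stack_chol)
  then show ?thesis by (simp add: mulm_inject[OF lindep_stack])
qed

lemma continuous_on_chol:
  fixes A :: "'s::topological_space \<Rightarrow> complex ^ 'n ^ 'n"
  assumes A: "continuous_on S A" "\<And>x. x \<in> S \<Longrightarrow> invertible (A x)"
  shows "continuous_on S (\<lambda>x. chol (A x))"
proof -
  have st: "continuous_on S (\<lambda>x. stack (A x) j)" for j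
    unfolding stack_def
    by (intro continuous_on_scl continuous_on_add continuous_on_const continuous_on_mulm
        continuous_on_matrix_inv A)
  have "continuous_on S (\<lambda>x. gs_stack (A x) j)" for j
    unfolding continuous_on_def gs_stack_def
  proof
    fix x assume "x \<in> S"
    then show "((\<lambda>x. gram_schmidt (\<lambda>k. stack (A x) (unidx k)) (idx j)) \<longlongrightarrow>
        gram_schmidt (\<lambda>k. stack (A x) (unidx k)) (idx j)) (at x within S)"
      using st lindep_stack[of "A x"] idx_less[of j]
      by (intro tendsto_gram_schmidt[where n = "CARD('n)"]) (auto simp: continuous_on_def lindep_reindex[OF bij_betw_unidx])
  qed
  then show ?thesis
    unfolding chol_def by (intro continuous_on_vec_lambda continuous_on_mult continuous_on_const continuous_on_lookup)
qed

text \<open>The involution on GL(n) induced by conjugating and reversing loops; on unitary matrices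
  it is the transpose.\<close>

definition dual :: "complex ^ 'n ^ 'n \<Rightarrow> complex ^ 'n ^ 'n" where
  "dual A = mcnj (matrix_inv A)"

lemma mcnj_dual: "invertible A \<Longrightarrow> mcnj A ** dual A = mat 1" "invertible A \<Longrightarrow> dual A ** mcnj A = mat 1"
  by (simp_all add: dual_def matrix_inv_props flip: mcnj_mult)

lemma invertible_dual: "invertible A \<Longrightarrow> invertible (dual A)"
  using mcnj_dual unfolding invertible_def by blast

lemma gram_dual:
  fixes A :: "complex ^ 'n ^ 'n"
  assumes "invertible A"
  shows "adj A ** gram A ** A = mcnj (gram (dual A))"
proof -
  let ?B = "matrix_inv A"
  have half: "X ** (\<chi> i j. M $ i $ j / 2) ** Y = (\<chi> i j. (X ** M ** Y) $ i $ j / 2)"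
    for X Y M :: "complex ^ 'n ^ 'n"
    by (simp add: vec_eq_iff matrix_matrix_mult_def sum_distrib_left sum_distrib_right sum_divide_distrib)
  have distr: "X ** (M + M') ** Y = X ** M ** Y + X ** M' ** Y" for X Y M M' :: "complex ^ 'n ^ 'n"
    by (simp add: vec_eq_iff matrix_matrix_mult_def algebra_simps sum.distrib)
  have "adj A ** adj ?B = mat 1"
    using matrix_inv_props(2)[OF assms] by (simp flip: adj_mult)
  then have "adj A ** (adj ?B ** ?B) ** A = mat 1"
    using matrix_inv_props(2)[OF assms] by (metis matrix_mul_assoc matrix_mul_lid)
  then have 1: "adj A ** gram A ** A = (\<chi> i j. (adj A ** A + mat 1) $ i $ j / 2)"
    unfolding gram_def half distr by simp
  have inv: "matrix_inv (dual A) = mcnj A"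
    using mcnj_dual(1)[OF assms] by (rule matrix_inv_eqI)
  then have 2: "mcnj (gram (dual A)) = (\<chi> i j. (mcnj (mat 1 + adj (mcnj A) ** mcnj A)) $ i $ j / 2)"
    unfolding gram_def inv by (simp add: vec_eq_iff)
  have "mcnj (mat 1 + adj (mcnj A) ** mcnj A) = adj A ** A + mat 1"
  proof -
    have "mcnj (mat 1 + adj (mcnj A) ** mcnj A) = mcnj (mat 1) + mcnj (adj (mcnj A) ** mcnj A)"
      by (simp add: vec_eq_iff mat_def)
    then show ?thesis by (simp add: mcnj_mult adj_mcnj add.commute)
  qed
  then show ?thesis using 1 2 by simp
qed

text \<open>The left factor comes from \<open>A\<close>, the right one from \<open>dual A\<close>,
  so that the formula is compatible with \<open>dual\<close>. A correction on one side only would in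
  general destroy the equation \<open>mcnj A ** A = mat 1\<close>.\<close>

definition rho :: "real \<Rightarrow> complex ^ 'n ^ 'n \<Rightarrow> complex ^ 'n ^ 'n" where
  "rho u A = matrix_inv (chol_path u A) ** A ** mcnj (chol_path u (dual A))"

lemma chol_path_0 [simp]: "chol_path 0 A = mat 1" and chol_path_1 [simp]: "chol_path 1 A = chol A"
  by (simp_all add: chol_path_def vec_eq_iff)

lemma matrix_inv_one [simp]: "matrix_inv (mat 1 :: complex ^ 'n ^ 'n) = mat 1"
  by (rule matrix_inv_eqI) simp

lemma rho_0: "rho 0 A = A"
  by (simp add: rho_def)

lemma invertible_mcnj: "invertible A \<Longrightarrow> invertible (mcnj A)"
  unfolding invertible_def by (metis mcnj_mult mcnj_one)

lemma invertible_matrix_inv: "invertible A \<Longrightarrow> invertible (matrix_inv A)"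
  for A :: "complex ^ 'n ^ 'n"
  using matrix_inv_props unfolding invertible_def by blast

lemma invertible_rho:
  assumes "invertible A" "u \<in> {0..1}"
  shows "invertible (rho u A)"
  unfolding rho_def
  by (intro invertible_mult invertible_matrix_inv invertible_mcnj invertible_chol_path assms)

lemma rho_1_unitary:
  fixes A :: "complex ^ 'n ^ 'n"
  assumes A: "invertible A"
  shows "rho 1 A \<in> unitary_matrices"
proof -
  let ?C = "chol A" and ?D = "chol (dual A)"
  let ?E = "matrix_inv ?C"
  have C: "invertible ?C" using invertible_chol_path[of 1 A] by simp
  have CE: "?C ** ?E = mat 1" using matrix_inv_props[OF C] by simp
  have "adj ?E ** adj ?C = mat 1" using CE by (simp flip: adj_mult)
  then have "gram A = (adj ?E ** adj ?C) ** gram A ** (?C ** ?E)" by (simp add: CE)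
  also have "\<dots> = adj ?E ** (adj ?C ** gram A ** ?C) ** ?E" by (simp add: matrix_mul_assoc)
  finally have gram: "gram A = adj ?E ** ?E" by (simp add: chol_gram)
  have "adj (rho 1 A) ** rho 1 A = adj (mcnj ?D) ** (adj A ** (adj ?E ** ?E) ** A) ** mcnj ?D"
    by (simp add: rho_def adj_mult matrix_mul_assoc)
  also have "\<dots> = adj (mcnj ?D) ** mcnj (gram (dual A)) ** mcnj ?D"
    using gram_dual[OF A] gram by simp
  also have "\<dots> = mcnj (adj ?D ** gram (dual A) ** ?D)"
    by (simp add: mcnj_mult adj_mcnj)
  finally show ?thesis by (simp add: chol_gram unitary_matrices_iff)
qed

lemma dual_unitary:
  assumes "A \<in> unitary_matrices"
  shows "dual A = transpose A" "transpose A \<in> unitary_matrices"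
proof -
  have A: "adj A ** A = mat 1" using assms by (simp add: unitary_matrices_iff)
  then have inv: "matrix_inv A = adj A" by (rule matrix_inv_eqI)
  then show d: "dual A = transpose A" by (simp add: dual_def adj_def)
  have "adj (transpose A) = mcnj A" by (simp add: adj_def)
  moreover have "mcnj A ** transpose A = mat 1"
    using mcnj_dual(1)[OF matrix_inv_eqI(1)[OF A]] d by simp
  ultimately show "transpose A \<in> unitary_matrices" by (simp add: unitary_matrices_iff)
qed

lemma rho_unitary:
  assumes "A \<in> unitary_matrices"
  shows "rho u A = A"
proof -
  have path: "chol_path u B = mat 1" if "B \<in> unitary_matrices" for B :: "complex ^ 'a ^ 'a"
    by (simp add: chol_path_def chol_of_unitary[OF that] vec_eq_iff flip: distrib_right)
  show ?thesis
    unfolding rho_def dual_unitary(1)[OF assms] path[OF assms] path[OF dual_unitary(2)[OF assms]]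
    by simp
qed

text \<open>Here \<open>dual A = A\<close>, so \<open>rho\<close> multiplies \<open>A\<close> by the
  inverse of a matrix on the left and by its conjugate on the right; these cancel in the
  product.\<close>

lemma rho_real:
  fixes A :: "complex ^ 'n ^ 'n"
  assumes A: "mcnj A ** A = mat 1" and u: "u \<in> {0..1}"
  shows "mcnj (rho u A) ** rho u A = mat 1"
proof -
  have "dual A = A" using matrix_inv_eqI(2)[OF A] by (simp add: dual_def)
  then have rho: "rho u A = matrix_inv (chol_path u A) ** A ** mcnj (chol_path u A)" by (simp add: rho_def)
  let ?C = "chol_path u A"
  note C = matrix_inv_props[OF invertible_chol_path[OF u, of A]]
  have "mcnj (rho u A) ** rho u A =
      mcnj (matrix_inv ?C) ** (mcnj A ** (?C ** matrix_inv ?C) ** A) ** mcnj ?C"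
    by (simp add: rho mcnj_mult matrix_mul_assoc)
  also have "\<dots> = mcnj (matrix_inv ?C) ** mcnj ?C" by (simp add: C A)
  also have "\<dots> = mcnj (matrix_inv ?C ** ?C)" by (rule mcnj_mult[symmetric])
  finally show ?thesis by (simp add: C)
qed

lemma continuous_on_chol_path:
  assumes "continuous_on S A" "\<And>x. x \<in> S \<Longrightarrow> invertible (A x)" "continuous_on S u"
  shows "continuous_on S (\<lambda>x. chol_path (u x) (A x))"
  unfolding chol_path_def using continuous_on_chol[OF assms(1,2)] assms(3)
  by (intro continuous_intros)

lemma continuous_on_mcnj: "continuous_on S A \<Longrightarrow> continuous_on S (\<lambda>x. mcnj (A x))"
  unfolding mcnj_def by (intro continuous_intros)

lemma continuous_on_rho:
  assumes A: "continuous_on S A" "\<And>x. x \<in> S \<Longrightarrow> invertible (A x)" and u: "continuous_on S u" "\<And>x. x \<in> S \<Longrightarrow> u x \<in> {0..1}"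
  shows "continuous_on S (\<lambda>x. rho (u x) (A x))"
proof -
  have "continuous_on S (\<lambda>x. dual (A x))"
    unfolding dual_def using A by (intro continuous_on_mcnj continuous_on_matrix_inv)
  then show ?thesis
    unfolding rho_def using A u
    by (intro continuous_on_matrix_mult continuous_on_matrix_inv continuous_on_mcnj continuous_on_chol_path
        invertible_chol_path invertible_dual)
qed

section \<open>The equivalence\<close>

text \<open>With \<open>fx = False\<close> this is the underlying space, with \<open>fx = True\<close> the fixed point space.\<close>

definition U_fx :: "bool \<Rightarrow> (complex ^ 'n ^ 'n) set" where
  "U_fx fx = {A \<in> unitary_matrices. fx \<longrightarrow> transpose A = A}"

lemma U_fx_props:
  assumes "A \<in> U_fx fx"
  shows "A \<in> unitary_matrices" "invertible A" "fx \<Longrightarrow> mcnj A ** A = mat 1"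
proof -
  show u: "A \<in> unitary_matrices" using assms by (simp add: U_fx_def)
  then have "adj A ** A = mat 1" by (simp add: unitary_matrices_iff)
  then show inv: "invertible A" by (rule matrix_inv_eqI(1))
  assume fx
  then have "dual A = A" using assms dual_unitary(1)[OF u] by (simp add: U_fx_def)
  then show "mcnj A ** A = mat 1" using mcnj_dual(1)[OF inv] by simp
qed

lemma real_unitary_in_U_fx:
  assumes "A \<in> unitary_matrices" "fx \<Longrightarrow> mcnj A ** A = mat 1"
  shows "A \<in> U_fx fx"
proof -
  have "transpose A = A" if fx
    using dual_unitary(1)[OF assms(1)] matrix_inv_eqI(2)[OF assms(2)[OF that]]
    by (simp add: dual_def)
  then show ?thesis using assms(1) by (simp add: U_fx_def)
qed

text \<open>The model loop with clutching matrix \<open>A\<close>.\<close>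

definition bott :: "complex ^ 'n ^ 'n \<Rightarrow> real option \<Rightarrow> cinf set" where
  "bott A = frame_loop (sec A)"

lemma continuous_map_bott:
  "continuous_map (top_of_set (U_fx fx)) (Omega_fx fx CARD('n)) (bott :: complex ^ 'n ^ 'n \<Rightarrow> _)"
proof -
  have "good_family fx (U_fx fx) (\<lambda>A :: complex ^ 'n ^ 'n. sec A) (\<lambda>A. A)"
    by (intro good_family_sec continuous_on_id) (simp_all add: U_fx_props)
  from good_family_map[OF this] show ?thesis by (simp add: bott_def[abs_def])
qed

lemma homotopic_rel_eq:
  fixes \<alpha> :: "'k::topological_space \<Rightarrow> 'y"
  assumes "homotopic_with (\<lambda>u. \<forall>l\<in>L. u l = \<alpha> l) (top_of_set K) Y f g" "L \<subseteq> K"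
    and "\<And>x. x \<in> K \<Longrightarrow> f' x = f x" "\<And>x. x \<in> K \<Longrightarrow> g' x = g x"
  shows "homotopic_with (\<lambda>u. \<forall>l\<in>L. u l = \<alpha> l) (top_of_set K) Y f' g'"
  using assms(1)
proof (rule homotopic_with_eq)
  fix u v :: "'k \<Rightarrow> 'y" assume "\<And>x. x \<in> topspace (top_of_set K) \<Longrightarrow> u x = v x"
  then have "\<forall>l\<in>L. u l = v l" using assms(2) by auto
  then show "(\<forall>l\<in>L. u l = \<alpha> l) \<longleftrightarrow> (\<forall>l\<in>L. v l = \<alpha> l)" by simp
qed (use assms in auto)

lemma rel_homotopy_lifting_bott:
  fixes K L :: "'k::{metric_space,second_countable_topology} set"
  assumes K: "compact K" and L: "closed L" "L \<subseteq> K"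
  shows "rel_homotopy_lifting (top_of_set (U_fx fx)) (Omega_fx fx CARD('n))
           (bott :: complex ^ 'n ^ 'n \<Rightarrow> _) K L"
  unfolding rel_homotopy_lifting_def
proof (intro allI impI, elim conjE)
  fix \<alpha> and \<beta> :: "'k \<Rightarrow> complex ^ 'n ^ 'n"
  assume \<alpha>: "continuous_map (top_of_set K) (Omega_fx fx CARD('n)) \<alpha>"
    and \<beta>: "continuous_map (top_of_set L) (top_of_set (U_fx fx)) \<beta>"
    and eq: "\<forall>l\<in>L. bott (\<beta> l) = \<alpha> l"
  have \<beta>c: "continuous_on L \<beta>" and \<beta>_in: "\<And>l. l \<in> L \<Longrightarrow> \<beta> l \<in> U_fx fx"
    using \<beta> by (auto simp: continuous_map_in_subtopology)
  obtain h A where good: "good_family fx K h (A :: 'k \<Rightarrow> complex ^ 'n ^ 'n)" and Ac: "continuous_on K A"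
    and h\<alpha>: "\<And>k. k \<in> K \<Longrightarrow> frame_loop (h k) = \<alpha> k"
    and hL: "\<And>l t. l \<in> L \<Longrightarrow> t \<in> {-1..1} \<Longrightarrow> h l t = sec (\<beta> l) t" and AL: "\<And>l. l \<in> L \<Longrightarrow> A l = \<beta> l"
  proof (rule frame_lift[OF K L \<alpha> \<beta>c])
    show "\<alpha> l = frame_loop (sec (\<beta> l))" if "l \<in> L" for l
      using eq that by (simp add: bott_def)
  qed (use \<beta>_in U_fx_props in blast)+
  have inv: "invertible (A k)" if "k \<in> K" for k using good that by (rule good_family_invertible)
  have real: "mcnj (A k) ** A k = mat 1" if fx "k \<in> K" for k
    using good_family_real[of K h A k] good that by simp
  \<comment> \<open>Over \<open>L\<close> the matrix is already unitary and \<open>rho\<close> fixes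
    it, so \<open>\<gamma>\<close> extends \<open>\<beta>\<close> exactly.\<close>
  define \<gamma> where "\<gamma> k = rho 1 (A k)" for k
  have \<gamma>L: "\<gamma> l = \<beta> l" if "l \<in> L" for l
    using rho_unitary[OF U_fx_props(1)[OF \<beta>_in[OF that]]] AL[OF that] by (simp add: \<gamma>_def)
  have "\<gamma> k \<in> U_fx fx" if k: "k \<in> K" for k
    unfolding \<gamma>_def using rho_1_unitary[OF inv[OF k]] rho_real[OF real[OF _ k]]
    by (intro real_unitary_in_U_fx) auto
  moreover have "continuous_on K \<gamma>"
    unfolding \<gamma>_def using Ac inv by (intro continuous_on_rho continuous_on_const) auto
  ultimately have \<gamma>: "continuous_map (top_of_set K) (top_of_set (U_fx fx)) \<gamma>"
    by (auto simp: continuous_map_in_subtopology)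
  let ?P = "\<lambda>f. \<forall>l\<in>L. f l = \<alpha> l"
  have 1: "homotopic_with ?P (top_of_set K) (Omega_fx fx CARD('n)) \<alpha> (\<lambda>k. frame_loop (sec (A k)))"
  proof (rule homotopic_rel_eq[OF _ L(2)])
    have "homotopic_with (\<lambda>f. \<forall>l\<in>L. f l = frame_loop (h l)) (top_of_set K) (Omega_fx fx CARD('n))
        (\<lambda>k. frame_loop (h k)) (\<lambda>k. frame_loop (sec (A k)))"
      by (rule good_family_homotopic_sec[OF good Ac L]) (simp add: hL AL)
    then show "homotopic_with ?P (top_of_set K) (Omega_fx fx CARD('n))
        (\<lambda>k. frame_loop (h k)) (\<lambda>k. frame_loop (sec (A k)))"
      by (rule homotopic_with_mono) (use h\<alpha> L(2) in auto)
  qed (simp_all add: h\<alpha>)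
  have "good_family fx ({0..1} \<times> K) (\<lambda>p. sec (rho (fst p) (A (snd p)))) (\<lambda>p. rho (fst p) (A (snd p)))"
  proof (rule good_family_sec)
    show "continuous_on ({0..1} \<times> K) (\<lambda>p. rho (fst p) (A (snd p)))"
      using inv by (intro continuous_on_rho continuous_on_compose2[OF Ac] continuous_intros) auto
  qed (auto intro!: invertible_rho rho_real inv real)
  then have "homotopic_with ?P (top_of_set K) (Omega_fx fx CARD('n))
      (\<lambda>k. frame_loop (sec (rho 0 (A k)))) (\<lambda>k. frame_loop (sec (rho 1 (A k))))"
  proof (rule good_family_homotopic)
    fix u l assume "l \<in> L"
    then show "frame_loop (sec (rho u (A l))) = \<alpha> l"
      using rho_unitary[OF U_fx_props(1)[OF \<beta>_in]] AL eq by (simp add: bott_def)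
  qed
  then have 2: "homotopic_with ?P (top_of_set K) (Omega_fx fx CARD('n))
      (\<lambda>k. frame_loop (sec (A k))) (bott \<circ> \<gamma>)"
    by (simp add: rho_0 bott_def \<gamma>_def o_def)
  show "\<exists>\<gamma>. continuous_map (top_of_set K) (top_of_set (U_fx fx)) \<gamma> \<and> (\<forall>l\<in>L. \<gamma> l = \<beta> l) \<and>
      homotopic_with ?P (top_of_set K) (Omega_fx fx CARD('n)) \<alpha> (bott \<circ> \<gamma>)"
    using \<gamma> \<gamma>L homotopic_with_trans[OF 1 2] by blast
qed

text \<open>For passing to the copy of the unitary group inside the sum type that
  \<open>C2_equivalent\<close> demands.\<close>

lemma rel_homotopy_lifting_homeo:
  assumes f: "rel_homotopy_lifting X Y f K L"
    and p: "continuous_map T X p" and i: "continuous_map X T i"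
    and inverse: "\<And>z. z \<in> topspace T \<Longrightarrow> i (p z) = z" "\<And>x. x \<in> topspace X \<Longrightarrow> p (i x) = x"
    and L: "L \<subseteq> K"
  shows "rel_homotopy_lifting T Y (f \<circ> p) K L"
  unfolding rel_homotopy_lifting_def
proof (intro allI impI, elim conjE)
  fix \<alpha> \<beta>
  assume \<alpha>: "continuous_map (top_of_set K) Y \<alpha>" and \<beta>: "continuous_map (top_of_set L) T \<beta>"
    and eq: "\<forall>l\<in>L. (f \<circ> p) (\<beta> l) = \<alpha> l"
  have "continuous_map (top_of_set L) X (p \<circ> \<beta>)" using \<beta> p by (rule continuous_map_compose)
  with f \<alpha> obtain \<gamma> where \<gamma>: "continuous_map (top_of_set K) X \<gamma>" "\<forall>l\<in>L. \<gamma> l = (p \<circ> \<beta>) l"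
    "homotopic_with (\<lambda>u. \<forall>l\<in>L. u l = \<alpha> l) (top_of_set K) Y \<alpha> (f \<circ> \<gamma>)"
    by (rule rel_homotopy_liftingE) (use eq in auto)
  have "continuous_map (top_of_set K) T (i \<circ> \<gamma>)" using \<gamma>(1) i by (rule continuous_map_compose)
  moreover have "\<forall>l\<in>L. (i \<circ> \<gamma>) l = \<beta> l"
    using \<gamma>(2) \<beta> inverse(1) by (auto simp: continuous_map_def Pi_iff)
  moreover have "homotopic_with (\<lambda>u. \<forall>l\<in>L. u l = \<alpha> l) (top_of_set K) Y \<alpha> ((f \<circ> p) \<circ> (i \<circ> \<gamma>))"
  proof (rule homotopic_rel_eq[OF \<gamma>(3) L])
    fix k assume "k \<in> K"
    then have "\<gamma> k \<in> topspace X" using \<gamma>(1) by (auto simp: continuous_map_def Pi_iff)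
    then show "((f \<circ> p) \<circ> (i \<circ> \<gamma>)) k = (f \<circ> \<gamma>) k" using inverse(2) by simp
  qed simp
  ultimately show "\<exists>\<gamma>. continuous_map (top_of_set K) T \<gamma> \<and> (\<forall>l\<in>L. \<gamma> l = \<beta> l) \<and>
      homotopic_with (\<lambda>u. \<forall>l\<in>L. u l = \<alpha> l) (top_of_set K) Y \<alpha> ((f \<circ> p) \<circ> \<gamma>)"
    by blast
qed

lemma rel_homotopy_lifting_id:
  assumes "L \<subseteq> K"
  shows "rel_homotopy_lifting X X (\<lambda>x. x) K L"
  unfolding rel_homotopy_lifting_def
proof (intro allI impI, elim conjE)
  fix \<alpha> \<beta> assume \<alpha>: "continuous_map (top_of_set K) X \<alpha>" and "\<forall>l\<in>L. \<beta> l = \<alpha> l"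
  then show "\<exists>\<gamma>. continuous_map (top_of_set K) X \<gamma> \<and> (\<forall>l\<in>L. \<gamma> l = \<beta> l) \<and>
      homotopic_with (\<lambda>u. \<forall>l\<in>L. u l = \<alpha> l) (top_of_set K) X \<alpha> ((\<lambda>x. x) \<circ> \<gamma>)"
    by (intro exI[of _ \<alpha>]) (simp add: o_def)
qed

section \<open>The involutions on the unitary group and on the loop space\<close>

lemma continuous_map_transpose: "continuous_on S (transpose :: complex ^ 'n ^ 'n \<Rightarrow> _)"
  unfolding transpose_def by (intro continuous_intros)

lemma transpose_unitary: "A \<in> unitary_matrices \<Longrightarrow> transpose A \<in> unitary_matrices"
  by (rule dual_unitary(2))

lemma C2_space_U_tau: "C2_space (U_tau :: (complex ^ 'n ^ 'n) C2space)"
  unfolding C2_space_def U_tau_def fst_conv snd_conv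
  by (auto simp: continuous_map_in_subtopology continuous_map_transpose transpose_unitary transpose_transpose)

lemma cinf_cnj_cfin: "cinf_cnj ` cfin m = cfin m"
proof -
  have "cinf_cnj v \<in> cfin m" if "v \<in> cfin m" for v using that by (simp add: cfin_iff)
  then show ?thesis by (metis (no_types, lifting) cinf_cnj_cnj image_eqI image_subsetI subsetI subset_antisym)
qed

lemma act_Omega: "act (Omega_sigma (Gr_tau n) y) f = (\<lambda>s. cinf_cnj ` f (map_option uminus s))"
  by (simp add: Omega_sigma_def Gr_tau_def sign_sphere_def o_def)

lemma underlying_Omega:
  "underlying (Omega_sigma (Gr_tau n) (cfin n)) = sign_loop_topology (grassmannian_topology n) (cfin n)"
  by (simp add: Omega_sigma_def Gr_tau_def)

lemma Omega_fx_False: "Omega_fx False n = underlying (Omega_sigma (Gr_tau n) (cfin n))"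
  by (simp add: Omega_fx_def underlying_Omega)

lemma Omega_fx_True: "Omega_fx True n = fixed_points (Omega_sigma (Gr_tau n) (cfin n))"
proof -
  let ?S = "{f. (\<lambda>s. cinf_cnj ` f (map_option uminus s)) = f}"
  have "subtopology (underlying (Omega_sigma (Gr_tau n) (cfin n))) ?S =
      subtopology (underlying (Omega_sigma (Gr_tau n) (cfin n)))
        (topspace (underlying (Omega_sigma (Gr_tau n) (cfin n))) \<inter> ?S)"
    by (rule subtopology_restrict[symmetric])
  moreover have "topspace (underlying (Omega_sigma (Gr_tau n) (cfin n))) \<inter> ?S =
      {x \<in> topspace (underlying (Omega_sigma (Gr_tau n) (cfin n))). act (Omega_sigma (Gr_tau n) (cfin n)) x = x}"
    unfolding act_Omega by auto
  ultimately show ?thesis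
    unfolding Omega_fx_def fixed_points_def underlying_Omega[symmetric] by simp
qed

text \<open>Continuity of the action uses both halves of the exponential law: evaluate at the
  reversed parameter, conjugate, and return to loops.\<close>

lemma C2_space_Omega:
  assumes n: "n \<ge> 1"
  shows "C2_space (Omega_sigma (Gr_tau n) (cfin n))"
proof -
  let ?Gr = "grassmannian_topology n"
  let ?O = "sign_loop_topology ?Gr (cfin n)"
  let ?I = "top_of_set {-1..1::real}"
  let ?G = "\<lambda>f u. cinf_cnj ` f (compactify (-u))"
  have 1: "continuous_map (prod_topology ?O ?I) ?Gr (\<lambda>(f, u). f (compactify u))"
    by (rule continuous_map_eval_loop[of _ _ "cfin n" "\<lambda>f. f"]) simp
  have "continuous_map ?I ?I uminus"
    by (auto simp: continuous_map_in_subtopology intro!: continuous_intros)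
  then have 2: "continuous_map (prod_topology ?O ?I) (prod_topology ?O ?I) (\<lambda>(f, u). (f, -u))"
    using continuous_map_prod_top[of ?O ?I ?O ?I "\<lambda>f. f" uminus] by (simp add: case_prod_unfold)
  have "continuous_map (prod_topology ?O ?I) ?Gr
      (image cinf_cnj \<circ> ((\<lambda>(f, u). f (compactify u)) \<circ> (\<lambda>(f, u). (f, -u))))"
    by (rule continuous_map_compose[OF continuous_map_compose[OF 2 1] continuous_map_cnj_grassmannian[OF n]])
  then have "continuous_map (prod_topology ?O ?I) ?Gr (\<lambda>(f, u). ?G f u)"
    by (simp add: o_def case_prod_unfold)
  then have "continuous_map ?O ?O (\<lambda>f. loop_of (?G f))"
    by (rule continuous_map_loop_of) (auto simp: compactify_def sign_loops_def cinf_cnj_cfin)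
  moreover have "loop_of (?G f) = (\<lambda>s. cinf_cnj ` f (map_option uminus s))" for f
    by (simp add: fun_eq_iff loop_of_def compactify_uminus compactify_uncompactify)
  ultimately have "continuous_map ?O ?O (\<lambda>f s. cinf_cnj ` f (map_option uminus s))" by simp
  then show ?thesis
    unfolding C2_space_def underlying_Omega act_Omega
    by (simp add: image_image option.map_comp o_def option.map_ident act_Omega[abs_def])
qed

theorem proposition4p15:
  shows "C2_equivalent
           (Omega_sigma (Gr_tau CARD('n::finite)) (cfin CARD('n)))
           (U_tau :: (complex ^ 'n ^ 'n) C2space)"
proof -
  let ?n = "CARD('n)"
  let ?O = "Omega_sigma (Gr_tau ?n) (cfin ?n)"
  let ?U = "unitary_matrices :: (complex ^ 'n ^ 'n) set"
  let ?Inr = "Inr :: complex ^ 'n ^ 'n \<Rightarrow> (real option \<Rightarrow> cinf set) + (complex ^ 'n ^ 'n)"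
  \<comment> \<open>A copy of the unitary group in the right summand is the only intermediate space;
    both legs of the zigzag start from it.\<close>
  define T where "T = pullback_topology (range ?Inr) projr (top_of_set ?U)"
  define C :: "((real option \<Rightarrow> cinf set) + (complex ^ 'n ^ 'n)) C2space" where "C = (T, \<lambda>z. ?Inr (transpose (projr z)))"
  have topT: "topspace T = ?Inr ` ?U"
    by (auto simp: T_def topspace_pullback_topology)
  have p: "continuous_map T (top_of_set ?U) projr"
    unfolding T_def using continuous_map_pullback[OF continuous_map_id] by simp
  have i: "continuous_map (top_of_set ?U) T ?Inr"
    unfolding T_def by (rule continuous_map_pullback') (auto simp: o_def)
  have fix_C: "fixed_points C = subtopology T {z \<in> topspace T. transpose (projr z) = projr z}"
    unfolding fixed_points_def C_def fst_conv snd_conv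
    by (rule arg_cong[of _ _ "subtopology T"]) (auto simp: topT)
  \<comment> \<open>The flag matches that of \<open>U_fx\<close> and \<open>Omega_fx\<close>, so
    underlying spaces and fixed points are handled together.\<close>
  define TT where "TT fx = (if fx then fixed_points C else underlying C)" for fx
  have TT_eq: "TT fx = subtopology T {z. fx \<longrightarrow> transpose (projr z) = projr z}" for fx
  proof (cases fx)
    case True
    then show ?thesis
      using subtopology_restrict[of T "{z. transpose (projr z) = projr z}"]
      by (simp add: TT_def fix_C Int_def conj_commute)
  qed (simp add: TT_def C_def)
  have topTT: "topspace (TT fx) = ?Inr ` U_fx fx" for fx
    by (auto simp: TT_eq topT U_fx_def)
  have pp: "continuous_map (TT fx) (top_of_set (U_fx fx)) projr" for fx
  proof -
    have "continuous_map (TT fx) (top_of_set ?U) projr"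
      unfolding TT_eq using p by (rule continuous_map_from_subtopology)
    moreover have "projr z \<in> U_fx fx" if "z \<in> topspace (TT fx)" for z
      using that topTT by auto
    ultimately show ?thesis by (simp add: continuous_map_in_subtopology Pi_iff)
  qed
  have ii: "continuous_map (top_of_set (U_fx fx)) (TT fx) ?Inr" for fx
  proof -
    have "top_of_set (U_fx fx) = subtopology (top_of_set ?U) (U_fx fx)"
      unfolding subtopology_subtopology by (rule arg_cong) (auto simp: U_fx_def)
    then have "continuous_map (top_of_set (U_fx fx)) T ?Inr"
      using continuous_map_from_subtopology[OF i] by simp
    then show ?thesis by (auto simp: TT_eq continuous_map_in_subtopology U_fx_def)
  qed
  have inverse: "?Inr (projr z) = z" if "z \<in> topspace (TT fx)" for z fx
    using that topTT by auto
  have C2_C: "C2_space C"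
  proof -
    have t: "continuous_map (top_of_set ?U) (top_of_set ?U) transpose"
      using C2_space_U_tau[where 'n = 'n] by (simp add: C2_space_def U_tau_def)
    have "continuous_map T T (?Inr \<circ> (transpose \<circ> projr))"
      by (rule continuous_map_compose[OF continuous_map_compose[OF p t] i])
    then show ?thesis by (auto simp: C2_space_def C_def topT o_def transpose_transpose)
  qed
  have lift_bott: "rel_homotopy_lifting (TT fx) (Omega_fx fx ?n) (bott \<circ> projr) K L"
    if "compact K" "closed L" "L \<subseteq> K" for fx and K L :: "'k::{metric_space,second_countable_topology} set"
    by (rule rel_homotopy_lifting_homeo[OF rel_homotopy_lifting_bott[OF that] pp ii inverse _ that(3)]) auto
  have lift_id: "rel_homotopy_lifting (TT fx) (top_of_set (U_fx fx)) projr K L"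
    if "L \<subseteq> K" for fx and K L :: "'k::topological_space set"
    using rel_homotopy_lifting_homeo[OF rel_homotopy_lifting_id[OF that] pp ii inverse _ that]
    by (simp add: o_def)
  have "weak_equivalence (TT fx) (Omega_fx fx ?n) (bott \<circ> projr)" for fx
    by (intro weak_equivalence_of_rel_lifting lift_bott continuous_map_compose[OF pp continuous_map_bott])
  note we_bott = this[of False] this[of True]
  have "weak_equivalence (TT fx) (top_of_set (U_fx fx)) projr" for fx
    by (intro weak_equivalence_of_rel_lifting lift_id pp)
  note we_id = this[of False] this[of True]
  have TT: "TT False = underlying C" "TT True = fixed_points C" by (simp_all add: TT_def)
  have U: "top_of_set (U_fx False) = underlying (U_tau :: (complex ^ 'n ^ 'n) C2space)"
    "top_of_set (U_fx True) = fixed_points (U_tau :: (complex ^ 'n ^ 'n) C2space)"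
    by (auto simp: U_tau_def U_fx_def fixed_points_def subtopology_subtopology
        intro!: arg_cong[of _ _ "subtopology euclidean"])
  have equivariant: "bott (transpose A) = act ?O (bott A)" if A: "A \<in> ?U" for A
  proof -
    have A': "transpose A \<in> ?U" using A by (rule transpose_unitary)
    have inv: "invertible A" "invertible (transpose A)"
      using A A' U_fx_props(2)[of _ False] by (simp_all add: U_fx_def)
    have "mcnj A ** transpose A = mat 1"
      using mcnj_dual(1)[OF inv(1)] dual_unitary(1)[OF A] by simp
    then have "sec (transpose A) (-t) = mulm (\<lambda>i. cinf_cnj (sec A t i)) (transpose A)" for t
      by (rule cnj_sec[symmetric])
    then show ?thesis
      unfolding act_Omega bott_def
      using cinf_cnj_frame_loop[OF sec_ends inv(1) sec_ends inv(2)] by simp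
  qed
  have "C2_weak_equivalence C ?O (bott \<circ> projr)"
    unfolding C2_weak_equivalence_def
  proof (intro conjI ballI)
    show "C2_space ?O" by (rule C2_space_Omega) (simp add: Suc_leI)
    fix z assume "z \<in> topspace (underlying C)"
    then obtain A where "A \<in> ?U" "z = ?Inr A" by (auto simp: C_def topT)
    then show "(bott \<circ> projr) (act C z) = act ?O ((bott \<circ> projr) z)"
      using equivariant by (simp add: C_def)
  qed (use C2_C we_bott in \<open>simp_all add: TT Omega_fx_False Omega_fx_True\<close>)
  moreover have "C2_weak_equivalence C (U_tau :: (complex ^ 'n ^ 'n) C2space) projr"
    unfolding C2_weak_equivalence_def
    using C2_C C2_space_U_tau[where 'n = 'n] we_id by (simp add: TT U) (simp add: C_def U_tau_def)
  moreover have "equivclp (\<lambda>V W. \<exists>f. C2_weak_equivalence V W f) C C"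
    by (simp add: equivclp_def)
  ultimately show ?thesis unfolding C2_equivalent_def by blast
qed

end
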